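(* Suppose that conditions (A1)–(A4) hold with $s\geq 4$. Then there is a polynomial $P_1$ such that $$\mathbb{P}\left(\frac{S_N-NA}{\sqrt{N}}\leq z\right)=\mathfrak{N}(z)+\frac{P_1(z)}{N^{1/2}}\,\mathfrak{n}(z)+\mathcal{O}\left(\frac{1}{N^{\kappa}}\right),$$ where $\kappa=\min\{1,\tfrac12+r_1\}$ and $r_1$ is the constant in (A4).
   Context: Let $X_1,X_2,\dots$ be real random variables and $S_N=\sum_{n=1}^N X_n$. Assume there are a complex Banach space $\mathcal{B}$ with dual $\mathcal{B}'$, a family of bounded linear operators $\mathcal{L}_t:\mathcal{B}\to\mathcal{B}$ ($t\in\mathbb{R}$), and vectors $v\in\mathcal{B}$, $\ell\in\mathcal{B}'$ such that $\mathbb{E}(e^{itS_N})=\ell(\mathcal{L}_t^N v)$ for all $t\in\mathbb{R}$ and $N\geq1$. The conditions are: (A1) $t\mapsto\mathcal{L}_t$ is continuous and there exist $s\in\mathbb{N}$ and $\delta>0$ such that $t\mapsto\mathcal{L}_t$ is $s$ times continuously differentiable for $|t|\leq\delta$. (A2) $1$ is an isolated and simple eigenvalue of $\mathcal{L}_0$, all other eigenvalues of $\mathcal{L}_0$ have absolute value less than $1$, and the essential spectrum of $\mathcal{L}_0$ is contained in a disk of radius strictly less than $1$. (A3) For all $t\neq 0$, the spectrum of $\mathcal{L}_t$ is contained in $\{|z|<1\}$. (A4) There are positive real numbers $K,r_1,r_2,N_0$ such that $\|\mathcal{L}_t^N\|\leq N^{-r_2}$ for all $t$ with $K\leq|t|\leq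 N^{r_1}$ and all $N>N_0$. Under (A1)–(A3) with $s\geq3$ there are $A\in\mathbb{R}$ and $\sigma^2\geq0$ such that $(S_N-NA)/\sqrt{N}$ converges in distribution to $\mathcal{N}(0,\sigma^2)$; it is assumed that $\sigma^2>0$. Here $\mathfrak{n}(y)=\frac{1}{\sqrt{2\pi\sigma^2}}e^{-y^2/(2\sigma^2)}$ and $\mathfrak{N}(z)=\int_{-\infty}^z\mathfrak{n}(y)\,dy$. *)

theory Defs
  imports "HOL-Probability.Probability" "HOL-Computational_Algebra.Polynomial"
begin

class complex_vector = real_vector +
  fixes scaleC :: "complex \<Rightarrow> 'a \<Rightarrow> 'a" (infixr \<open>*\<^sub>C\<close> 75)
  assumes scaleC_add_right: "a *\<^sub>C (x + y) = a *\<^sub>C x + a *\<^sub>C y"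
    and scaleC_add_left: "(a + b) *\<^sub>C x = a *\<^sub>C x + b *\<^sub>C x"
    and scaleC_scaleC: "a *\<^sub>C (b *\<^sub>C x) = (a * b) *\<^sub>C x"
    and scaleC_one: "1 *\<^sub>C x = x"
    and scaleR_scaleC: "r *\<^sub>R x = complex_of_real r *\<^sub>C x"

class complex_normed_vector = complex_vector + real_normed_vector +
  assumes norm_scaleC: "norm (a *\<^sub>C x) = cmod a * norm x"

instantiation complex :: complex_normed_vector
begin
definition scaleC_complex_def: "scaleC = ((*) :: complex \<Rightarrow> complex \<Rightarrow> complex)"
instance
  by standard (auto simp: scaleC_complex_def algebra_simps scaleR_conv_of_real norm_mult)
end

definition clinear_op :: "('b::complex_normed_vector \<Rightarrow>\<^sub>L 'b) \<Rightarrow> bool" where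
  "clinear_op T \<longleftrightarrow> (\<forall>c x. T (c *\<^sub>C x) = c *\<^sub>C T x)"

definition clinear_fun :: "('b::complex_normed_vector \<Rightarrow>\<^sub>L complex) \<Rightarrow> bool" where
  "clinear_fun l \<longleftrightarrow> (\<forall>c x. l (c *\<^sub>C x) = c * l x)"

fun blpow :: "('b::real_normed_vector \<Rightarrow>\<^sub>L 'b) \<Rightarrow> nat \<Rightarrow> ('b \<Rightarrow>\<^sub>L 'b)" where
  "blpow T 0 = id_blinfun"
| "blpow T (Suc n) = T o\<^sub>L blpow T n"

definition op_spectrum :: "('b::complex_normed_vector \<Rightarrow>\<^sub>L 'b) \<Rightarrow> complex set" where
  "op_spectrum T = {z. \<not> (\<exists>S :: 'b \<Rightarrow>\<^sub>L 'b.
       \<forall>x. S (T x - z *\<^sub>C x) = x \<and> T (S x) - z *\<^sub>C (S x) = x)}"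

definition eigenvalues :: "('b::complex_normed_vector \<Rightarrow>\<^sub>L 'b) \<Rightarrow> complex set" where
  "eigenvalues T = {z. \<exists>x. x \<noteq> 0 \<and> T x = z *\<^sub>C x}"

definition gen_eigenspace :: "('b::complex_normed_vector \<Rightarrow>\<^sub>L 'b) \<Rightarrow> complex \<Rightarrow> 'b set" where
  "gen_eigenspace T z = {x. \<exists>k. ((\<lambda>y. T y - z *\<^sub>C y) ^^ k) x = 0}"

definition simple_eigenvalue :: "('b::complex_normed_vector \<Rightarrow>\<^sub>L 'b) \<Rightarrow> complex \<Rightarrow> bool" where
  "simple_eigenvalue T z \<longleftrightarrow>
     (\<exists>x0. x0 \<noteq> 0 \<and> gen_eigenspace T z = range (\<lambda>c. c *\<^sub>C x0))"

definition isolated_in_spectrum :: "('b::complex_normed_vector \<Rightarrow>\<^sub>L 'b) \<Rightarrow> complex \<Rightarrow> bool" where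
  "isolated_in_spectrum T z \<longleftrightarrow> z \<in> op_spectrum T \<and>
     (\<exists>e>0. \<forall>w \<in> op_spectrum T. w \<noteq> z \<longrightarrow> e \<le> cmod (w - z))"

definition finite_dim_set :: "'b::real_vector set \<Rightarrow> bool" where
  "finite_dim_set K \<longleftrightarrow> (\<exists>F. finite F \<and> K \<subseteq> span F)"

definition fredholm_at :: "('b::complex_normed_vector \<Rightarrow>\<^sub>L 'b) \<Rightarrow> complex \<Rightarrow> bool" where
  "fredholm_at T z \<longleftrightarrow>
     finite_dim_set {x. T x - z *\<^sub>C x = 0} \<and>
     closed (range (\<lambda>x. T x - z *\<^sub>C x)) \<and>
     (\<exists>F. finite_dim_set F \<and> (\<forall>y. \<exists>u w. w \<in> F \<and> y = (T u - z *\<^sub>C u) + w))"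

definition ess_spectrum :: "('b::complex_normed_vector \<Rightarrow>\<^sub>L 'b) \<Rightarrow> complex set" where
  "ess_spectrum T = {z. \<not> fredholm_at T z}"

definition nfrak :: "real \<Rightarrow> real \<Rightarrow> real" where
  "nfrak \<sigma>2 y = 1 / sqrt (2 * pi * \<sigma>2) * exp (- y\<^sup>2 / (2 * \<sigma>2))"

definition Nfrak :: "real \<Rightarrow> real \<Rightarrow> real" where
  "Nfrak \<sigma>2 z = (LBINT y:{..z}. nfrak \<sigma>2 y)"

end

(* The spectral gap at t = 0 gives E(cis (t S_N)) = lam t ^ N * mu t + O(theta ^ N) near t = 0, where lam
   and mu have Taylor expansions at 0. The limit law identifies the first two coefficients of
   ln (lam t) - i A t as 0 and - sigma2 / 2, and the symmetry under t -> -t makes the third coefficient and the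
   linear coefficient of mu imaginary, so that after rescaling t by sqrt N the characteristic function is that
   of the density n + (P1 n)' / sqrt N up to O(1 / N). Esseen's smoothing argument with the Fejer kernel turns
   this into a bound for the distribution functions, with error of order 1 / T for a cut-off T = c N^kappa;
   the frequencies beyond a neighbourhood of 0 are negligible by (A3), on compact sets, and by (A4). *)

theory Submission
  imports Defs "HOL-Real_Asymp.Real_Asymp"
begin

text \<open>The cut-off explains the exponent. Smoothing at scale 1/T costs 1/T, and after the
  scaling by sqrt N the frequencies up to T become t \<le> c N^(kappa - 1/2), which (A4) controls as
  long as kappa - 1/2 \<le> r1; kappa \<le> 1 reflects the order 1/N of the first neglected term.
  Four derivatives suffice because the error of the logarithm of lam at t / sqrt N, multiplied by N,
  is N (t / sqrt N)^4 = t^4 / N. Esseen's argument divides the difference of the characteristic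
  functions by t, so every estimate near 0 must carry a factor t; a remainder that is merely
  O(theta^N) would not be integrable. Hence the powers of the complementary operator are also
  compared with those at t = 0. The numbers A and sigma2 are known only through the limit law and
  have to be matched with Taylor coefficients afterwards. No contour integrals occur: the
  eigenvectors solve implicit equations whose right sides carry a factor t, so that an expansion of
  order j, once substituted, returns one of order j + 1.\<close>

subsection \<open>Asymptotic expansions at the origin\<close>

text \<open>\<open>jet k f\<close>: near \<open>0\<close>, \<open>f\<close> is a polynomial of degree less than \<open>k\<close> up to \<open>O(t ^ k)\<close>
  (see \<open>jet_iff_taylor\<close>). Unlike differentiability in a neighbourhood, this is easily propagated through
  implicit equations of the form \<open>f t = c + t *\<^sub>R G t (f t)\<close>.\<close>

primrec jet :: "nat \<Rightarrow> (real \<Rightarrow> 'a::real_normed_vector) \<Rightarrow> bool" where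
  "jet 0 f \<longleftrightarrow> (\<exists>B. \<forall>\<^sub>F t in nhds 0. norm (f t) \<le> B)"
| "jet (Suc k) f \<longleftrightarrow> (\<exists>c g. jet k g \<and> (\<forall>\<^sub>F t in nhds 0. f t = c + t *\<^sub>R g t))"

lemma eventually_abs_le_nhds_0: "0 < d \<Longrightarrow> \<forall>\<^sub>F t in nhds (0::real). \<bar>t\<bar> \<le> d"
  unfolding eventually_nhds_metric by (intro exI[of _ d]) (auto simp: dist_norm)

lemma eventually_nhds_0_obtain:
  assumes "\<forall>\<^sub>F t in nhds (0::real). P t"
  obtains d where "d > 0" "\<And>t. \<bar>t\<bar> \<le> d \<Longrightarrow> P t"
proof -
  obtain e where "e > 0" "\<And>t. dist t 0 < e \<Longrightarrow> P t"
    using assms unfolding eventually_nhds_metric by blast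
  then show ?thesis by (intro that[of "e/2"]) (auto simp: dist_norm)
qed

lemma jet_SucI': "jet k g \<Longrightarrow> \<forall>\<^sub>F t in nhds 0. f t = c + t *\<^sub>R g t \<Longrightarrow> jet (Suc k) f"
  unfolding jet.simps by blast

lemma jet_cong:
  assumes "\<forall>\<^sub>F t in nhds 0. f t = g t" "jet k f"
  shows "jet k g"
proof (cases k)
  case 0
  then obtain B where "\<forall>\<^sub>F t in nhds 0. norm (f t) \<le> B" using assms(2) by auto
  with assms(1) have "\<forall>\<^sub>F t in nhds 0. norm (g t) \<le> B" by eventually_elim simp
  then show ?thesis using 0 by auto
next
  case (Suc n)
  then obtain c h where h: "jet n h" "\<forall>\<^sub>F t in nhds 0. f t = c + t *\<^sub>R h t" using assms(2) by auto
  from h(2) assms(1) have "\<forall>\<^sub>F t in nhds 0. g t = c + t *\<^sub>R h t" by eventually_elim simp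
  then show ?thesis unfolding Suc by (rule jet_SucI'[OF h(1)])
qed

lemma jet_SucI: "jet k g \<Longrightarrow> (\<And>t. f t = c + t *\<^sub>R g t) \<Longrightarrow> jet (Suc k) f"
  by (erule jet_SucI') simp

lemma jet_Suc_imp: "jet (Suc k) f \<Longrightarrow> jet k f"
proof (induction k arbitrary: f)
  case 0
  then obtain c g B where g: "\<forall>\<^sub>F t in nhds 0. norm (g t) \<le> B" "\<forall>\<^sub>F t in nhds 0. f t = c + t *\<^sub>R g t"
    by auto
  from g eventually_abs_le_nhds_0[OF zero_less_one]
  have "\<forall>\<^sub>F t in nhds 0. norm (f t) \<le> norm c + 1 * B"
  proof eventually_elim
    case (elim t)
    have "norm (f t) \<le> norm c + \<bar>t\<bar> * norm (g t)" using norm_triangle_ineq[of c "t *\<^sub>R g t"] elim by simp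
    also have "\<bar>t\<bar> * norm (g t) \<le> 1 * B" using elim by (intro mult_mono) auto
    finally show ?case by simp
  qed
  then show ?case by auto
next
  case (Suc k)
  from Suc.prems obtain c g where g: "jet (Suc k) g" "\<forall>\<^sub>F t in nhds 0. f t = c + t *\<^sub>R g t"
    unfolding jet.simps(2)[of "Suc k"] by blast
  then show ?case by (intro jet_SucI'[OF Suc.IH[OF g(1)]])
qed

lemma jet_mono: "jet k f \<Longrightarrow> j \<le> k \<Longrightarrow> jet j f"
proof (induction k)
  case (Suc k)
  then show ?case using jet_Suc_imp[of k f] by (cases "j = Suc k") auto
qed simp

lemma jet_zero: "jet k (\<lambda>t. 0)"
  by (induction k) (auto intro: exI[of _ 0] simp del: jet.simps(2) intro!: jet_SucI[of _ "\<lambda>_. 0" _ 0])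

lemma jet_const [simp]: "jet k (\<lambda>t. c)"
proof (cases k)
  case (Suc n)
  then show ?thesis using jet_SucI[of n "\<lambda>_. 0" "\<lambda>_. c" c] jet_zero[of n] by simp
qed auto

lemma jet_add: "jet k f \<Longrightarrow> jet k g \<Longrightarrow> jet k (\<lambda>t. f t + g t)"
proof (induction k arbitrary: f g)
  case 0
  then obtain B C where B: "\<forall>\<^sub>F t in nhds 0. norm (f t) \<le> B" "\<forall>\<^sub>F t in nhds 0. norm (g t) \<le> C" by auto
  from B have "\<forall>\<^sub>F t in nhds 0. norm (f t + g t) \<le> B + C"
    by eventually_elim (metis norm_add_rule_thm)
  then show ?case by auto
next
  case (Suc k)
  then obtain c h d i where *: "jet k h" "\<forall>\<^sub>F t in nhds 0. f t = c + t *\<^sub>R h t"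
     "jet k i" "\<forall>\<^sub>F t in nhds 0. g t = d + t *\<^sub>R i t" by auto
  from *(2,4) have "\<forall>\<^sub>F t in nhds 0. f t + g t = (c + d) + t *\<^sub>R (h t + i t)"
    by eventually_elim (simp add: algebra_simps)
  then show ?case by (rule jet_SucI'[OF Suc.IH[OF *(1,3)]])
qed

lemma jet_linear:
  assumes "bounded_linear h"
  shows "jet k f \<Longrightarrow> jet k (\<lambda>t. h (f t))"
proof (induction k arbitrary: f)
  case 0
  interpret bounded_linear h by fact
  obtain K where K: "K > 0" "\<And>x. norm (h x) \<le> norm x * K" using pos_bounded by auto
  from 0 obtain B where B: "\<forall>\<^sub>F t in nhds 0. norm (f t) \<le> B" by auto
  then have "\<forall>\<^sub>F t in nhds 0. norm (h (f t)) \<le> B * K"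
    by eventually_elim (meson K less_imp_le mult_right_mono order_trans)
  then show ?case by auto
next
  case (Suc k)
  interpret bounded_linear h by fact
  from Suc obtain c i where *: "jet k i" "\<forall>\<^sub>F t in nhds 0. f t = c + t *\<^sub>R i t" by auto
  from *(2) have "\<forall>\<^sub>F t in nhds 0. h (f t) = h c + t *\<^sub>R h (i t)"
    by eventually_elim (simp add: add scaleR)
  then show ?case by (rule jet_SucI'[OF Suc.IH[OF *(1)]])
qed

lemma jet_minus: "jet k f \<Longrightarrow> jet k (\<lambda>t. - f t)"
  by (rule jet_linear) (simp add: bounded_linear_minus bounded_linear_ident)

lemma jet_diff: "jet k f \<Longrightarrow> jet k g \<Longrightarrow> jet k (\<lambda>t. f t - g t)"
  using jet_add[of k f "\<lambda>t. - g t"] jet_minus[of k g] by simp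

text \<open>The product is expanded asymmetrically, with remainder
  \<open>p c (i t) + p (h t) (g t)\<close>. The full factor \<open>g\<close> is kept in the last
  term; it has an expansion of order \<open>k\<close> by \<open>jet_Suc_imp\<close>, so the
  induction hypothesis applies to it.\<close>

lemma jet_bilinear:
  assumes "bounded_bilinear p"
  shows "jet k f \<Longrightarrow> jet k g \<Longrightarrow> jet k (\<lambda>t. p (f t) (g t))"
proof (induction k arbitrary: f g)
  case 0
  interpret bounded_bilinear p by fact
  obtain K where K: "K > 0" "\<And>x y. norm (p x y) \<le> norm x * norm y * K" using pos_bounded by auto
  from 0 obtain B C where B: "\<forall>\<^sub>F t in nhds 0. norm (f t) \<le> B" "\<forall>\<^sub>F t in nhds 0. norm (g t) \<le> C" by auto
  from B have "\<forall>\<^sub>F t in nhds 0. norm (p (f t) (g t)) \<le> B * C * K"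
  proof eventually_elim
    case (elim t)
    have "norm (f t) * norm (g t) * K \<le> B * C * K"
      using elim K by (intro mult_right_mono mult_mono) (auto intro: order_trans[OF norm_ge_zero])
    then show ?case using K(2) order_trans by blast
  qed
  then show ?case by auto
next
  case (Suc k)
  interpret bounded_bilinear p by fact
  from Suc obtain c h d i where *: "jet k h" "\<forall>\<^sub>F t in nhds 0. f t = c + t *\<^sub>R h t"
     "jet k i" "\<forall>\<^sub>F t in nhds 0. g t = d + t *\<^sub>R i t" by auto
  from *(2,4) have "\<forall>\<^sub>F t in nhds 0. p (f t) (g t) = p c d + t *\<^sub>R (p c (i t) + p (h t) (g t))"
    by eventually_elim (simp add: add_left add_right scaleR_left scaleR_right algebra_simps)
  moreover have "jet k (\<lambda>t. p c (i t) + p (h t) (g t))"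
    using * Suc.IH[OF *(1) jet_Suc_imp[OF Suc.prems(2)]]
    by (intro jet_add) (auto intro: jet_linear[OF bounded_linear_right])
  ultimately show ?case by (rule jet_SucI'[rotated])
qed

text \<open>The reciprocal solves 1/f = 1/c - t (g/c) (1/f), an implicit equation with a factor t on
  the right: an expansion of 1/f of order k produces one of order k + 1.\<close>

lemma jet_inverse:
  fixes f :: "real \<Rightarrow> complex"
  assumes "jet k f" "b > 0" "\<forall>\<^sub>F t in nhds 0. b \<le> norm (f t)"
  shows "jet k (\<lambda>t. inverse (f t))"
  using assms(1)
proof (induction k)
  case 0
  have "\<forall>\<^sub>F t in nhds 0. norm (inverse (f t)) \<le> inverse b"
    using assms(3) by eventually_elim (use assms(2) in \<open>simp add: norm_inverse le_imp_inverse_le\<close>)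
  then show ?case by auto
next
  case (Suc k)
  then obtain c g where g: "jet k g" "\<forall>\<^sub>F t in nhds 0. f t = c + t *\<^sub>R g t" by auto
  have c: "c \<noteq> 0"
    using eventually_nhds_x_imp_x[OF g(2)] eventually_nhds_x_imp_x[OF assms(3)] assms(2) by auto
  have "\<forall>\<^sub>F t in nhds 0. inverse (f t) = inverse c + t *\<^sub>R (- inverse c * (g t * inverse (f t)))"
    using g(2) assms(3)
  proof eventually_elim
    case (elim t)
    then have "f t \<noteq> 0" using assms(2) by auto
    moreover have "inverse (f t) - inverse c = (c - f t) * inverse c * inverse (f t)"
      using \<open>f t \<noteq> 0\<close> c by (simp add: field_simps)
    ultimately show ?case using elim by (simp add: scaleR_conv_of_real algebra_simps)
  qed
  moreover have "jet k (\<lambda>t. - inverse c * (g t * inverse (f t)))"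
    using Suc.IH[OF jet_Suc_imp[OF Suc.prems]] g(1)
    by (intro jet_linear[OF bounded_linear_mult_right] jet_bilinear[OF bounded_bilinear_mult])
  ultimately show ?case by (rule jet_SucI'[rotated])
qed

text \<open>Induction on \<open>k\<close>: subtract the constant term and divide by t. The filter
  \<open>nhds 0\<close> includes the point 0 itself, so the constant term is forced to be
  \<open>f 0\<close>.\<close>

lemma jet_iff_taylor:
  "jet k f \<longleftrightarrow> (\<exists>c B. \<forall>\<^sub>F t in nhds 0. norm (f t - (\<Sum>j<k. t ^ j *\<^sub>R c j)) \<le> B * \<bar>t\<bar> ^ k)"
proof (induction k arbitrary: f)
  case 0
  show ?case by simp
next
  case (Suc k)
  show ?case
  proof
    assume "jet (Suc k) f"
    then obtain c g where g: "jet k g" "\<forall>\<^sub>F t in nhds 0. f t = c + t *\<^sub>R g t" by auto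
    from Suc.IH[of g] g(1) obtain d B
      where B: "\<forall>\<^sub>F t in nhds 0. norm (g t - (\<Sum>j<k. t ^ j *\<^sub>R d j)) \<le> B * \<bar>t\<bar> ^ k" by auto
    from B g(2) have "\<forall>\<^sub>F t in nhds 0. norm (f t - (\<Sum>j<Suc k. t ^ j *\<^sub>R (case_nat c d j))) \<le> B * \<bar>t\<bar> ^ Suc k"
    proof eventually_elim
      case (elim t)
      have "f t - (\<Sum>j<Suc k. t ^ j *\<^sub>R (case_nat c d j)) = t *\<^sub>R (g t - (\<Sum>j<k. t ^ j *\<^sub>R d j))"
        unfolding sum.lessThan_Suc_shift using elim by (simp add: scaleR_diff_right scaleR_sum_right)
      then show ?case using mult_left_mono[OF elim(1), of "\<bar>t\<bar>"] by (simp add: ac_simps)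
    qed
    then show "\<exists>c B. \<forall>\<^sub>F t in nhds 0. norm (f t - (\<Sum>j<Suc k. t ^ j *\<^sub>R c j)) \<le> B * \<bar>t\<bar> ^ Suc k" by blast
  next
    assume "\<exists>c B. \<forall>\<^sub>F t in nhds 0. norm (f t - (\<Sum>j<Suc k. t ^ j *\<^sub>R c j)) \<le> B * \<bar>t\<bar> ^ Suc k"
    then obtain c B where B: "\<forall>\<^sub>F t in nhds 0. norm (f t - (\<Sum>j<Suc k. t ^ j *\<^sub>R c j)) \<le> B * \<bar>t\<bar> ^ Suc k"
      by blast
    \<comment> \<open>The estimate for \<open>g\<close> is also required at t = 0, where the
      quotient says nothing, so \<open>g 0\<close> is set to the value there of the polynomial it is
      compared with.\<close>
    define g where "g t = (if t = 0 then (\<Sum>j<k. t ^ j *\<^sub>R c (Suc j)) else (f t - c 0) /\<^sub>R t)" for t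
    have f0: "f 0 = c 0"
      using eventually_nhds_x_imp_x[OF B] unfolding sum.lessThan_Suc_shift by simp
    have "f t = c 0 + t *\<^sub>R g t" for t
      by (auto simp: g_def f0)
    moreover have "jet k g" unfolding Suc.IH
    proof (intro exI)
      show "\<forall>\<^sub>F t in nhds 0. norm (g t - (\<Sum>j<k. t ^ j *\<^sub>R c (Suc j))) \<le> \<bar>B\<bar> * \<bar>t\<bar> ^ k"
        using B
      proof eventually_elim
        case (elim t)
        show ?case
        proof (cases "t = 0")
          case False
          have "f t - (\<Sum>j<Suc k. t ^ j *\<^sub>R c j) = t *\<^sub>R (g t - (\<Sum>j<k. t ^ j *\<^sub>R c (Suc j)))"
            unfolding sum.lessThan_Suc_shift using False
            by (simp add: g_def scaleR_diff_right scaleR_sum_right)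
          then have "\<bar>t\<bar> * norm (g t - (\<Sum>j<k. t ^ j *\<^sub>R c (Suc j))) \<le> \<bar>t\<bar> * (B * \<bar>t\<bar> ^ k)"
            using elim by (simp add: ac_simps)
          then have "norm (g t - (\<Sum>j<k. t ^ j *\<^sub>R c (Suc j))) \<le> B * \<bar>t\<bar> ^ k"
            using False by (metis mult_le_cancel_left_pos zero_less_abs_iff)
          also have "\<dots> \<le> \<bar>B\<bar> * \<bar>t\<bar> ^ k" by (intro mult_right_mono) auto
          finally show ?thesis .
        qed (auto simp: g_def)
      qed
    qed
    ultimately show "jet (Suc k) f" by (rule jet_SucI[rotated])
  qed
qed

text \<open>Integrate the Taylor polynomial of f' term by term. What remains of f has a derivative
  of size |t|^k, and the mean value inequality on [-|t|, |t|] gains the missing factor |t|.\<close>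

lemma jet_antiderivative:
  fixes f f' :: "real \<Rightarrow> 'a::real_normed_vector"
  assumes "\<delta> > 0" "jet k f'"
    and D: "\<And>t. t \<in> {-\<delta>..\<delta>} \<Longrightarrow> (f has_vector_derivative f' t) (at t within {-\<delta>..\<delta>})"
  shows "jet (Suc k) f"
proof -
  from assms(2) obtain c B where "\<forall>\<^sub>F t in nhds 0. norm (f' t - (\<Sum>j<k. t ^ j *\<^sub>R c j)) \<le> B * \<bar>t\<bar> ^ k"
    unfolding jet_iff_taylor by blast
  then obtain d where d: "d > 0" "\<And>t. \<bar>t\<bar> \<le> d \<Longrightarrow> norm (f' t - (\<Sum>j<k. t ^ j *\<^sub>R c j)) \<le> B * \<bar>t\<bar> ^ k"
    by (rule eventually_nhds_0_obtain) blast
  define C where "C j = (case j of 0 \<Rightarrow> f 0 | Suc i \<Rightarrow> c i /\<^sub>R Suc i)" for j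
  define F where "F t = f t - (\<Sum>j<Suc k. t ^ j *\<^sub>R C j)" for t
  have F: "F t = f t - (f 0 + (\<Sum>j<k. t ^ Suc j *\<^sub>R (c j /\<^sub>R Suc j)))" for t
    unfolding F_def sum.lessThan_Suc_shift C_def by simp
  have F': "(F has_vector_derivative (f' t - (\<Sum>j<k. t ^ j *\<^sub>R c j))) (at t within {-\<delta>..\<delta>})"
    if "t \<in> {-\<delta>..\<delta>}" for t
  proof -
    have P: "((\<lambda>t. t ^ Suc j *\<^sub>R (c j /\<^sub>R Suc j)) has_vector_derivative t ^ j *\<^sub>R c j) (at t within {-\<delta>..\<delta>})" for j
    proof -
      have "((\<lambda>t. t ^ Suc j) has_real_derivative (Suc j * t ^ j)) (at t within {-\<delta>..\<delta>})"
        by (auto intro!: derivative_eq_intros simp del: power_Suc)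
      from has_vector_derivative_scaleR[OF this has_vector_derivative_const[of "c j /\<^sub>R Suc j"]]
      show ?thesis
        by (rule has_vector_derivative_eq_rhs) (simp add: field_simps del: of_nat_Suc)
    qed
    have "((\<lambda>t. \<Sum>j<k. t ^ Suc j *\<^sub>R (c j /\<^sub>R Suc j)) has_vector_derivative (\<Sum>j<k. t ^ j *\<^sub>R c j))
        (at t within {-\<delta>..\<delta>})"
      by (intro has_vector_derivative_sum P)
    from has_vector_derivative_diff[OF D[OF that]
        has_vector_derivative_add[OF has_vector_derivative_const[of "f 0"] this]]
    show ?thesis unfolding F by simp
  qed
  have bound: "norm (F t) \<le> \<bar>B\<bar> * \<bar>t\<bar> ^ Suc k" if t: "\<bar>t\<bar> \<le> min d \<delta>" for t
  proof -
    have "norm (F t - F 0) \<le> (\<bar>B\<bar> * \<bar>t\<bar> ^ k) * norm (t - 0)"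
    proof (rule differentiable_bound[where S = "{-\<bar>t\<bar>..\<bar>t\<bar>}"])
      fix x assume x: "x \<in> {-\<bar>t\<bar>..\<bar>t\<bar>}"
      then have "x \<in> {-\<delta>..\<delta>}" using t by auto
      from has_vector_derivative_within_subset[OF F'[OF this], of "{-\<bar>t\<bar>..\<bar>t\<bar>}"] t
      show "(F has_derivative (\<lambda>h. h *\<^sub>R (f' x - (\<Sum>j<k. x ^ j *\<^sub>R c j)))) (at x within {-\<bar>t\<bar>..\<bar>t\<bar>})"
        by (auto simp: has_vector_derivative_def)
      have "norm (f' x - (\<Sum>j<k. x ^ j *\<^sub>R c j)) \<le> B * \<bar>x\<bar> ^ k" using d(2)[of x] x t by auto
      also have "\<dots> \<le> \<bar>B\<bar> * \<bar>t\<bar> ^ k" using x by (intro mult_mono power_mono) auto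
      finally show "onorm (\<lambda>h. h *\<^sub>R (f' x - (\<Sum>j<k. x ^ j *\<^sub>R c j))) \<le> \<bar>B\<bar> * \<bar>t\<bar> ^ k"
        by (intro onorm_bound) (auto simp: mult.commute mult_left_mono)
    qed auto
    then show ?thesis by (simp add: F mult_ac)
  qed
  show ?thesis unfolding jet_iff_taylor
  proof (intro exI)
    show "\<forall>\<^sub>F t in nhds 0. norm (f t - (\<Sum>j<Suc k. t ^ j *\<^sub>R C j)) \<le> \<bar>B\<bar> * \<bar>t\<bar> ^ Suc k"
      unfolding F_def[symmetric] using eventually_abs_le_nhds_0[of "min d \<delta>"] d(1) assms(1)
      by (rule_tac eventually_mono[OF eventually_abs_le_nhds_0[of "min d \<delta>"]]) (simp_all add: bound del: power_Suc)
  qed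
qed

text \<open>Continuity bounds the highest derivative near 0, which is an expansion of order 0; each
  of the \<open>s\<close> integrations then adds one order.\<close>

lemma jet_of_derivatives:
  fixes D :: "nat \<Rightarrow> real \<Rightarrow> 'a::real_normed_vector"
  assumes "\<delta> > 0"
    and "\<And>k t. k < s \<Longrightarrow> t \<in> {-\<delta>..\<delta>} \<Longrightarrow> (D k has_vector_derivative D (Suc k) t) (at t within {-\<delta>..\<delta>})"
    and "continuous_on {-\<delta>..\<delta>} (D s)"
  shows "jet s (D 0)"
proof -
  have "jet k (D (s - k))" if "k \<le> s" for k using that
  proof (induction k)
    case 0
    have "bounded (D s ` {-\<delta>..\<delta>})" using assms(3)
      by (simp add: compact_continuous_image compact_imp_bounded)
    then obtain B where "\<And>t. t \<in> {-\<delta>..\<delta>} \<Longrightarrow> norm (D s t) \<le> B" unfolding bounded_iff by (meson imageI)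
    then have "\<forall>\<^sub>F t in nhds 0. norm (D s t) \<le> B"
      by (intro eventually_mono[OF eventually_abs_le_nhds_0[OF assms(1)]]) (simp add: abs_le_iff)
    then show ?case by auto
  next
    case (Suc k)
    then have "s - k = Suc (s - Suc k)" by simp
    with Suc show ?case using assms(2)[of "s - Suc k"]
      by (intro jet_antiderivative[OF assms(1), where f' = "D (s - k)"]) auto
  qed
  from this[of s] show ?thesis by simp
qed


subsection \<open>Bounded operators and their inverses\<close>

abbreviation is_inverse :: "('a::real_normed_vector \<Rightarrow>\<^sub>L 'b::real_normed_vector) \<Rightarrow> ('b \<Rightarrow>\<^sub>L 'a) \<Rightarrow> bool" where
  "is_inverse T S \<equiv> (\<forall>x. S (T x) = x) \<and> (\<forall>y. T (S y) = y)"

text \<open>The lower bound yields injectivity, hence linearity of the chosen preimage, and at the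
  same time the norm of the inverse.\<close>

lemma bounded_below_surj_inverse:
  fixes T :: "'a::real_normed_vector \<Rightarrow>\<^sub>L 'b::real_normed_vector"
  assumes k: "k \<ge> 0" "\<And>x. norm x \<le> k * norm (T x)" and surj: "\<And>y. \<exists>x. T x = y"
  obtains S where "is_inverse T S" "norm S \<le> k"
proof -
  have inj: "x = y" if "T x = T y" for x y
    using k(2)[of "x - y"] that by (simp add: blinfun.diff_right)
  define f where "f y = (SOME x. T x = y)" for y
  have f: "T (f y) = y" for y unfolding f_def using someI_ex[OF surj] .
  have fb: "norm (f y) \<le> k * norm y" for y using k(2)[of "f y"] by (simp add: f)
  have lin: "bounded_linear f"
  proof (rule bounded_linear_intro)
    show "norm (f y) \<le> norm y * k" for y using fb[of y] by (simp add: mult.commute)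
  qed (rule inj, simp add: f blinfun.add_right blinfun.scaleR_right)+
  show ?thesis
  proof (rule that[of "Blinfun f"])
    show "is_inverse T (Blinfun f)"
      using lin by (auto simp: bounded_linear_Blinfun_apply f intro: inj)
    show "norm (Blinfun f) \<le> k"
      using k lin by (intro norm_blinfun_bound) (auto simp: bounded_linear_Blinfun_apply fb)
  qed
qed

lemma is_inverse_unique: "is_inverse T S \<Longrightarrow> is_inverse T S' \<Longrightarrow> S = S'"
  by (rule blinfun_eqI) metis

text \<open>The term S (T' - T) x is absorbed on the left to give a lower bound for T', and T' u = y
  is solved as a fixed point of u = S (y + (T - T') u), a contraction with factor
  \<open>?q\<close>.\<close>

lemma is_inverse_perturb:
  fixes T T' :: "'a::banach \<Rightarrow>\<^sub>L 'a"
  assumes S: "is_inverse T S" and q: "norm (T' - T) * norm S < 1"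
  obtains S' where "is_inverse T' S'" "norm S' \<le> norm S / (1 - norm (T' - T) * norm S)"
proof -
  let ?q = "norm (T' - T) * norm S"
  have bb: "norm x \<le> norm S / (1 - ?q) * norm (T' x)" for x
  proof -
    have "x = S (T' x) - S ((T' - T) x)"
      using S by (simp add: blinfun.bilinear_simps)
    then have "norm x \<le> norm (S (T' x)) + norm (S ((T' - T) x))" by (metis norm_triangle_ineq4)
    also have "\<dots> \<le> norm S * norm (T' x) + norm S * (norm (T' - T) * norm x)"
      by (intro add_mono order_trans[OF norm_blinfun] mult_left_mono norm_blinfun) auto
    finally show ?thesis using q by (simp add: field_simps)
  qed
  have surj: "\<exists>x. T' x = y" for y
  proof -
    let ?g = "\<lambda>u. S (y + (T u - T' u))"
    have "\<exists>!u. ?g u = u"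
    proof (rule banach_fix_type)
      show "\<forall>u w. dist (?g u) (?g w) \<le> ?q * dist u w"
      proof (intro allI)
        fix u w
        have "?g u - ?g w = - S ((T' - T) (u - w))" by (simp add: blinfun.bilinear_simps algebra_simps)
        then have "dist (?g u) (?g w) = norm (S ((T' - T) (u - w)))" by (simp add: dist_norm)
        also have "\<dots> \<le> norm S * (norm (T' - T) * norm (u - w))"
          by (intro order_trans[OF norm_blinfun] mult_left_mono norm_blinfun) auto
        finally show "dist (?g u) (?g w) \<le> ?q * dist u w" by (simp add: dist_norm mult_ac)
      qed
    qed (use q in auto)
    then obtain u where "S (y + (T u - T' u)) = u" by auto
    then have "T u = y + (T u - T' u)" using S by metis
    then show ?thesis by (intro exI[of _ u]) (simp add: algebra_simps)
  qed
  have "norm S / (1 - ?q) \<ge> 0" using q by simp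
  then show ?thesis by (rule bounded_below_surj_inverse[OF _ bb surj]) (rule that)
qed

section \<open>Geometric bounds for powers of an operator\<close>

lemma blpow_add: "blpow T (m + n) = blpow T m o\<^sub>L blpow T n"
  by (induction m) (auto intro!: blinfun_eqI)

lemma blpow_1 [simp]: "blpow T (Suc 0) = T"
  by (auto intro!: blinfun_eqI)

lemma norm_blpow_add: "norm (blpow T (m + n)) \<le> norm (blpow T m) * norm (blpow T n)"
  unfolding blpow_add by (rule norm_blinfun_compose)

lemma norm_blpow_le: "norm T \<le> b \<Longrightarrow> 1 \<le> b \<Longrightarrow> norm (blpow T n) \<le> b ^ n"
proof (induction n)
  case (Suc n)
  then show ?case by (auto intro!: order_trans[OF norm_blinfun_compose] mult_mono)
qed (simp add: norm_blinfun_id_le)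

lemma norm_blpow_mult: "norm (blpow T (m * n)) \<le> norm (blpow T m) ^ n"
proof (induction n)
  case (Suc n)
  have "norm (blpow T (m * Suc n)) \<le> norm (blpow T m) * norm (blpow T (m * n))"
    using norm_blpow_add[of T m "m * n"] by simp
  also have "\<dots> \<le> norm (blpow T m) * norm (blpow T m) ^ n" by (intro mult_left_mono Suc) auto
  finally show ?case by simp
qed (simp add: norm_blinfun_id_le)

lemma isCont_blpow: "isCont (\<lambda>T. blpow T n) (T0 :: 'a::real_normed_vector \<Rightarrow>\<^sub>L 'a)"
proof (induction n)
  case (Suc n)
  then show ?case
    by (auto intro!: bounded_bilinear.isCont[OF bounded_bilinear_blinfun_compose])
qed simp

text \<open>Divide \<open>N\<close> by \<open>n\<close> with remainder: full blocks contribute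
  \<open>q\<close> each, and the fewer than \<open>n\<close> factors left over contribute at most
  b^n.\<close>

lemma blpow_geometric_bound:
  fixes T :: "'a::real_normed_vector \<Rightarrow>\<^sub>L 'a"
  assumes n: "norm (blpow T n) \<le> q" "0 < q" "q < 1" and b: "norm T \<le> b" "1 \<le> b" and "0 < n"
  shows "norm (blpow T N) \<le> b ^ n / q * root n q ^ N"
proof -
  define \<theta> where "\<theta> = root n q"
  have \<theta>: "0 < \<theta>" "\<theta> \<le> 1" "\<theta> ^ n = q" using assms by (auto simp: \<theta>_def)
  have N: "N = n * (N div n) + N mod n" by simp
  have "norm (blpow T N) \<le> norm (blpow T (n * (N div n))) * norm (blpow T (N mod n))"
    by (subst N) (rule norm_blpow_add)
  also have "\<dots> \<le> norm (blpow T n) ^ (N div n) * b ^ (N mod n)"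
    using norm_blpow_mult[of T n "N div n"] norm_blpow_le[OF b, of "N mod n"] by (intro mult_mono) auto
  also have "\<dots> \<le> q ^ (N div n) * b ^ n"
    using assms by (intro mult_mono power_mono power_increasing) auto
  \<comment> \<open>One extra factor q = \<theta>^n pays for the incomplete block, since \<theta>^n
    \<le> \<theta>^(N mod n). This is the origin of the division by \<open>q\<close> in the
    constant.\<close>
  also have "q ^ (N div n) * q \<le> \<theta> ^ N"
  proof -
    have "q ^ (N div n) * q = \<theta> ^ (n * (N div n)) * \<theta> ^ n" by (simp add: \<theta>(3) power_mult)
    also have "\<dots> \<le> \<theta> ^ (n * (N div n)) * \<theta> ^ (N mod n)"
      using \<theta> \<open>0 < n\<close> by (intro mult_left_mono power_decreasing) (auto simp: less_imp_le)
    also have "\<dots> = \<theta> ^ N" by (subst (3) N) (simp only: power_add)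
    finally show ?thesis .
  qed
  then have "q ^ (N div n) * b ^ n \<le> b ^ n / q * \<theta> ^ N"
    using assms by (simp add: field_simps)
  finally show ?thesis by (simp add: \<theta>_def)
qed

text \<open>A single power controls all others, and that power depends continuously on the operator:
  the bound 1/2 at \<open>T0\<close> becomes 3/4 nearby. This stands in for upper semicontinuity of
  the spectral radius, with uniform constants.\<close>

lemma blpow_locally_uniform_geometric_bound:
  fixes T0 :: "'a::real_normed_vector \<Rightarrow>\<^sub>L 'a"
  assumes "norm (blpow T0 n) \<le> 1/2" "0 < n"
  obtains d C \<theta> where "d > 0" "C > 0" "0 < \<theta>" "\<theta> < 1"
    "\<And>T N. norm (T - T0) < d \<Longrightarrow> norm (blpow T N) \<le> C * \<theta> ^ N"
proof -
  obtain d where d: "d > 0" "\<And>T. dist T T0 < d \<Longrightarrow> dist (blpow T n) (blpow T0 n) < 1/4"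
    using isCont_blpow[of T0 n] unfolding continuous_at_eps_delta
    by (meson zero_less_divide_1_iff zero_less_numeral)
  let ?b = "norm T0 + 1" and ?q = "3/4 :: real"
  show ?thesis
  proof (rule that[of "min d 1" "?b ^ n / ?q" "root n ?q"])
    fix T N assume T: "norm (T - T0) < min d 1"
    show "norm (blpow T N) \<le> ?b ^ n / ?q * root n ?q ^ N"
    proof (rule blpow_geometric_bound)
      have "norm (blpow T n - blpow T0 n) < 1/4" using d(2)[of T] T by (simp add: dist_norm)
      then show "norm (blpow T n) \<le> 3/4"
        using assms(1) norm_triangle_sub[of "blpow T n" "blpow T0 n"] by linarith
      show "norm T \<le> norm T0 + 1" using norm_triangle_sub[of T T0] T by linarith
    qed (use assms in auto)
  qed (use d assms in \<open>auto simp: add_nonneg_pos add_pos_nonneg intro!: divide_pos_pos zero_less_power\<close>)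
qed

lemma blpow_half_tendsto_zero:
  fixes T :: "'a::real_normed_vector \<Rightarrow>\<^sub>L 'a"
  assumes "norm (blpow T n) \<le> 1/2" "0 < n"
  shows "(\<lambda>N. norm (blpow T N)) \<longlonglongrightarrow> 0"
proof -
  obtain d C \<theta> where *: "d > 0" "C > 0" "0 < \<theta>" "\<theta> < 1"
    "\<And>T' N. norm (T' - T) < d \<Longrightarrow> norm (blpow T' N) \<le> C * \<theta> ^ N"
    by (rule blpow_locally_uniform_geometric_bound[OF assms]) blast
  have "(\<lambda>N. C * \<theta> ^ N) \<longlonglongrightarrow> 0"
    using * by (auto intro!: tendsto_mult_right_zero LIMSEQ_realpow_zero)
  then show ?thesis
    by (rule tendsto_0_le[where K = 1]) (use *(5)[of T] *(1) in \<open>auto intro!: always_eventually order_trans[OF _ abs_ge_self]\<close>)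
qed

text \<open>Telescoping S^N - T^N into N terms T^j (S - T) S^(N-1-j), each of size C^2
  \<theta>^(N-1) norm (S - T). It later supplies the factor t in the remainder of the characteristic
  function.\<close>

lemma blpow_diff_bound:
  fixes S T :: "'a::real_normed_vector \<Rightarrow>\<^sub>L 'a"
  assumes "\<And>n. norm (blpow S n) \<le> C * \<theta> ^ n" "\<And>n. norm (blpow T n) \<le> C * \<theta> ^ n" "0 < \<theta>" "C > 0"
  shows "norm (blpow S N - blpow T N) \<le> (C\<^sup>2 / \<theta>) * N * \<theta> ^ N * norm (S - T)"
proof -
  have tele: "blpow S N - blpow T N
      = (\<Sum>j<N. blpow T j o\<^sub>L ((S - T) o\<^sub>L blpow S (N - Suc j)))"
  proof (induction N)
    case (Suc N)
    have "blpow S (Suc N) - blpow T (Suc N) = ((S - T) o\<^sub>L blpow S N) + (T o\<^sub>L (blpow S N - blpow T N))"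
      by (rule blinfun_eqI) (simp add: blinfun.bilinear_simps)
    also have "T o\<^sub>L (blpow S N - blpow T N)
        = (\<Sum>j<N. blpow T (Suc j) o\<^sub>L ((S - T) o\<^sub>L blpow S (Suc N - Suc (Suc j))))"
      unfolding Suc by (rule blinfun_eqI) (simp add: blinfun.bilinear_simps blinfun.sum_left blinfun.sum_right)
    finally show ?case
      unfolding sum.lessThan_Suc_shift by (simp add: blinfun_eqI)
  qed simp
  have "norm (blpow T j o\<^sub>L ((S - T) o\<^sub>L blpow S (N - Suc j))) \<le> (C\<^sup>2 / \<theta>) * \<theta> ^ N * norm (S - T)"
    if "j < N" for j
  proof -
    have "norm (blpow T j o\<^sub>L ((S - T) o\<^sub>L blpow S (N - Suc j)))
        \<le> norm (blpow T j) * (norm (S - T) * norm (blpow S (N - Suc j)))"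
      by (meson mult_left_mono norm_blinfun_compose norm_ge_zero order_trans)
    also have "\<dots> \<le> (C * \<theta> ^ j) * (norm (S - T) * (C * \<theta> ^ (N - Suc j)))"
      using assms by (intro mult_mono assms mult_nonneg_nonneg) (auto simp: less_imp_le)
    also have "\<dots> = C\<^sup>2 * norm (S - T) * (\<theta> ^ (j + (N - Suc j)))"
      by (simp add: power_add power2_eq_square)
    also have "\<theta> ^ (j + (N - Suc j)) = \<theta> ^ N / \<theta>"
      using that assms by (simp add: field_simps flip: power_Suc power_Suc2)
    finally show ?thesis by (simp add: mult_ac)
  qed
  then have "norm (blpow S N - blpow T N) \<le> (\<Sum>j<N. (C\<^sup>2 / \<theta>) * \<theta> ^ N * norm (S - T))"
    unfolding tele by (intro sum_norm_le) auto
  then show ?thesis by (simp add: mult_ac)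
qed

text \<open>Indexing the local constants by a natural number in a monotone way lets the maximum over
  a finite subcover serve everywhere.\<close>

lemma compact_uniform_nat_bound:
  fixes P :: "nat \<Rightarrow> 'a::metric_space \<Rightarrow> bool"
  assumes "compact K" and mono: "\<And>m n x. P m x \<Longrightarrow> m \<le> n \<Longrightarrow> P n x"
    and loc: "\<And>x. x \<in> K \<Longrightarrow> \<exists>e>0. \<exists>n. \<forall>y\<in>K. dist y x < e \<longrightarrow> P n y"
  obtains n where "\<And>x. x \<in> K \<Longrightarrow> P n x"
proof -
  obtain e n where en: "\<And>x. x \<in> K \<Longrightarrow> e x > 0" "\<And>x y. x \<in> K \<Longrightarrow> y \<in> K \<Longrightarrow> dist y x < e x \<Longrightarrow> P (n x) y"
    using loc by metis
  have cover: "K \<subseteq> (\<Union>x\<in>K. ball x (e x))"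
    using en(1) by (auto intro!: bexI)
  obtain F where F: "F \<subseteq> K" "finite F" "K \<subseteq> (\<Union>x\<in>F. ball x (e x))"
    by (rule compactE_image[OF \<open>compact K\<close> open_ball cover]) (rule that)
  show ?thesis
  proof (rule that[of "Max (n ` F)"])
    fix y assume "y \<in> K"
    then obtain x where x: "x \<in> F" "dist y x < e x" using F(3) by (auto simp: dist_commute)
    then have "P (n x) y" using en(2) F(1) \<open>y \<in> K\<close> by auto
    then show "P (Max (n ` F)) y" using mono F(2) x(1) by simp
  qed
qed


subsection \<open>Complex scalars and the spectral radius\<close>

lemma bounded_linear_scaleC: "bounded_linear (\<lambda>x::'a::complex_normed_vector. z *\<^sub>C x)"
proof (rule bounded_linear_intro)
  show "z *\<^sub>C (r *\<^sub>R x) = r *\<^sub>R (z *\<^sub>C x)" for r and x :: 'a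
    by (simp add: scaleR_scaleC scaleC_scaleC mult.commute)
  show "norm (z *\<^sub>C x) \<le> norm x * cmod z" for x :: 'a by (simp add: norm_scaleC)
qed (rule scaleC_add_right)

lemmas scaleC_zero_right [simp] = linear_0[OF bounded_linear.linear[OF bounded_linear_scaleC]]
lemmas scaleC_diff_right = linear_diff[OF bounded_linear.linear[OF bounded_linear_scaleC]]
lemmas scaleC_minus_right = linear_neg[OF bounded_linear.linear[OF bounded_linear_scaleC]]
lemmas scaleC_scaleR_right = linear_scale[OF bounded_linear.linear[OF bounded_linear_scaleC]]

lemma scaleC_zero_left [simp]: "0 *\<^sub>C x = (0::'a::complex_normed_vector)"
  by (metis norm_scaleC norm_zero mult_zero_left norm_eq_zero)

lemma scaleC_minus_left: "(- a) *\<^sub>C x = - (a *\<^sub>C (x::'a::complex_normed_vector))"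
  using scaleC_add_left[of "- a" a x] by (simp add: eq_neg_iff_add_eq_0)

lemma scaleC_diff_left: "(a - b) *\<^sub>C x = a *\<^sub>C x - b *\<^sub>C (x::'a::complex_normed_vector)"
  using scaleC_add_left[of a "- b" x] by (simp add: scaleC_minus_left)

lemma scaleC_sum_left: "(\<Sum>i\<in>I. a i) *\<^sub>C x = (\<Sum>i\<in>I. a i *\<^sub>C (x::'a::complex_normed_vector))"
  by (induction I rule: infinite_finite_induct) (auto simp: scaleC_add_left)

lemma scaleC_eq_0_iff: "a *\<^sub>C x = 0 \<longleftrightarrow> a = 0 \<or> x = (0::'a::complex_normed_vector)"
  using norm_scaleC[of a x] by (metis mult_eq_0_iff norm_eq_zero)

lemma bounded_bilinear_scaleC: "bounded_bilinear (\<lambda>z (x::'a::complex_normed_vector). z *\<^sub>C x)"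
proof
  show "\<exists>K. \<forall>a x. norm (a *\<^sub>C (x::'a)) \<le> norm a * norm x * K"
    by (rule exI[of _ 1]) (simp add: norm_scaleC)
qed (simp_all add: scaleC_add_left scaleC_add_right scaleR_scaleC scaleC_scaleC mult.commute scaleR_conv_of_real scaleC_complex_def)

text \<open>Operators of type \<open>blinfun\<close> are only real linear, so complex scalars enter
  as operators of their own.\<close>

definition cscale :: "complex \<Rightarrow> ('a::complex_normed_vector \<Rightarrow>\<^sub>L 'a)" where
  "cscale z = Blinfun (\<lambda>x. z *\<^sub>C x)"

lemma cscale_apply [simp]: "cscale z x = z *\<^sub>C x"
  unfolding cscale_def by (simp add: bounded_linear_Blinfun_apply bounded_linear_scaleC)

lemma cscale_add: "cscale (z + w) = cscale z + cscale w"
  by (rule blinfun_eqI) (simp add: scaleC_add_left blinfun.add_left)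

lemma cscale_diff: "cscale (z - w) = cscale z - cscale w"
  by (rule blinfun_eqI) (simp add: scaleC_diff_left blinfun.diff_left)

lemma cscale_one: "cscale 1 = id_blinfun"
  by (rule blinfun_eqI) (simp add: scaleC_one)

lemma norm_cscale_le: "norm (cscale z :: 'a::complex_normed_vector \<Rightarrow>\<^sub>L 'a) \<le> cmod z"
  by (rule norm_blinfun_bound) (auto simp: norm_scaleC)

lemma bounded_linear_cscale: "bounded_linear (cscale :: complex \<Rightarrow> ('a::complex_normed_vector \<Rightarrow>\<^sub>L 'a))"
proof (rule bounded_linear_intro)
  show "cscale (r *\<^sub>R z) = r *\<^sub>R (cscale z :: 'a \<Rightarrow>\<^sub>L 'a)" for r z
    by (rule blinfun_eqI) (simp add: scaleR_scaleC scaleC_scaleC blinfun.scaleR_left scaleR_conv_of_real scaleC_complex_def)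
  show "norm (cscale z :: 'a \<Rightarrow>\<^sub>L 'a) \<le> norm z * 1" for z using norm_cscale_le by simp
qed (rule cscale_add)

lemma clinear_op_inverse: "clinear_op T \<Longrightarrow> is_inverse T S \<Longrightarrow> clinear_op S"
  unfolding clinear_op_def by metis

lemma blpow_scaleR: "blpow (r *\<^sub>R T) n = (r ^ n) *\<^sub>R blpow T n"
  by (induction n) (auto intro!: blinfun_eqI simp: blinfun.bilinear_simps)

text \<open>Orthogonality of the characters of the cyclic group of order \<open>n\<close>.
  Exchanging the roles of \<open>j\<close> and \<open>k\<close> turns the sum into a geometric
  series.\<close>

lemma sum_roots_of_unity_power:
  assumes "j < n"
  shows "(\<Sum>k<n. exp (2 * of_real pi * \<i> * of_nat k / of_nat n) ^ j) = (if j = 0 then of_nat n else (0::complex))"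
proof (cases "j = 0")
  case False
  let ?w = "exp (2 * of_real pi * \<i> * of_nat j / of_nat n)"
  have "exp (2 * of_real pi * \<i> * of_nat k / of_nat n) ^ j = ?w ^ k" for k
    by (simp add: exp_of_nat_mult[symmetric] mult_ac)
  moreover have "?w \<noteq> 1"
    using complex_root_unity_eq_1[of n j] assms False by (auto dest: dvd_imp_le)
  moreover have "?w ^ n = 1" using complex_root_unity[of n j] assms by simp
  ultimately show ?thesis using False by (simp add: geometric_sum)
qed simp

lemma geometric_telescope:
  assumes "clinear_op M"
  shows "(\<Sum>j<n. z ^ j *\<^sub>C blpow M j x) - z *\<^sub>C M (\<Sum>j<n. z ^ j *\<^sub>C blpow M j x) = x - z ^ n *\<^sub>C blpow M n x"
proof (induction n)
  case (Suc n)
  have "z *\<^sub>C M (z ^ n *\<^sub>C blpow M n x) = z ^ Suc n *\<^sub>C blpow M (Suc n) x"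
    using assms by (simp add: clinear_op_def scaleC_scaleC)
  moreover have "(S + u) - z *\<^sub>C M (S + u) = (S - z *\<^sub>C M S) + (u - z *\<^sub>C M u)" for S u
    by (simp add: blinfun.add_right scaleC_add_right)
  ultimately show ?case unfolding sum.lessThan_Suc by (simp only: Suc) simp
qed (simp add: scaleC_one blinfun.zero_right)

text \<open>Rickart's argument, which avoids Banach-valued holomorphy: averaging the resolvent over the \<open>n\<close>-th roots
  of unity inverts \<open>1 - r ^ n * M ^ n\<close>, with a bound and a modulus of continuity in \<open>r\<close> uniform in \<open>n\<close>. Hence
  \<open>r ^ n * norm (M ^ n) \<longlonglongrightarrow> 0\<close> propagates from \<open>r = 0\<close> to \<open>r = 1\<close> in steps of fixed length.\<close>

lemma spectral_radius_less_one:
  fixes M :: "'b::{complex_normed_vector,banach} \<Rightarrow>\<^sub>L 'b"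
  assumes lin: "clinear_op M"
    and inv: "\<And>z. cmod z \<le> 1 \<Longrightarrow> \<exists>S. is_inverse (id_blinfun - (cscale z o\<^sub>L M)) S"
  obtains n where "0 < n" "norm (blpow M n) \<le> 1/2"
proof -
  let ?T = "\<lambda>z. id_blinfun - (cscale z o\<^sub>L M)"
  obtain R where R: "\<And>z. cmod z \<le> 1 \<Longrightarrow> is_inverse (?T z) (R z)"
    using inv by metis
  have Tdiff: "norm (?T z - ?T w) \<le> cmod (w - z) * norm M" for z w
  proof -
    have "?T z - ?T w = cscale (w - z) o\<^sub>L M"
      by (rule blinfun_eqI) (simp add: cscale_diff blinfun.bilinear_simps)
    then show ?thesis
      by (simp add: order_trans[OF norm_blinfun_compose mult_right_mono[OF norm_cscale_le norm_ge_zero]])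
  qed
  \<comment> \<open>Within distance \<open>e\<close> of \<open>z\<close> the perturbation bound at
    most doubles the norm of the inverse, so compactness of the disc turns the pointwise inverses
    into a uniform bound.\<close>
  obtain C0 where C0: "\<And>z. z \<in> cball 0 1 \<Longrightarrow> norm (R z) \<le> real C0"
  proof (rule compact_uniform_nat_bound[of "cball (0::complex) 1" "\<lambda>n z. norm (R z) \<le> real n"])
    fix z :: complex assume z: "z \<in> cball 0 1"
    define e where "e = 1 / (2 * (norm M * norm (R z) + 1))"
    have e: "e > 0" unfolding e_def by (simp add: add_nonneg_pos)
    have eq: "e * (norm M * norm (R z)) \<le> 1/2"
    proof -
      have "0 < norm M * norm (R z) + 1" by (simp add: add_nonneg_pos)
      then show ?thesis unfolding e_def by (simp add: divide_simps)
    qed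
    have "norm (R y) \<le> real (nat \<lceil>2 * norm (R z)\<rceil>)" if y: "y \<in> cball 0 1" "dist y z < e" for y
    proof -
      have "norm (?T y - ?T z) \<le> e * norm M"
        using Tdiff[of y z] y(2) by (smt (verit) dist_commute dist_norm mult_right_mono norm_ge_zero)
      then have q: "norm (?T y - ?T z) * norm (R z) \<le> 1/2"
        using eq by (smt (verit) mult.assoc mult_right_mono norm_ge_zero)
      have Rz: "is_inverse (?T z) (R z)" using R z by simp
      have q1: "norm (?T y - ?T z) * norm (R z) < 1" using q by linarith
      obtain S where S: "is_inverse (?T y) S" "norm S \<le> norm (R z) / (1 - norm (?T y - ?T z) * norm (R z))"
        by (rule is_inverse_perturb[OF Rz q1]) (rule that)
      have "S = R y" using is_inverse_unique[OF S(1)] R[of y] y by simp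
      moreover have "norm (R z) / (1 - norm (?T y - ?T z) * norm (R z)) \<le> norm (R z) / (1/2)"
        using q by (intro divide_left_mono mult_pos_pos) auto
      ultimately have "norm (R y) \<le> 2 * norm (R z)" using S(2) by simp
      then show ?thesis by linarith
    qed
    with e show "\<exists>e>0. \<exists>n. \<forall>y\<in>cball 0 1. dist y z < e \<longrightarrow> norm (R y) \<le> real n" by blast
  qed (auto intro: order_trans)
  define C where "C = real C0 + 1"
  have C: "C > 0" "\<And>z. cmod z \<le> 1 \<Longrightarrow> norm (R z) \<le> C"
    using C0 by (auto simp: C_def add_increasing2)
  define \<Lambda> where "\<Lambda> = C\<^sup>2 * norm M"
  have lip: "norm (R z - R w) \<le> \<Lambda> * cmod (z - w)" if zw: "cmod z \<le> 1" "cmod w \<le> 1" for z w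
  proof -
    have "R z - R w = R z o\<^sub>L ((?T w - ?T z) o\<^sub>L R w)"
    proof (rule blinfun_eqI)
      fix x
      have "(R z o\<^sub>L ((?T w - ?T z) o\<^sub>L R w)) x = R z (?T w (R w x)) - R z (?T z (R w x))"
        by (simp only: blinfun_apply_blinfun_compose blinfun.diff_left blinfun.diff_right)
      also have "\<dots> = R z x - R w x" using R zw by metis
      finally show "(R z - R w) x = (R z o\<^sub>L ((?T w - ?T z) o\<^sub>L R w)) x" by (simp add: blinfun.diff_left)
    qed
    then have "norm (R z - R w) = norm (R z o\<^sub>L ((?T w - ?T z) o\<^sub>L R w))" by simp
    also have "\<dots> \<le> norm (R z) * norm ((?T w - ?T z) o\<^sub>L R w)" by (rule norm_blinfun_compose)
    also have "\<dots> \<le> norm (R z) * (norm (?T w - ?T z) * norm (R w))"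
      by (intro mult_left_mono norm_blinfun_compose norm_ge_zero)
    also have "\<dots> \<le> C * ((cmod (z - w) * norm M) * C)"
      using C zw Tdiff[of w z] by (intro mult_mono) (auto intro!: mult_nonneg_nonneg)
    finally show ?thesis by (simp add: \<Lambda>_def power2_eq_square mult_ac)
  qed
  define \<omega> where "\<omega> n k = exp (2 * of_real pi * \<i> * of_nat k / of_nat n)" for n k :: nat
  have \<omega>: "cmod (\<omega> n k) = 1" "n > 0 \<Longrightarrow> \<omega> n k ^ n = 1" for n k
    using complex_root_unity[of n k] by (auto simp: \<omega>_def)
  \<comment> \<open>Averaging the geometric series of \<open>R\<close> over n equally spaced points
    of the circle of radius r leaves only the powers of M^n, so \<open>A n r\<close> acts as the
    inverse of 1 - r^n M^n. As an average it inherits the bound \<open>C\<close> and the Lipschitz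
    constant \<open>\<Lambda>\<close>, neither depending on n.\<close>
  define A where "A n r = (1 / real n) *\<^sub>R (\<Sum>k<n. R (of_real r * \<omega> n k))" for n r
  have disc: "cmod (of_real r * \<omega> n k) \<le> 1" if "0 \<le> r" "r \<le> 1" for r n k
    using that by (simp add: norm_mult \<omega>)
  have A_le: "norm (A n r) \<le> C" if n: "n > 0" and r: "0 \<le> r" "r \<le> 1" for n r
  proof -
    have "norm (\<Sum>k<n. R (of_real r * \<omega> n k)) \<le> (\<Sum>k<n. C)"
      using C(2) disc[OF r] by (intro sum_norm_le) auto
    then show ?thesis using n by (simp add: A_def field_simps)
  qed
  have A_lip: "norm (A n r - A n r') \<le> \<Lambda> * \<bar>r - r'\<bar>"
    if n: "n > 0" and r: "0 \<le> r" "r \<le> 1" "0 \<le> r'" "r' \<le> 1" for n r r'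
  proof -
    have "norm (\<Sum>k<n. R (of_real r * \<omega> n k) - R (of_real r' * \<omega> n k)) \<le> (\<Sum>k<n. \<Lambda> * \<bar>r - r'\<bar>)"
    proof (intro sum_norm_le)
      fix k
      have "cmod (of_real r * \<omega> n k - of_real r' * \<omega> n k) = \<bar>r - r'\<bar>"
        by (metis \<omega>(1) left_diff_distrib mult.right_neutral norm_mult norm_of_real of_real_diff)
      then show "norm (R (of_real r * \<omega> n k) - R (of_real r' * \<omega> n k)) \<le> \<Lambda> * \<bar>r - r'\<bar>"
        using lip[OF disc[OF r(1,2)] disc[OF r(3,4)]] by metis
    qed
    then have "norm (\<Sum>k<n. R (of_real r * \<omega> n k) - R (of_real r' * \<omega> n k)) / n \<le> \<Lambda> * \<bar>r - r'\<bar>"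
      using n by (simp add: field_simps)
    moreover have "A n r - A n r' = (1 / n) *\<^sub>R (\<Sum>k<n. R (of_real r * \<omega> n k) - R (of_real r' * \<omega> n k))"
      by (simp add: A_def sum_subtractf scaleR_diff_right)
    ultimately show ?thesis by simp
  qed
  have A_inv: "A n r (x - r ^ n *\<^sub>R blpow M n x) = x" if n: "n > 0" and r: "0 \<le> r" "r \<le> 1" for n r x
  proof -
    let ?z = "\<lambda>k. of_real r * \<omega> n k"
    have "R (?z k) (x - r ^ n *\<^sub>R blpow M n x) = (\<Sum>j<n. ?z k ^ j *\<^sub>C blpow M j x)" for k
    proof -
      let ?S = "\<Sum>j<n. ?z k ^ j *\<^sub>C blpow M j x"
      have "?z k ^ n = of_real (r ^ n)" using \<omega>(2)[OF n] by (simp add: power_mult_distrib)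
      then have "?T (?z k) ?S = x - r ^ n *\<^sub>R blpow M n x"
        using geometric_telescope[OF lin, where z = "?z k" and n = n and x = x] by (simp add: blinfun.diff_left scaleR_scaleC)
      then show ?thesis using R[OF disc[OF r]] by metis
    qed
    then have "(\<Sum>k<n. R (?z k)) (x - r ^ n *\<^sub>R blpow M n x) = (\<Sum>k<n. \<Sum>j<n. ?z k ^ j *\<^sub>C blpow M j x)"
      by (simp add: blinfun.sum_left)
    also have "\<dots> = (\<Sum>j<n. (of_real r ^ j * (\<Sum>k<n. \<omega> n k ^ j)) *\<^sub>C blpow M j x)"
      by (subst sum.swap) (simp add: power_mult_distrib sum_distrib_left scaleC_sum_left)
    also have "\<dots> = (\<Sum>j<n. if j = 0 then of_nat n *\<^sub>C x else 0)"
      by (intro sum.cong) (auto simp: \<omega>_def sum_roots_of_unity_power)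
    also have "\<dots> = real n *\<^sub>R x" using n by (simp add: scaleR_scaleC)
    finally show ?thesis using n by (simp add: A_def blinfun.scaleR_left)
  qed
  define Z where "Z r \<longleftrightarrow> (\<lambda>n. r ^ n * norm (blpow M n)) \<longlonglongrightarrow> 0" for r
  have step: "Z r'" if Zr: "Z r" and r: "0 \<le> r" "r \<le> 1" "0 \<le> r'" "r' \<le> 1" and d: "\<Lambda> * \<bar>r' - r\<bar> \<le> 1/8" for r r'
  proof -
    have "\<forall>\<^sub>F n in sequentially. r ^ n * norm (blpow M n) < 1 / (8 * C)"
      using Zr C unfolding Z_def by (intro order_tendstoD) auto
    then obtain N where N: "\<And>n. n \<ge> N \<Longrightarrow> r ^ n * norm (blpow M n) < 1 / (8 * C)"
      by (auto simp: eventually_sequentially)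
    define n where "n = max N 1"
    have n: "n > 0" "r ^ n * norm (blpow M n) * C \<le> 1/8"
      using N[of n] C by (auto simp: n_def field_simps)
    have "norm (blpow (r' *\<^sub>R M) n x) \<le> 1/2 * norm x" for x
    proof -
      let ?B = "r' ^ n *\<^sub>R blpow M n x"
      \<comment> \<open>Both averages reproduce their arguments, so x - y = (A n r' - A n r) y + A n
        r (r^n M^n y), where each term is at most 1/8 norm y. As norm y \<le> norm x + norm (x - y),
        this gives norm (x - y) \<le> 1/3 norm x, which is below the needed 1/2.\<close>
      define y where "y = x - ?B"
      have x: "x = A n r' y" using A_inv[OF n(1) r(3,4)] by (simp add: y_def)
      have "y = A n r (y - r ^ n *\<^sub>R blpow M n y)" using A_inv[OF n(1) r(1,2)] by simp
      then have "x - y = (A n r' - A n r) y + A n r (r ^ n *\<^sub>R blpow M n y)"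
        using x by (simp add: blinfun.bilinear_simps algebra_simps)
      then have "norm (x - y) \<le> norm ((A n r' - A n r) y) + norm (A n r (r ^ n *\<^sub>R blpow M n y))"
        by (metis norm_triangle_ineq)
      also have "norm ((A n r' - A n r) y) \<le> 1/8 * norm y"
      proof -
        have "norm (A n r' - A n r) \<le> 1/8" using A_lip[OF n(1) r(3,4) r(1,2)] d by linarith
        then show ?thesis by (rule order_trans[OF norm_blinfun mult_right_mono[OF _ norm_ge_zero]])
      qed
      also have "norm (A n r (r ^ n *\<^sub>R blpow M n y)) \<le> C * (r ^ n * (norm (blpow M n) * norm y))"
        using A_le[OF n(1) r(1,2)] r C norm_blinfun[of "blpow M n" y]
        by (intro order_trans[OF norm_blinfun] mult_mono) (auto intro!: mult_left_mono)
      also have "\<dots> = (r ^ n * norm (blpow M n) * C) * norm y" by (simp add: mult_ac)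
      also have "\<dots> \<le> 1/8 * norm y" using n(2) by (intro mult_right_mono) auto
      finally have "norm ?B \<le> 1/4 * norm y" by (simp add: y_def)
      moreover have "norm y \<le> norm x + norm ?B" unfolding y_def by (rule norm_triangle_ineq4)
      ultimately show ?thesis by (simp add: blpow_scaleR blinfun.scaleR_left) (use norm_ge_zero[of x] in linarith)
    qed
    then have "norm (blpow (r' *\<^sub>R M) n) \<le> 1/2" by (intro norm_blinfun_bound) auto
    from blpow_half_tendsto_zero[OF this n(1)] show ?thesis
      using r by (simp add: Z_def blpow_scaleR)
  qed
  \<comment> \<open>Steps of length 1/m with m > 8 \<open>\<Lambda>\<close> change the averages by
    at most 1/8, as the previous claim demands, and m of them lead from 0 to 1.\<close>
  obtain m where m: "real m > 8 * \<Lambda> + 1" using reals_Archimedean2 by blast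
  have \<Lambda>0: "\<Lambda> \<ge> 0" by (simp add: \<Lambda>_def)
  have "Z (real k / real m)" if "k \<le> m" for k
    using that
  proof (induction k)
    case 0
    show ?case unfolding Z_def
      by (rule tendsto_eventually) (auto simp: eventually_sequentially intro!: exI[of _ 1])
  next
    case (Suc k)
    have "real (Suc k) / m - real k / m = 1 / m" by (simp add: add_divide_distrib)
    then have "\<Lambda> * \<bar>real (Suc k) / m - real k / m\<bar> \<le> 1/8" using m \<Lambda>0 by (simp add: field_simps)
    then show ?case using Suc m \<Lambda>0 by (intro step[OF Suc.IH]) auto
  qed
  from this[of m] have "Z 1" using m \<Lambda>0 by simp
  then have "\<forall>\<^sub>F n in sequentially. norm (blpow M n) < 1/2"
    unfolding Z_def by (intro order_tendstoD) auto
  then obtain N where "\<And>n. n \<ge> N \<Longrightarrow> norm (blpow M n) < 1/2"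
    by (auto simp: eventually_sequentially)
  from that[of "max N 1"] this[of "max N 1"] show ?thesis by simp
qed


subsection \<open>Operators with closed range\<close>

text \<open>The open mapping theorem for T onto its range. The range is a set and not a type, so
  Baire's theorem is applied in its subspace topology, and completeness comes from
  closedness.\<close>

lemma open_mapping_closed_range:
  fixes T :: "'a::banach \<Rightarrow>\<^sub>L 'b::banach"
  assumes "closed (range T)"
  obtains C where "C > 0" "\<And>y. y \<in> range T \<Longrightarrow> \<exists>x. T x = y \<and> norm x \<le> C * norm y"
proof -
  define H where "H = range T"
  define F where "F n = closure (T ` ball 0 (real n))" for n
  have H_add: "u + w \<in> H" and H_diff: "u - w \<in> H" and H_scale: "r *\<^sub>R u \<in> H" if uw: "u \<in> H" "w \<in> H" for u w r
  proof -
    obtain a b where ab: "u = T a" "w = T b" using uw by (auto simp: H_def)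
    have "u + w = T (a + b)" "u - w = T (a - b)" "r *\<^sub>R u = T (r *\<^sub>R a)"
      by (simp_all add: ab blinfun.bilinear_simps)
    then show "u + w \<in> H" "u - w \<in> H" "r *\<^sub>R u \<in> H" unfolding H_def by blast+
  qed
  have T_H: "T x \<in> H" for x by (simp add: H_def)
  have FH: "F n \<subseteq> H" for n
    unfolding F_def H_def using assms by (intro closure_minimal) auto
  have UF: "\<Union> (range F) = H"
  proof
    show "H \<subseteq> \<Union> (range F)"
    proof
      fix y assume "y \<in> H"
      then obtain x where x: "y = T x" by (auto simp: H_def)
      obtain n where "norm x < real n" using reals_Archimedean2 by blast
      then have "y \<in> T ` ball 0 (real n)" using x by auto
      then have "y \<in> F n" unfolding F_def by (rule subsetD[OF closure_subset])
      then show "y \<in> \<Union> (range F)" by blast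
    qed
  qed (use FH in blast)
  \<comment> \<open>By Baire: the closed sets \<open>F n\<close> exhaust the range, so one of them
    has interior points relative to \<open>H\<close>.\<close>
  have "\<exists>n. top_of_set H interior_of F n \<noteq> {}"
  proof (rule ccontr)
    assume neg: "\<not> ?thesis"
    have "top_of_set H interior_of \<Union> (range F) = {}"
    proof (rule Baire_category_alt)
      have "completely_metrizable_space (top_of_set H)"
        using assms completely_metrizable_space_closedin[OF completely_metrizable_space_euclidean] closed_closedin
        unfolding H_def by blast
      then show "completely_metrizable_space (top_of_set H) \<or> locally_compact_space (top_of_set H) \<and> regular_space (top_of_set H)"
        by blast
    next
      fix S assume "S \<in> range F"
      then obtain n where n: "S = F n" by auto
      moreover have "closedin (top_of_set H) (F n)"
        using FH[of n] by (intro closed_subset) (auto simp: F_def)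
      ultimately show "closedin (top_of_set H) S \<and> top_of_set H interior_of S = {}"
        using neg by blast
    qed auto
    moreover have "top_of_set H interior_of H = H"
      using interior_of_topspace[of "top_of_set H"] by simp
    ultimately show False using UF by (auto simp: H_def)
  qed
  then obtain n y0 where "y0 \<in> top_of_set H interior_of F n" by blast
  then obtain U where U: "open U" "y0 \<in> U" "y0 \<in> H" "U \<inter> H \<subseteq> F n"
    unfolding interior_of_def openin_open by blast
  from U(1,2) obtain e where e: "e > 0" "ball y0 e \<subseteq> U" by (meson openE)
  have F0: "u \<in> F n" if "u \<in> H" "norm (u - y0) < e" for u
  proof -
    have "u \<in> ball y0 e" using that by (simp add: dist_norm norm_minus_commute)
    then show ?thesis using that e U(4) by blast
  qed
  \<comment> \<open>A small y is the difference of y0 + y and y0, both in \<open>F n\<close>;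
    subtracting approximate preimages of norm below n gives the bound 2n.\<close>
  have approx_small: "\<exists>x. norm x \<le> 2 * real n \<and> norm (y - T x) < \<eta>" if y: "y \<in> H" "norm y < e" and "\<eta> > 0" for y \<eta>
  proof -
    have "y0 + y \<in> H"
      by (rule H_add[OF U(3) y(1)])
    then have "y0 + y \<in> F n" "y0 \<in> F n" using F0[of "y0 + y"] F0[of y0] y U(3) e by auto
    moreover have "\<exists>x. norm x < n \<and> norm (T x - u) < \<eta>/2" if "u \<in> F n" for u
    proof -
      have "0 < \<eta>/2" using \<open>\<eta> > 0\<close> by simp
      then obtain w where "w \<in> T ` ball 0 (real n)" "dist w u < \<eta>/2"
        using \<open>u \<in> F n\<close> unfolding F_def closure_approachable by blast
      then show ?thesis by (auto simp: dist_norm)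
    qed
    ultimately obtain x1 x2 where x: "norm x1 < n" "norm (T x1 - (y0 + y)) < \<eta>/2" "norm x2 < n" "norm (T x2 - y0) < \<eta>/2"
      by meson
    have "y - T (x1 - x2) = (T x2 - y0) - (T x1 - (y0 + y))" by (simp add: blinfun.diff_right)
    then have "norm (y - T (x1 - x2)) \<le> norm (T x2 - y0) + norm (T x1 - (y0 + y))" by (metis norm_triangle_ineq4)
    moreover have "norm (x1 - x2) \<le> 2 * real n" using x norm_triangle_ineq4[of x1 x2] by simp
    ultimately show ?thesis using x by (intro exI[of _ "x1 - x2"]) auto
  qed
  \<comment> \<open>Rescaling y to norm e/2 uses the factor r = e / (2 norm y), and 2n / r = (4n/e)
    norm y.\<close>
  define K where "K = 4 * real n / e"
  have K: "K \<ge> 0" using e by (simp add: K_def)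
  have "\<exists>x. norm x \<le> K * norm y \<and> norm (y - T x) \<le> norm y / 2" if y: "y \<in> H" for y
  proof (cases "y = 0")
    case True
    then show ?thesis by (intro exI[of _ 0]) (simp add: blinfun.zero_right)
  next
    case False
    define r where "r = e / (2 * norm y)"
    have r: "r > 0" "r * norm y = e / 2" using False e by (auto simp: r_def)
    have "r *\<^sub>R y \<in> H" by (rule H_scale[OF y y])
    moreover have "norm (r *\<^sub>R y) < e" using r e by simp
    moreover have "r * norm y / 2 > 0" using r e by simp
    ultimately obtain x where x: "norm x \<le> 2 * real n" "norm (r *\<^sub>R y - T x) < r * norm y / 2"
      using approx_small by blast
    have "norm (x /\<^sub>R r) \<le> K * norm y"
    proof -
      have "norm (x /\<^sub>R r) = norm x / r" using r by (simp add: field_simps)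
      also have "\<dots> \<le> 2 * real n / r" using x r by (intro divide_right_mono) auto
      also have "\<dots> = K * norm y" using False e by (simp add: K_def r_def field_simps)
      finally show ?thesis .
    qed
    moreover have "norm (y - T (x /\<^sub>R r)) \<le> norm y / 2"
    proof -
      have "y - T (x /\<^sub>R r) = (r *\<^sub>R y - T x) /\<^sub>R r"
        using r by (simp add: blinfun.scaleR_right scaleR_diff_right)
      then have "norm (y - T (x /\<^sub>R r)) = norm (r *\<^sub>R y - T x) / r"
        by (simp only: norm_scaleR abs_of_pos[OF positive_imp_inverse_positive[OF r(1)]] divide_inverse mult.commute)
      also have "\<dots> \<le> (r * norm y / 2) / r" using x r by (intro divide_right_mono) auto
      also have "\<dots> = norm y / 2" using r(1) by simp
      finally show ?thesis .
    qed
    ultimately show ?thesis by blast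
  qed
  then obtain g where g: "\<And>y. y \<in> H \<Longrightarrow> norm (g y) \<le> K * norm y" "\<And>y. y \<in> H \<Longrightarrow> norm (y - T (g y)) \<le> norm y / 2"
    by metis
  show ?thesis
  proof (rule that[of "2 * K + 1"])
    fix y assume "y \<in> range T"
    \<comment> \<open>The residuals of repeated approximate solving. Each is at most half of the one
      before, so the corrections sum to a preimage of norm at most 2 K norm y; the + 1 keeps the
      constant positive when K = 0.\<close>
    define s where "s k = ((\<lambda>y. y - T (g y)) ^^ k) y" for k
    have s_Suc: "s (Suc k) = s k - T (g (s k))" for k by (simp add: s_def)
    have sH: "s k \<in> H" for k
    proof (induction k)
      case 0
      then show ?case using \<open>y \<in> range T\<close> by (simp add: s_def H_def)
    next
      case (Suc k)
      then show ?case unfolding s_Suc by (intro H_diff T_H)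
    qed
    have s_le: "norm (s k) \<le> norm y * (1/2) ^ k" for k
    proof (induction k)
      case (Suc k)
      then show ?case using g(2)[OF sH[of k]] by (simp add: s_Suc)
    qed (simp add: s_def)
    have gs: "norm (g (s k)) \<le> K * norm y * (1/2) ^ k" for k
      using order_trans[OF g(1)[OF sH[of k]] mult_left_mono[OF s_le K]] by (simp add: mult_ac)
    have geo: "summable (\<lambda>k. K * norm y * (1/2) ^ k)" by (intro summable_mult summable_geometric) auto
    have sn: "summable (\<lambda>k. norm (g (s k)))"
      by (rule summable_comparison_test'[OF geo]) (use gs in auto)
    define x where "x = (\<Sum>k. g (s k))"
    have "norm x \<le> (\<Sum>k. norm (g (s k)))" unfolding x_def by (rule summable_norm[OF sn])
    also have "\<dots> \<le> (\<Sum>k. K * norm y * (1/2) ^ k)" by (rule suminf_le[OF gs sn geo])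
    also have "\<dots> = 2 * K * norm y" by (subst suminf_mult) (auto simp: suminf_geometric summable_geometric)
    also have "\<dots> \<le> (2 * K + 1) * norm y" by (simp add: algebra_simps)
    finally have 1: "norm x \<le> (2 * K + 1) * norm y" .
    have "s \<longlonglongrightarrow> 0"
    proof (rule Lim_null_comparison)
      show "\<forall>\<^sub>F k in sequentially. norm (s k) \<le> norm y * (1/2) ^ k" using s_le by simp
      show "(\<lambda>k. norm y * (1/2) ^ k) \<longlonglongrightarrow> 0" by (intro tendsto_mult_right_zero LIMSEQ_realpow_zero) auto
    qed
    then have "(\<lambda>k. s k - s (Suc k)) sums (s 0 - 0)" by (rule telescope_sums')
    then have "(\<lambda>k. T (g (s k))) sums y" by (simp add: s_Suc s_def)
    moreover have "(\<lambda>k. T (g (s k))) sums T x"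
      unfolding x_def using sn by (intro bounded_linear.sums[OF blinfun.bounded_linear_right] summable_sums)
        (rule summable_norm_cancel)
    ultimately have "T x = y" using sums_unique2 by blast
    with 1 show "\<exists>x. T x = y \<and> norm x \<le> (2 * K + 1) * norm y" by blast
  qed (use K in auto)
qed

lemma bounded_below_of_injective_closed_range:
  fixes T :: "'a::banach \<Rightarrow>\<^sub>L 'b::banach"
  assumes "closed (range T)" "\<And>x. T x = 0 \<Longrightarrow> x = 0"
  obtains k where "k > 0" "\<And>x. norm x \<le> k * norm (T x)"
proof -
  obtain C where C: "C > 0" "\<And>y. y \<in> range T \<Longrightarrow> \<exists>x. T x = y \<and> norm x \<le> C * norm y"
    by (rule open_mapping_closed_range[OF assms(1)]) (rule that)
  show ?thesis
  proof (rule that[OF C(1)])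
    fix x
    obtain u where u: "T u = T x" "norm u \<le> C * norm (T x)" using C(2)[of "T x"] by auto
    then have "u = x" using assms(2)[of "u - x"] by (simp add: blinfun.diff_right)
    then show "norm x \<le> C * norm (T x)" using u by simp
  qed
qed

lemma op_spectrum_iff: "z \<in> op_spectrum T \<longleftrightarrow> \<not> (\<exists>S. is_inverse (T - cscale z) S)"
  by (simp add: op_spectrum_def blinfun.diff_left all_conj_distrib)

text \<open>A boundary point of the resolvent set must be an approximate eigenvalue. The lower bound
  at \<open>w\<close> passes to the nearby \<open>u\<close> with 2k in place of k, so the inverse at
  \<open>u\<close> has norm at most 2k, and \<open>w\<close> is reached from \<open>u\<close> by a
  perturbation of ratio at most 1/2.\<close>

lemma invertible_closed_under_bounded_below:
  fixes T :: "'b::{complex_normed_vector,banach} \<Rightarrow>\<^sub>L 'b"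
  assumes k: "k > 0" "\<And>x. norm x \<le> k * norm ((T - cscale w) x)"
    and u: "2 * k * cmod (u - w) \<le> 1/2" "is_inverse (T - cscale u) S"
  shows "\<exists>S. is_inverse (T - cscale w) S"
proof -
  have "norm x \<le> 2 * k * norm ((T - cscale u) x)" for x
  proof -
    have "(T - cscale w) x = (T - cscale u) x + (u - w) *\<^sub>C x"
      by (simp add: blinfun.diff_left scaleC_diff_left)
    then have "norm ((T - cscale w) x) \<le> norm ((T - cscale u) x) + cmod (u - w) * norm x"
      by (metis norm_scaleC norm_triangle_ineq)
    then have "k * norm ((T - cscale w) x) \<le> k * norm ((T - cscale u) x) + (k * cmod (u - w)) * norm x"
      using k(1) by (simp add: distrib_left[symmetric] mult.assoc)
    moreover have "(k * cmod (u - w)) * norm x \<le> (1/2) * norm x"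
      using u(1) by (intro mult_right_mono) auto
    ultimately show ?thesis using k(2)[of x] by linarith
  qed
  then have "norm (S y) \<le> 2 * k * norm y" for y using u(2) by metis
  then have nS: "norm S \<le> 2 * k" using k(1) by (intro norm_blinfun_bound) auto
  have "(T - cscale w) - (T - cscale u) = cscale (u - w)" by (simp add: cscale_diff)
  then have "norm ((T - cscale w) - (T - cscale u)) * norm S \<le> cmod (u - w) * (2 * k)"
    using nS norm_cscale_le[of "u - w"] by (simp only:) (intro mult_mono, auto)
  also have "\<dots> = 2 * k * cmod (u - w)" by simp
  also have "\<dots> < 1" using u(1) by linarith
  finally show ?thesis using is_inverse_perturb[OF u(2)] by metis
qed

lemma invertible_outside_norm:
  fixes T :: "'b::{complex_normed_vector,banach} \<Rightarrow>\<^sub>L 'b"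
  assumes "cmod w > norm T"
  shows "\<exists>S. is_inverse (T - cscale w) S"
proof -
  have w: "w \<noteq> 0" using assms norm_ge_zero[of T] by auto
  have inv: "is_inverse (cscale (- w) :: 'b \<Rightarrow>\<^sub>L 'b) (cscale (- inverse w))"
    using w by (simp add: scaleC_scaleC scaleC_one)
  have "norm ((T - cscale w) - cscale (- w)) * norm (cscale (- inverse w) :: 'b \<Rightarrow>\<^sub>L 'b) \<le> norm T * inverse (cmod w)"
  proof (rule mult_mono)
    have "(T - cscale w) - cscale (- w) = T"
      by (rule blinfun_eqI) (simp add: blinfun.diff_left scaleC_minus_left)
    then show "norm ((T - cscale w) - cscale (- w)) \<le> norm T" by (simp only: order_refl)
    show "norm (cscale (- inverse w) :: 'b \<Rightarrow>\<^sub>L 'b) \<le> inverse (cmod w)"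
      using norm_cscale_le[of "- inverse w"] by (simp add: norm_inverse)
  qed auto
  also have "\<dots> < 1" using assms w by (simp add: field_simps)
  finally show ?thesis using is_inverse_perturb[OF inv] by metis
qed

text \<open>This replaces the invariance of the Fredholm index: invertibility spreads inwards along the ray
  through \<open>z\<close>, from the region \<open>cmod w > norm T\<close>.\<close>

lemma invertible_of_bounded_below_ray:
  fixes T :: "'b::{complex_normed_vector,banach} \<Rightarrow>\<^sub>L 'b"
  assumes bb: "\<And>r. r \<ge> 1 \<Longrightarrow> \<exists>k>0. \<forall>x. norm x \<le> k * norm ((T - cscale (of_real r * z)) x)"
    and z: "z \<noteq> 0"
  shows "\<exists>S. is_inverse (T - cscale z) S"
proof -
  define G where "G r \<longleftrightarrow> (\<exists>S. is_inverse (T - cscale (of_real r * z)) S)" for r :: real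
  define r0 where "r0 = norm T / cmod z + 1"
  have big: "G r" if "r \<ge> max r0 1" for r
  proof -
    have "norm T < r * cmod z" using that z by (simp add: r0_def field_simps) (smt (verit) zero_less_norm_iff)
    then have "norm T < cmod (of_real r * z)" using that by (simp add: norm_mult)
    then show ?thesis unfolding G_def by (rule invertible_outside_norm)
  qed
  \<comment> \<open>\<open>m\<close> will be the last point reached when coming in from infinity
    along the ray. It is shown to be good itself by the lower bound, and then to be 1, because
    invertibility is an open condition.\<close>
  define I where "I = {r. r \<ge> 1 \<and> (\<forall>u\<ge>r. G u)}"
  have I: "max r0 1 \<in> I" "bdd_below I" using big by (auto simp: I_def bdd_below_def)
  define m where "m = Inf I"
  have m1: "m \<ge> 1" unfolding m_def
  proof (rule cInf_greatest)
    show "I \<noteq> {}" using I(1) by blast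
  qed (simp add: I_def)
  have above: "G u" if "u > m" for u
  proof -
    have "Inf I < u" using that by (simp add: m_def)
    moreover have "I \<noteq> {}" using I(1) by blast
    ultimately obtain r where "r \<in> I" "r < u" using cInf_lessD by blast
    then show ?thesis unfolding I_def by simp
  qed
  obtain k where k: "k > 0" "\<And>x. norm x \<le> k * norm ((T - cscale (of_real m * z)) x)"
    using bb[OF m1] by auto
  \<comment> \<open>Chosen so that 2 k |z| e = 1/2, the closeness required for passing from m + e to
    m.\<close>
  define e where "e = 1 / (4 * k * cmod z)"
  have e: "e > 0" "4 * k * cmod z * e = 1" using k z by (auto simp: e_def)
  have dist: "cmod (of_real u * z - of_real w * z) = \<bar>u - w\<bar> * cmod z" for u w :: real
    by (simp only: left_diff_distrib[symmetric] norm_mult of_real_diff[symmetric] norm_of_real)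
  have "G (m + e)" using above[of "m + e"] e by simp
  then obtain S where S: "is_inverse (T - cscale (of_real (m + e) * z)) S"
    unfolding G_def by blast
  have Gm: "G m" unfolding G_def
  proof (rule invertible_closed_under_bounded_below[OF k _ S])
    show "2 * k * cmod (of_real (m + e) * z - of_real m * z) \<le> 1/2"
      unfolding dist using e by (simp add: mult_ac)
  qed
  have "m = 1"
  proof (rule ccontr)
    assume "m \<noteq> 1"
    with m1 have "m > 1" by simp
    obtain S where S: "is_inverse (T - cscale (of_real m * z)) S" using Gm unfolding G_def by blast
    \<comment> \<open>The second entry keeps the perturbation ratio h |z| norm S below 1; the first
      keeps m - h from dropping below 1, where \<open>bb\<close> is silent.\<close>
    define h where "h = min (m - 1) (1 / (2 * (cmod z * norm S + 1)))"
    have p: "cmod z * norm S + 1 > 0" by (simp add: add_nonneg_pos)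
    have h: "h > 0" "h * (cmod z * norm S) < 1" "m - h \<ge> 1"
    proof -
      show "h > 0" using \<open>m > 1\<close> p by (simp add: h_def)
      have "h * (cmod z * norm S) \<le> (1 / (2 * (cmod z * norm S + 1))) * (cmod z * norm S)"
        by (intro mult_right_mono) (auto simp: h_def)
      also have "\<dots> < 1" using p by (simp add: divide_simps)
      finally show "h * (cmod z * norm S) < 1" .
      show "m - h \<ge> 1" by (simp add: h_def)
    qed
    have "G u" if u: "u \<ge> m - h" for u
    proof (cases "u > m")
      case False
      have "(T - cscale (of_real u * z)) - (T - cscale (of_real m * z)) = cscale (of_real m * z - of_real u * z)"
        by (simp add: cscale_diff)
      then have "norm ((T - cscale (of_real u * z)) - (T - cscale (of_real m * z))) \<le> \<bar>m - u\<bar> * cmod z"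
        using norm_cscale_le[of "of_real m * z - of_real u * z"] unfolding dist by (simp only:)
      also have "\<dots> \<le> h * cmod z" using False u by (intro mult_right_mono) auto
      finally have "norm ((T - cscale (of_real u * z)) - (T - cscale (of_real m * z))) * norm S \<le> h * cmod z * norm S"
        by (intro mult_right_mono) auto
      also have "\<dots> < 1" using h(2) by (simp add: mult.assoc)
      finally show ?thesis unfolding G_def using is_inverse_perturb[OF S] by metis
    qed (use above in auto)
    then have "m - h \<in> I" using h by (auto simp: I_def)
    then have "m \<le> m - h" unfolding m_def using I(2) by (rule cInf_lower)
    with h show False by simp
  qed
  with Gm show ?thesis by (simp add: G_def)
qed


subsection \<open>Splitting off the leading eigenvalue\<close>

definition rank_one :: "'a::complex_normed_vector \<Rightarrow> ('a \<Rightarrow>\<^sub>L complex) \<Rightarrow> ('a \<Rightarrow>\<^sub>L 'a)" where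
  "rank_one x p = Blinfun (\<lambda>y. p y *\<^sub>C x)"

lemma rank_one_apply [simp]: "rank_one x p y = p y *\<^sub>C x"
proof -
  have "bounded_linear (\<lambda>y. p y *\<^sub>C x)"
    by (rule bounded_linear_compose[OF bounded_bilinear.bounded_linear_left[OF bounded_bilinear_scaleC]
        blinfun.bounded_linear_right])
  then show ?thesis by (simp add: rank_one_def bounded_linear_Blinfun_apply)
qed

lemma norm_rank_one_le: "norm (rank_one x p) \<le> norm x * norm p"
proof (rule norm_blinfun_bound)
  fix y
  have "norm (p y) * norm x \<le> norm p * norm y * norm x"
    by (intro mult_right_mono norm_blinfun) auto
  then show "norm (rank_one x p y) \<le> norm x * norm p * norm y" by (simp add: norm_scaleC mult_ac)
qed auto

lemma bounded_bilinear_rank_one: "bounded_bilinear (rank_one :: 'a::complex_normed_vector \<Rightarrow> _)"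
proof
  show "\<exists>K. \<forall>a b. norm (rank_one (a::'a) b) \<le> norm a * norm b * K"
    by (rule exI[of _ 1]) (simp add: norm_rank_one_le)
qed (auto intro!: blinfun_eqI simp: blinfun.bilinear_simps scaleC_add_left scaleC_add_right
     scaleC_scaleR_right scaleR_scaleC scaleC_scaleC scaleC_complex_def scaleR_conv_of_real mult.commute)

lemma closed_dist_pos:
  fixes H :: "'a::real_normed_vector set"
  assumes "closed H" "x \<notin> H"
  obtains d where "d > 0" "\<And>h. h \<in> H \<Longrightarrow> d \<le> norm (x - h)"
proof -
  from assms have "open (- H)" "x \<in> - H" by auto
  then obtain d where "d > 0" "ball x d \<subseteq> - H" by (meson openE)
  then show ?thesis by (intro that[of d]) (force simp: dist_norm subset_eq not_less)+
qed

text \<open>\<open>D\<close> = T - 1 has closed range \<open>H\<close>. Simplicity makes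
  \<open>H\<close> miss x0, and isolation makes \<open>D\<close> bijective on \<open>H\<close>, so
  the space splits into the line of x0 and \<open>H\<close>, and \<open>p0\<close> is the coordinate
  along x0. Subtracting the rank one part removes the eigenvalue 1. Every other point outside the
  open unit disc is reached by the ray argument, with Fredholmness used only through closed
  ranges.\<close>

lemma leading_eigenvalue_splitting:
  fixes T :: "'b::{complex_normed_vector,banach} \<Rightarrow>\<^sub>L 'b"
  assumes lin: "clinear_op T"
    and isol: "isolated_in_spectrum T 1" and simple: "simple_eigenvalue T 1"
    and other: "\<And>z. z \<in> eigenvalues T \<Longrightarrow> z \<noteq> 1 \<Longrightarrow> cmod z < 1"
    and ess: "\<exists>\<rho><1. ess_spectrum T \<subseteq> cball 0 \<rho>"
  obtains x0 p0 n where "T x0 = x0" "clinear_fun p0" "p0 x0 = 1" "\<And>x. p0 (T x) = p0 x"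
    "0 < n" "norm (blpow (T - rank_one x0 p0) n) \<le> 1/2"
    "\<And>z. cmod z \<le> 1 \<Longrightarrow> \<exists>S. is_inverse (id_blinfun - (cscale z o\<^sub>L (T - rank_one x0 p0))) S"
proof -
  have T_scaleC: "T (c *\<^sub>C x) = c *\<^sub>C T x" for c x using lin by (simp add: clinear_op_def)
  have fredholm: "fredholm_at T z" if "cmod z \<ge> 1" for z
    using ess that by (fastforce simp: ess_spectrum_def)
  have closed_range: "closed (range (T - cscale z))" if "cmod z \<ge> 1" for z
    using fredholm[OF that] by (simp add: fredholm_at_def blinfun.diff_left)
  define D where "D = T - id_blinfun"
  have D: "D x = T x - x" for x by (simp add: D_def blinfun.diff_left)
  have D1: "D = T - cscale 1" by (simp add: D_def cscale_one)
  have D_scaleC: "D (c *\<^sub>C x) = c *\<^sub>C D x" for c x by (simp add: D T_scaleC scaleC_diff_right)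
  from simple obtain x0 where x0: "x0 \<noteq> 0" "gen_eigenspace T 1 = range (\<lambda>c. c *\<^sub>C x0)"
    unfolding simple_eigenvalue_def by blast
  have gen: "(\<exists>k. ((blinfun_apply D) ^^ k) x = 0) \<longleftrightarrow> (\<exists>c. x = c *\<^sub>C x0)" for x
  proof -
    have "(\<lambda>y. T y - 1 *\<^sub>C y) = D" by (simp add: D scaleC_one fun_eq_iff)
    then have "{x. \<exists>k. ((blinfun_apply D) ^^ k) x = 0} = range (\<lambda>c. c *\<^sub>C x0)"
      using x0(2) by (simp add: gen_eigenspace_def)
    then show ?thesis by blast
  qed
  \<comment> \<open>The generator of the generalised eigenspace is not assumed to be an eigenvector.
    \<open>D\<close> maps the line into itself, so D x0 = c x0, and nilpotency forces c = 0.\<close>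
  have Dx0: "D x0 = 0"
  proof -
    obtain k where k: "((blinfun_apply D) ^^ k) x0 = 0" using gen[of x0] scaleC_one[of x0] by metis
    then have "((blinfun_apply D) ^^ k) (D x0) = 0"
      by (metis funpow_swap1 blinfun.zero_right)
    then obtain c where c: "D x0 = c *\<^sub>C x0" using gen[of "D x0"] by blast
    have "((blinfun_apply D) ^^ j) x0 = c ^ j *\<^sub>C x0" for j
      by (induction j) (auto simp: scaleC_one D_scaleC c scaleC_scaleC mult.commute)
    then have "c = 0" using k x0(1) by (simp add: scaleC_eq_0_iff)
    with c show ?thesis by simp
  qed
  have ker1: "\<exists>c. x = c *\<^sub>C x0" if "D x = 0" for x
    using gen[of x] that by (metis funpow_0 funpow_simps_right(2) comp_apply)
  have ker2: "\<exists>c. x = c *\<^sub>C x0" if "D (D x) = 0" for x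
  proof -
    have "((blinfun_apply D) ^^ 2) x = 0" using that by (simp add: numeral_2_eq_2)
    then show ?thesis using gen[of x] by blast
  qed
  define H where "H = range D"
  have closedH: "closed H" unfolding H_def D1 by (rule closed_range) simp
  have H_add: "u + w \<in> H" and H_diff: "u - w \<in> H" and H_scaleC: "c *\<^sub>C u \<in> H" if uw: "u \<in> H" "w \<in> H" for u w c
  proof -
    obtain a b where ab: "u = D a" "w = D b" using uw by (auto simp: H_def)
    have "u + w = D (a + b)" "u - w = D (a - b)" "c *\<^sub>C u = D (c *\<^sub>C a)"
      by (simp_all add: ab blinfun.bilinear_simps D_scaleC)
    then show "u + w \<in> H" "u - w \<in> H" "c *\<^sub>C u \<in> H" unfolding H_def by blast+
  qed
  have D_H: "D x \<in> H" for x by (simp add: H_def)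
  \<comment> \<open>x0 = D x would make x a generalised eigenvector of rank two, whereas the kernel
    of D^2 is already the line of x0.\<close>
  have x0_H: "x0 \<notin> H"
  proof
    assume "x0 \<in> H"
    then obtain x where x: "x0 = D x" by (auto simp: H_def)
    then obtain c where "x = c *\<^sub>C x0" using ker2[of x] Dx0 by auto
    then have "D x = c *\<^sub>C D x0" by (simp only: D_scaleC)
    then have "x0 = 0" using x Dx0 by simp
    with x0 show False by simp
  qed
  obtain d where d: "d > 0" "\<And>h. h \<in> H \<Longrightarrow> d \<le> norm (x0 - h)"
    by (rule closed_dist_pos[OF closedH x0_H]) (rule that)
  have dist_H: "cmod c * d \<le> norm (c *\<^sub>C x0 + h)" if "h \<in> H" for c h
  proof (cases "c = 0")
    case False
    have "c *\<^sub>C x0 + h = c *\<^sub>C (x0 - (- inverse c) *\<^sub>C h)"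
      using False by (simp add: scaleC_diff_right scaleC_add_right scaleC_scaleC scaleC_minus_left scaleC_minus_right scaleC_one)
    moreover have "d \<le> norm (x0 - (- inverse c) *\<^sub>C h)" by (intro d(2) H_scaleC[OF that that])
    ultimately show ?thesis by (simp add: norm_scaleC mult_left_mono)
  qed simp
  have x0c_H: "c = 0" if "c *\<^sub>C x0 \<in> H" for c
    using dist_H[of "- (c *\<^sub>C x0)" c] H_scaleC[OF that that, of "-1"] d(1)
    by (simp add: scaleC_minus_left scaleC_one mult_le_0_iff)
  obtain C where C: "C > 0" "\<And>y. y \<in> range D \<Longrightarrow> \<exists>u. D u = y \<and> norm u \<le> C * norm y"
    by (rule open_mapping_closed_range[OF closedH[unfolded H_def]]) (rule that)
  \<comment> \<open>A preimage u of D h with norm u \<le> C norm (D h) differs from h by some c x0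
    with |c| d \<le> norm u; removing this multiple costs the factor 1 + norm x0 / d.\<close>
  define k1 where "k1 = (1 + norm x0 / d) * C"
  have k1: "k1 > 0" unfolding k1_def using C(1) d(1) by (intro mult_pos_pos add_pos_nonneg) auto
  have bbH: "norm h \<le> k1 * norm (D h)" if h: "h \<in> H" for h
  proof -
    obtain u where u: "D u = D h" "norm u \<le> C * norm (D h)" using C(2)[OF rangeI] by blast
    have "D (u - h) = 0" using u(1) by (simp add: blinfun.diff_right)
    then obtain c where c: "u - h = c *\<^sub>C x0" using ker1 by blast
    then have uh: "u = c *\<^sub>C x0 + h" by (simp add: algebra_simps)
    have "cmod c * d \<le> norm u" unfolding uh by (rule dist_H[OF h])
    then have "cmod c * norm x0 \<le> norm u / d * norm x0"
      using d(1) by (intro mult_right_mono) (auto simp: field_simps)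
    moreover have "norm h \<le> norm u + cmod c * norm x0"
      using norm_triangle_ineq4[of u "c *\<^sub>C x0"] uh by (simp add: norm_scaleC)
    ultimately have "norm h \<le> (1 + norm x0 / d) * norm u" by (simp add: algebra_simps)
    also have "\<dots> \<le> (1 + norm x0 / d) * (C * norm (D h))"
      using u(2) d(1) by (intro mult_left_mono) auto
    finally show ?thesis by (simp add: k1_def mult_ac)
  qed
  \<comment> \<open>Isolation enters here. For small \<epsilon> > 0 the operator D - \<epsilon> has
    an inverse \<open>S\<close> that preserves \<open>H\<close> and is bounded on \<open>H\<close>
    by 2 \<open>k1\<close>, independently of \<epsilon>. Then D h = y is the fixed point equation h
    = S (y - \<epsilon> h), with contraction factor 2 k1 \<epsilon> \<le> 1/2.\<close>
  have surjH: "\<exists>h\<in>H. D h = y" if y: "y \<in> H" for y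
  proof -
    obtain e where e: "e > 0" "\<And>w. w \<in> op_spectrum T \<Longrightarrow> w \<noteq> 1 \<Longrightarrow> e \<le> cmod (w - 1)"
      using isol unfolding isolated_in_spectrum_def by blast
    define \<epsilon> where "\<epsilon> = min (e / 2) (1 / (4 * k1))"
    have \<epsilon>: "\<epsilon> > 0" "\<epsilon> < e" "\<epsilon> * k1 \<le> 1/4"
    proof -
      show "\<epsilon> > 0" "\<epsilon> < e" using e(1) k1 by (auto simp: \<epsilon>_def)
      have "\<epsilon> * k1 \<le> 1 / (4 * k1) * k1" using k1 by (intro mult_right_mono) (auto simp: \<epsilon>_def)
      then show "\<epsilon> * k1 \<le> 1/4" using k1 by simp
    qed
    have "1 + complex_of_real \<epsilon> \<notin> op_spectrum T"
      using e(2)[of "1 + complex_of_real \<epsilon>"] \<epsilon> by auto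
    then obtain S where S: "is_inverse (T - cscale (1 + complex_of_real \<epsilon>)) S"
      unfolding op_spectrum_iff by blast
    have Tw: "(T - cscale (1 + complex_of_real \<epsilon>)) x = D x - \<epsilon> *\<^sub>R x" for x
      by (simp add: D blinfun.diff_left scaleC_add_left scaleC_one scaleR_scaleC)
    have S1: "D (S x) - \<epsilon> *\<^sub>R S x = x" for x using S unfolding Tw by blast
    have S2: "S (D x - \<epsilon> *\<^sub>R x) = x" for x using S unfolding Tw by blast
    have SH: "S x \<in> H" if x: "x \<in> H" for x
    proof -
      obtain a where a: "x = D a" using x by (auto simp: H_def)
      have "D (D (S a)) - \<epsilon> *\<^sub>R D (S a) = D a"
        using arg_cong[OF S1[of a], of D] by (simp add: blinfun.bilinear_simps)
      then have "S x = D (S a)" using S2[of "D (S a)"] a by simp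
      then show ?thesis using D_H by simp
    qed
    have Sle: "norm (S x) \<le> 2 * k1 * norm x" if x: "x \<in> H" for x
    proof -
      have "norm (S x) \<le> k1 * norm (D (S x))" by (rule bbH[OF SH[OF x]])
      also have "D (S x) = x + \<epsilon> *\<^sub>R S x" using S1[of x] by (simp add: algebra_simps)
      also have "k1 * norm (x + \<epsilon> *\<^sub>R S x) \<le> k1 * (norm x + \<epsilon> * norm (S x))"
        using k1 \<epsilon>(1) norm_triangle_ineq[of x "\<epsilon> *\<^sub>R S x"] by (intro mult_left_mono) auto
      also have "\<dots> = k1 * norm x + (\<epsilon> * k1) * norm (S x)" by (simp add: algebra_simps)
      also have "(\<epsilon> * k1) * norm (S x) \<le> 1/4 * norm (S x)" using \<epsilon>(3) by (intro mult_right_mono) auto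
      finally show ?thesis using mult_nonneg_nonneg[OF less_imp_le[OF k1] norm_ge_zero[of x]]
        by (simp add: mult_ac)
    qed
    have "\<exists>!h. h \<in> H \<and> S (y - \<epsilon> *\<^sub>R h) = h"
    proof (rule Banach_fix[OF complete_eq_closed[THEN iffD2, OF closedH], of "1/2"])
      show "H \<noteq> {}" using y by blast
      have sc: "\<epsilon> *\<^sub>R h \<in> H" if "h \<in> H" for h using H_scaleC[OF that that] by (simp add: scaleR_scaleC)
      show "(\<lambda>h. S (y - \<epsilon> *\<^sub>R h)) ` H \<subseteq> H" using SH H_diff[OF y sc] by blast
      show "dist (S (y - \<epsilon> *\<^sub>R u)) (S (y - \<epsilon> *\<^sub>R w)) \<le> 1/2 * dist u w" if uw: "u \<in> H" "w \<in> H" for u w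
      proof -
        have "S (y - \<epsilon> *\<^sub>R u) - S (y - \<epsilon> *\<^sub>R w) = S (\<epsilon> *\<^sub>R (w - u))"
          by (simp add: blinfun.bilinear_simps scaleR_diff_right)
        then have "dist (S (y - \<epsilon> *\<^sub>R u)) (S (y - \<epsilon> *\<^sub>R w)) = norm (S (\<epsilon> *\<^sub>R (w - u)))" by (simp add: dist_norm)
        also have "\<dots> \<le> 2 * k1 * norm (\<epsilon> *\<^sub>R (w - u))" by (intro Sle sc H_diff uw)
        also have "\<dots> = 2 * (\<epsilon> * k1) * norm (w - u)" using \<epsilon>(1) by simp
        also have "\<dots> \<le> 2 * (1/4) * norm (w - u)" using \<epsilon>(3) by (intro mult_right_mono mult_left_mono) auto
        finally show ?thesis by (simp add: dist_norm norm_minus_commute)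
      qed
    qed auto
    then obtain h where h: "h \<in> H" "S (y - \<epsilon> *\<^sub>R h) = h" by blast
    then have "D h = y" using S1[of "y - \<epsilon> *\<^sub>R h"] by simp
    with h show ?thesis by blast
  qed
  have ex: "\<exists>c. y - c *\<^sub>C x0 \<in> H" for y
  proof -
    obtain h where h: "h \<in> H" "D h = D y" using surjH[OF D_H] by blast
    then have "D (y - h) = 0" by (simp add: blinfun.diff_right)
    then obtain c where "y - h = c *\<^sub>C x0" using ker1 by blast
    then have "y - c *\<^sub>C x0 = h" by (simp add: algebra_simps)
    with h show ?thesis by metis
  qed
  define f where "f y = (SOME c. y - c *\<^sub>C x0 \<in> H)" for y
  have f: "y - f y *\<^sub>C x0 \<in> H" for y unfolding f_def by (rule someI_ex[OF ex])
  have f_unique: "f y = c" if "y - c *\<^sub>C x0 \<in> H" for y c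
  proof -
    have "(y - c *\<^sub>C x0) - (y - f y *\<^sub>C x0) \<in> H" by (intro H_diff that f)
    also have "(y - c *\<^sub>C x0) - (y - f y *\<^sub>C x0) = (f y - c) *\<^sub>C x0" by (simp add: scaleC_diff_left)
    finally show ?thesis using x0c_H by fastforce
  qed
  have f_scaleC: "f (c *\<^sub>C y) = c * f y" for c y
  proof (rule f_unique)
    have "c *\<^sub>C (y - f y *\<^sub>C x0) \<in> H" by (rule H_scaleC[OF f f])
    then show "c *\<^sub>C y - (c * f y) *\<^sub>C x0 \<in> H" by (simp add: scaleC_diff_right scaleC_scaleC)
  qed
  have f_lin: "bounded_linear f"
  proof (rule bounded_linear_intro)
    fix x y
    show "f (x + y) = f x + f y"
    proof (rule f_unique)
      have "(x - f x *\<^sub>C x0) + (y - f y *\<^sub>C x0) \<in> H" by (rule H_add[OF f f])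
      then show "x + y - (f x + f y) *\<^sub>C x0 \<in> H" by (simp add: scaleC_add_left algebra_simps)
    qed
    show "norm (f x) \<le> norm x * (1 / d)"
      using dist_H[OF f[of x], of "f x"] d(1) by (simp add: field_simps)
    show "f (r *\<^sub>R x) = r *\<^sub>R f x" for r using f_scaleC[of "of_real r" x] by (simp add: scaleR_scaleC scaleC_complex_def)
  qed
  define p0 where "p0 = Blinfun f"
  have p0: "p0 y = f y" for y using f_lin by (simp add: p0_def bounded_linear_Blinfun_apply)
  have p0x0: "p0 x0 = 1" unfolding p0 by (rule f_unique) (use D_H[of 0] in \<open>simp add: scaleC_one blinfun.zero_right\<close>)
  have p0_scaleC: "p0 (c *\<^sub>C y) = c * p0 y" for c y by (simp add: p0 f_scaleC)
  have p0H: "p0 y = 0" if "y \<in> H" for y unfolding p0 by (rule f_unique) (use that in simp)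
  have Hp0: "y - p0 y *\<^sub>C x0 \<in> H" for y unfolding p0 by (rule f)
  have p0T: "p0 (T x) = p0 x" for x
    using p0H[OF D_H[of x]] by (simp add: D blinfun.diff_right)
  have Tx0: "T x0 = x0" using Dx0 by (simp add: D)
  define M where "M = T - rank_one x0 p0"
  have M: "M x = T x - p0 x *\<^sub>C x0" for x by (simp add: M_def blinfun.diff_left)
  have Mlin: "clinear_op M"
    by (simp add: clinear_op_def M T_scaleC p0_scaleC scaleC_diff_right scaleC_scaleC)
  \<comment> \<open>\<open>M\<close> kills x0 and agrees with T on the kernel of \<open>p0\<close>.
    At z = 1 the operator is p0 x * x0 - D x, handled by \<open>bbH\<close> and
    \<open>surjH\<close>; every other z \<noteq> 0 is treated through w = 1/z.\<close>
  have inv: "\<exists>V. is_inverse (id_blinfun - (cscale z o\<^sub>L M)) V" if z: "cmod z \<le> 1" for z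
  proof -
    have ap: "(id_blinfun - (cscale z o\<^sub>L M)) x = x - z *\<^sub>C M x" for x by (simp add: blinfun.diff_left)
    consider "z = 0" | "z = 1" | "z \<noteq> 0" "z \<noteq> 1" by blast
    then show ?thesis
    proof cases
      case 1
      then show ?thesis by (intro exI[of _ id_blinfun]) (simp add: blinfun.diff_left)
    next
      case 2
      have ap1: "(id_blinfun - (cscale z o\<^sub>L M)) x = p0 x *\<^sub>C x0 - D x" for x
        by (simp add: blinfun.diff_left 2 M D scaleC_one)
      let ?k = "k1 * (1 + norm p0 * norm x0) + norm p0 * norm x0"
      show ?thesis
      proof (rule bounded_below_surj_inverse[of ?k "id_blinfun - (cscale z o\<^sub>L M)"])
        fix x
        define y where "y = p0 x *\<^sub>C x0 - D x"
        define u where "u = x - p0 x *\<^sub>C x0"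
        have py: "p0 y = p0 x" using p0H[OF D_H[of x]] by (simp add: y_def blinfun.diff_right p0_scaleC p0x0)
        have c: "norm (p0 x *\<^sub>C x0) \<le> norm p0 * norm x0 * norm y"
          using mult_right_mono[OF norm_blinfun[of p0 y] norm_ge_zero[of x0]] by (simp add: norm_scaleC py mult_ac)
        have "D u = p0 x *\<^sub>C x0 - y" by (simp add: u_def y_def blinfun.diff_right D_scaleC Dx0)
        then have "norm (D u) \<le> norm (p0 x *\<^sub>C x0) + norm y" by (metis norm_triangle_ineq4)
        then have "norm (D u) \<le> (1 + norm p0 * norm x0) * norm y" using c by (simp add: algebra_simps)
        then have "norm u \<le> k1 * ((1 + norm p0 * norm x0) * norm y)"
          using bbH[OF Hp0[of x]] k1 unfolding u_def[symmetric] by (meson less_imp_le mult_left_mono order_trans)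
        moreover have "norm x \<le> norm u + norm (p0 x *\<^sub>C x0)"
          unfolding u_def by (metis norm_triangle_sub add.commute)
        ultimately show "norm x \<le> ?k * norm ((id_blinfun - (cscale z o\<^sub>L M)) x)"
          unfolding ap1 y_def[symmetric] using c by (simp add: algebra_simps)
      next
        fix y
        obtain h where h: "h \<in> H" "D h = y - p0 y *\<^sub>C x0" using surjH[OF Hp0] by blast
        have "(id_blinfun - (cscale z o\<^sub>L M)) (p0 y *\<^sub>C x0 - h) = y"
          unfolding ap1 using p0H[OF h(1)] by (simp add: blinfun.diff_right p0_scaleC p0x0 D_scaleC Dx0 h(2))
        then show "\<exists>x. (id_blinfun - (cscale z o\<^sub>L M)) x = y" by blast
      qed (use k1 in auto)
    next
      case 3
      define w where "w = inverse z"
      have w: "cmod w \<ge> 1" "w \<noteq> 1" "z * w = 1" "w * z = 1" "w \<noteq> 0"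
      proof -
        have "1 \<le> inverse (cmod z)" using 3(1) z by (simp add: one_le_inverse)
        then show "cmod w \<ge> 1" by (simp add: w_def norm_inverse)
      qed (use 3 in \<open>auto simp: w_def field_simps\<close>)
      \<comment> \<open>The ray from w outwards stays outside the open unit disc and avoids 1, so
        none of its points is an eigenvalue, and closed range turns injectivity into a lower
        bound.\<close>
      have "\<exists>k>0. \<forall>x. norm x \<le> k * norm ((T - cscale (of_real r * w)) x)" if r: "r \<ge> 1" for r :: real
      proof -
        have rw: "cmod (of_real r * w) \<ge> 1" using r w(1) mult_mono[of 1 r 1 "cmod w"] by (simp add: norm_mult)
        have rw1: "of_real r * w \<noteq> 1"
        proof
          assume *: "of_real r * w = 1"
          then have "r * cmod w = 1" using r by (metis abs_of_nonneg norm_mult norm_of_real norm_one order_trans zero_le_one)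
          then have "r = 1" using r w(1) by (smt (verit) mult_le_cancel_left1 mult_less_cancel_left2)
          with * w(2) show False by simp
        qed
        have "x = 0" if "(T - cscale (of_real r * w)) x = 0" for x
        proof (rule ccontr)
          assume "x \<noteq> 0"
          then have "of_real r * w \<in> eigenvalues T"
            using that by (auto simp: eigenvalues_def blinfun.diff_left)
          from other[OF this rw1] rw show False by simp
        qed
        then show ?thesis
          using bounded_below_of_injective_closed_range[OF closed_range[OF rw]] by metis
      qed
      then obtain S where S: "is_inverse (T - cscale w) S"
        using invertible_of_bounded_below_ray[of T w] w(5) by blast
      have Tw: "(T - cscale w) x = T x - w *\<^sub>C x" for x by (simp add: blinfun.diff_left)
      have S1: "T (S x) - w *\<^sub>C S x = x" for x using S unfolding Tw by blast
      have S2: "S (T x - w *\<^sub>C x) = x" for x using S unfolding Tw by blast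
      have "clinear_op (T - cscale w)"
        unfolding clinear_op_def Tw by (simp add: T_scaleC scaleC_diff_right scaleC_scaleC mult.commute)
      then have SlinC: "S (c *\<^sub>C x) = c *\<^sub>C S x" for c x
        using clinear_op_inverse[OF _ S] by (simp add: clinear_op_def)
      have p0S: "p0 (S x) = 0" if "p0 x = 0" for x
      proof -
        have "p0 (T (S x) - w *\<^sub>C S x) = (1 - w) * p0 (S x)"
          by (simp add: blinfun.diff_right p0T p0_scaleC algebra_simps)
        then show ?thesis using that S1[of x] w(2) by simp
      qed
      \<comment> \<open>On the line of x0 the operator 1 - zM is the identity; on the kernel of p0
        it is 1 - zT = - z (T - w), with inverse - w S.\<close>
      define V where "V = rank_one x0 p0 - (cscale w o\<^sub>L S o\<^sub>L (id_blinfun - rank_one x0 p0))"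
      have V: "V y = p0 y *\<^sub>C x0 - w *\<^sub>C S (y - p0 y *\<^sub>C x0)" for y
        by (simp add: V_def blinfun.diff_left)
      have "V (x - z *\<^sub>C M x) = x" for x
      proof -
        define u where "u = x - p0 x *\<^sub>C x0"
        have pM: "p0 (M x) = 0" by (simp add: M blinfun.diff_right p0T p0_scaleC p0x0)
        have Mu: "M x = T u" by (simp add: M u_def blinfun.diff_right T_scaleC Tx0)
        have pz: "p0 (x - z *\<^sub>C M x) = p0 x" by (simp add: blinfun.diff_right p0_scaleC pM)
        have "x - z *\<^sub>C M x - p0 x *\<^sub>C x0 = u - z *\<^sub>C T u" by (simp add: u_def Mu)
        also have "\<dots> = (- z) *\<^sub>C (T u - w *\<^sub>C u)"
          by (simp add: scaleC_diff_right scaleC_minus_left scaleC_scaleC w scaleC_one)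
        finally have e1: "x - z *\<^sub>C M x - p0 x *\<^sub>C x0 = (- z) *\<^sub>C (T u - w *\<^sub>C u)" .
        have "w *\<^sub>C S ((- z) *\<^sub>C (T u - w *\<^sub>C u)) = - u"
          unfolding SlinC S2 by (simp add: scaleC_scaleC w scaleC_one scaleC_minus_left scaleC_minus_right)
        then show ?thesis unfolding V pz e1 by (simp add: u_def)
      qed
      moreover have "V y - z *\<^sub>C M (V y) = y" for y
      proof -
        define u where "u = y - p0 y *\<^sub>C x0"
        have "p0 u = 0" by (simp add: u_def blinfun.diff_right p0_scaleC p0x0)
        then have p: "p0 (S u) = 0" by (rule p0S)
        have Vu: "V y = p0 y *\<^sub>C x0 - w *\<^sub>C S u" by (simp add: V u_def)
        have "M (V y) = - (w *\<^sub>C T (S u))"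
          unfolding Vu by (simp add: M blinfun.diff_right T_scaleC p0_scaleC p Tx0 p0x0)
        then have "z *\<^sub>C M (V y) = - T (S u)" by (simp add: scaleC_minus_right scaleC_scaleC w scaleC_one)
        then have "V y - z *\<^sub>C M (V y) = p0 y *\<^sub>C x0 + (T (S u) - w *\<^sub>C S u)" unfolding Vu by simp
        then show ?thesis unfolding S1 by (simp add: u_def)
      qed
      ultimately show ?thesis unfolding ap by blast
    qed
  qed
  obtain n where n: "0 < n" "norm (blpow M n) \<le> 1/2"
    by (rule spectral_radius_less_one[OF Mlin inv], assumption) (rule that)
  have p0_lin: "clinear_fun p0" by (simp add: clinear_fun_def p0_scaleC)
  show ?thesis
    by (rule that[OF Tx0 p0_lin p0x0 p0T n[unfolded M_def] inv[unfolded M_def]])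
qed


subsection \<open>Perturbation of the leading eigenvalue\<close>

text \<open>With \<open>S = (1 - M)\<^sup>-\<^sup>1\<close>, \<open>M = T - rank_one x0 p0\<close>, the eigenvector normalised by \<open>p0 x = 1\<close> is the fixed point
  of a contraction near \<open>x0\<close>.\<close>

lemma perturbed_eigenvector:
  fixes T S :: "'b::{complex_normed_vector,banach} \<Rightarrow>\<^sub>L 'b"
    and x0 :: 'b and p0 :: "'b \<Rightarrow>\<^sub>L complex"
  assumes Tx0: "T x0 = x0" and p0: "clinear_fun p0" "p0 x0 = 1" "\<And>x. p0 (T x) = p0 x"
    and S: "is_inverse (id_blinfun - (T - rank_one x0 p0)) S"
  obtains \<eta> where "\<eta> > 0" "\<And>E :: 'b \<Rightarrow>\<^sub>L 'b. norm E \<le> \<eta> \<Longrightarrow>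
    \<exists>x. norm (x - x0) \<le> 1 \<and> x = x0 + S (blinfun_apply E x - p0 (blinfun_apply E x) *\<^sub>C x) \<and> p0 x = 1 \<and> blinfun_apply (T + E) x = (1 + p0 (blinfun_apply E x)) *\<^sub>C x"
proof -
  define r where "r = norm x0 + 1"
  \<comment> \<open>\<open>r\<close> bounds the norm on the unit ball around x0, and
    \<open>B\<close> times norm E dominates the Lipschitz constant of the fixed point map there;
    \<eta> B = 1/2 makes it a contraction.\<close>
  define B where "B = (norm S + 1) * (1 + 2 * norm p0) * r\<^sup>2"
  define \<eta> where "\<eta> = 1 / (2 * B)"
  have r: "r \<ge> 1" by (simp add: r_def)
  have B: "B > 0" using r unfolding B_def by (intro mult_pos_pos add_nonneg_pos add_pos_nonneg) auto
  have \<eta>: "\<eta> > 0" using B by (simp add: \<eta>_def)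
  have \<eta>_le: "a * \<eta> \<le> 1/2" if "a \<le> B" for a
    using that B by (simp add: \<eta>_def field_simps)
  have rr: "r \<le> r\<^sup>2" using r by (simp add: power2_eq_square)
  have p0_scaleC: "p0 (c *\<^sub>C y) = c * p0 y" for c y using p0(1) by (simp add: clinear_fun_def)
  show ?thesis
  proof (rule that[OF \<eta>])
    fix E :: "'b \<Rightarrow>\<^sub>L 'b" assume E: "norm E \<le> \<eta>"
    \<comment> \<open>If p0 x = 1, the eigenvalue equation (T + E) x = (1 + p0 (E x)) x reads (1 -
      M) x = x0 + g x. As (1 - M) x0 = x0, applying S gives x = x0 + S (g x).\<close>
    define g where "g x = E x - p0 (E x) *\<^sub>C x" for x
    let ?F = "\<lambda>x. x0 + S (g x)"
    have Ex: "norm (E x) \<le> \<eta> * norm x" for x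
      by (rule order_trans[OF norm_blinfun mult_right_mono[OF E norm_ge_zero]])
    have pEx: "cmod (p0 (E x)) \<le> norm p0 * (\<eta> * norm x)" for x
      by (rule order_trans[OF norm_blinfun mult_left_mono[OF Ex norm_ge_zero]])
    have in_ball: "norm x \<le> r" if "x \<in> cball x0 1" for x
      using that norm_triangle_ineq[of x0 "x - x0"] by (simp add: r_def dist_norm norm_minus_commute)
    have "\<exists>!x. x \<in> cball x0 1 \<and> ?F x = x"
    proof (rule Banach_fix[of _ "1/2"])
      show "?F ` cball x0 1 \<subseteq> cball x0 1"
      proof safe
        fix x assume x: "x \<in> cball x0 1"
        have "norm (g x) \<le> norm (E x) + cmod (p0 (E x)) * norm x"
          unfolding g_def using norm_triangle_ineq4[of "E x" "p0 (E x) *\<^sub>C x"] by (simp add: norm_scaleC)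
        also have "\<dots> \<le> \<eta> * r + norm p0 * (\<eta> * r) * r"
          using Ex[of x] pEx[of x] in_ball[OF x] \<eta> r
          by (intro add_mono mult_mono order_trans[OF Ex] order_trans[OF pEx] mult_left_mono mult_nonneg_nonneg) auto
        also have "\<dots> = (r + norm p0 * r\<^sup>2) * \<eta>" by (simp add: algebra_simps power2_eq_square)
        also have "\<dots> \<le> ((1 + 2 * norm p0) * r\<^sup>2) * \<eta>"
          using rr \<eta> r by (intro mult_right_mono) (auto simp: algebra_simps intro!: add_increasing2)
        finally have "norm S * norm (g x) \<le> norm S * (((1 + 2 * norm p0) * r\<^sup>2) * \<eta>)"
          by (intro mult_left_mono) auto
        also have "\<dots> = (norm S * ((1 + 2 * norm p0) * r\<^sup>2)) * \<eta>" by (simp add: mult_ac)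
        also have "\<dots> \<le> 1/2"
          by (rule \<eta>_le) (unfold B_def mult.assoc, intro mult_right_mono, auto)
        finally have "norm (S (g x)) \<le> 1/2" using norm_blinfun[of S "g x"] by linarith
        then show "?F x \<in> cball x0 1" by (simp add: dist_norm)
      qed
      show "dist (?F x) (?F y) \<le> 1/2 * dist x y" if x: "x \<in> cball x0 1" and y: "y \<in> cball x0 1" for x y
      proof -
        have "g x - g y = E (x - y) - p0 (E x) *\<^sub>C (x - y) - p0 (E (x - y)) *\<^sub>C y"
          by (simp add: g_def blinfun.diff_right scaleC_diff_right scaleC_diff_left)
        then have "norm (g x - g y) \<le> norm (E (x - y)) + norm (p0 (E x) *\<^sub>C (x - y)) + norm (p0 (E (x - y)) *\<^sub>C y)"
          by (metis norm_triangle_ineq4 norm_triangle_le_diff order_refl add_mono)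
        also have "\<dots> \<le> \<eta> * norm (x - y) + (norm p0 * (\<eta> * r)) * norm (x - y) + (norm p0 * (\<eta> * norm (x - y))) * r"
          unfolding norm_scaleC using in_ball[OF x] in_ball[OF y] \<eta> r
          by (intro add_mono mult_mono order_trans[OF pEx] Ex mult_left_mono mult_nonneg_nonneg) auto
        also have "\<dots> = ((1 + 2 * norm p0 * r) * \<eta>) * norm (x - y)" by (simp add: algebra_simps)
        also have "\<dots> \<le> (((1 + 2 * norm p0) * r\<^sup>2) * \<eta>) * norm (x - y)"
        proof (intro mult_right_mono)
          have "1 \<le> r\<^sup>2" using r by simp
          moreover have "norm p0 * r \<le> norm p0 * r\<^sup>2" using rr by (intro mult_left_mono) auto
          ultimately show "1 + 2 * norm p0 * r \<le> (1 + 2 * norm p0) * r\<^sup>2" by (simp add: algebra_simps)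
        qed (use \<eta> in auto)
        finally have "norm S * norm (g x - g y) \<le> norm S * ((((1 + 2 * norm p0) * r\<^sup>2) * \<eta>) * norm (x - y))"
          by (intro mult_left_mono) auto
        also have "\<dots> = ((norm S * ((1 + 2 * norm p0) * r\<^sup>2)) * \<eta>) * norm (x - y)" by (simp add: mult_ac)
        also have "\<dots> \<le> 1/2 * norm (x - y)"
          by (intro mult_right_mono \<eta>_le) (unfold B_def mult.assoc, intro mult_right_mono, auto)
        finally have "norm (S (g x - g y)) \<le> 1/2 * norm (x - y)" using norm_blinfun[of S "g x - g y"] by linarith
        then show ?thesis by (simp add: dist_norm blinfun.diff_right)
      qed
    qed (auto simp: complete_eq_closed)
    then obtain x where x: "x \<in> cball x0 1" "x0 + S (g x) = x" by blast
    have pS: "p0 (S y) = p0 y" for y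
    proof -
      have "S y - (T (S y) - p0 (S y) *\<^sub>C x0) = y" using S by (simp add: blinfun.diff_left)
      then have "p0 (S y - (T (S y) - p0 (S y) *\<^sub>C x0)) = p0 y" by simp
      then show ?thesis by (simp add: blinfun.diff_right p0 p0_scaleC)
    qed
    \<comment> \<open>The normalisation is not imposed on the fixed point but follows from it: since
      p0 S = p0, applying p0 to the equation gives (p0 x - 1) (1 + p0 (E x)) = 0, and the second
      factor is close to 1.\<close>
    have px: "p0 x = 1"
    proof -
      have "p0 x = 1 + (p0 (E x) - p0 (E x) * p0 x)"
        by (subst (1) x(2)[symmetric]) (simp add: blinfun.add_right pS p0 g_def blinfun.diff_right p0_scaleC)
      then have "(p0 x - 1) * (1 + p0 (E x)) = 0" by (simp add: algebra_simps)
      moreover have "cmod (p0 (E x)) \<le> 1/2"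
      proof -
        have "cmod (p0 (E x)) \<le> norm p0 * (\<eta> * r)"
          using in_ball[OF x(1)] \<eta> by (intro order_trans[OF pEx] mult_left_mono) auto
        also have "\<dots> = (norm p0 * r) * \<eta>" by (simp add: mult_ac)
        also have "\<dots> \<le> 1/2"
        proof (rule \<eta>_le)
          have "norm p0 * r \<le> (1 + 2 * norm p0) * r\<^sup>2" using rr r by (intro mult_mono) auto
          also have "\<dots> \<le> (norm S + 1) * ((1 + 2 * norm p0) * r\<^sup>2)"
            using mult_right_mono[of 1 "norm S + 1" "(1 + 2 * norm p0) * r\<^sup>2"] by simp
          finally show "norm p0 * r \<le> B" by (simp add: B_def mult.assoc)
        qed
        finally show ?thesis .
      qed
      then have "1 + p0 (E x) \<noteq> 0"
        by (metis add_eq_0_iff norm_minus_cancel norm_one one_le_numeral half_bounded_equal linorder_not_le divide_less_eq_1_pos zero_less_numeral one_less_numeral_iff semiring_norm(76))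
      ultimately show ?thesis by simp
    qed
    have "(T + E) x = (1 + p0 (E x)) *\<^sub>C x"
    proof -
      have Mx0: "(id_blinfun - (T - rank_one x0 p0)) x0 = x0"
        by (simp add: blinfun.diff_left Tx0 p0 scaleC_one)
      have "(id_blinfun - (T - rank_one x0 p0)) x = x0 + g x"
      proof -
        have "(id_blinfun - (T - rank_one x0 p0)) (S (g x)) = g x" using S by blast
        then have "(id_blinfun - (T - rank_one x0 p0)) (x0 + S (g x)) = x0 + g x"
          by (simp only: blinfun.add_right Mx0)
        then show ?thesis unfolding x(2) .
      qed
      then have "x - T x + x0 = x0 + g x" by (simp add: blinfun.diff_left px scaleC_one)
      then show ?thesis by (simp add: g_def blinfun.add_left scaleC_add_left scaleC_one algebra_simps)
    qed
    then show "\<exists>x. norm (x - x0) \<le> 1 \<and> x = x0 + S (blinfun_apply E x - p0 (blinfun_apply E x) *\<^sub>C x) \<and> p0 x = 1 \<and> blinfun_apply (T + E) x = (1 + p0 (blinfun_apply E x)) *\<^sub>C x"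
      using x px by (intro exI[of _ x]) (simp add: g_def dist_norm norm_minus_commute)
  qed
qed

lemma jet_tendsto_0:
  assumes "jet (Suc k) f"
  shows "\<forall>\<^sub>F t in nhds 0. norm (f t - f 0) \<le> C \<or> C \<le> 0"
proof (cases "C > 0")
  case True
  have "jet (Suc 0) f" using jet_mono[OF assms, of "Suc 0"] by (simp del: jet.simps)
  then obtain c g B where g: "\<forall>\<^sub>F t in nhds 0. f t = c + t *\<^sub>R g t" "\<forall>\<^sub>F t in nhds 0. norm (g t) \<le> B"
    by auto
  have c: "f 0 = c" using eventually_nhds_x_imp_x[OF g(1)] by simp
  have "C / (\<bar>B\<bar> + 1) > 0" using True by (intro divide_pos_pos) auto
  from eventually_abs_le_nhds_0[OF this] g show ?thesis
  proof eventually_elim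
    case (elim t)
    have "norm (f t - f 0) = \<bar>t\<bar> * norm (g t)" by (simp add: elim(2) c)
    also have "\<dots> \<le> (C / (\<bar>B\<bar> + 1)) * (\<bar>B\<bar> + 1)" using elim True by (intro mult_mono) auto
    also have "\<dots> = C" by simp
    finally show ?case by simp
  qed
qed auto

lemma jet_Suc_expand:
  assumes "jet (Suc k) f"
  obtains g where "jet k g" "\<forall>\<^sub>F t in nhds 0. f t = f 0 + t *\<^sub>R g t"
proof -
  obtain c g where g: "jet k g" "\<forall>\<^sub>F t in nhds 0. f t = c + t *\<^sub>R g t" using assms by auto
  have "f 0 = c" using eventually_nhds_x_imp_x[OF g(2)] by simp
  with g show ?thesis by (intro that[of g]) auto
qed

lemma jet_Suc_lipschitz:
  assumes "jet (Suc k) f"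
  obtains B where "B > 0" "\<forall>\<^sub>F t in nhds 0. norm (f t - f 0) \<le> B * \<bar>t\<bar>"
proof -
  obtain g where g: "jet 0 g" "\<forall>\<^sub>F t in nhds 0. f t = f 0 + t *\<^sub>R g t"
    by (rule jet_Suc_expand[OF jet_mono[OF assms, of "Suc 0"]]) auto
  from g(1) obtain B where "\<forall>\<^sub>F t in nhds 0. norm (g t) \<le> B" by auto
  with g(2) have "\<forall>\<^sub>F t in nhds 0. norm (f t - f 0) \<le> (\<bar>B\<bar> + 1) * \<bar>t\<bar>"
  proof eventually_elim
    case (elim t)
    have "norm (f t - f 0) = \<bar>t\<bar> * norm (g t)" by (subst elim(1)) simp
    also have "\<dots> \<le> \<bar>t\<bar> * (\<bar>B\<bar> + 1)" using elim by (intro mult_left_mono) auto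
    finally show ?case by (simp add: mult.commute)
  qed
  then show ?thesis by (intro that[of "\<bar>B\<bar> + 1"]) auto
qed


text \<open>With right eigenvector \<open>y t\<close>, left eigenvector \<open>p t\<close> and p t
  (y t) = 1, the remainder \<open>Q t\<close> satisfies p t o Q t = 0, so that L^N = lam^N (y t
  tensor p t) + (Q t)^N for N \<ge> 1; at N = 0 the identity is counted differently. The leading
  coefficient is then mu t = p t v * l (y t). The second estimate compares \<open>Q t\<close> with
  \<open>Q 0\<close> and gains the factor t.\<close>

lemma leading_term_of_powers:
  fixes L :: "real \<Rightarrow> ('b::{complex_normed_vector,banach} \<Rightarrow>\<^sub>L 'b)" and l :: "'b \<Rightarrow>\<^sub>L complex"
  assumes lin_L: "\<And>t. clinear_op (L t)" and lin_l: "clinear_fun l" and jet_L: "jet (Suc k) L"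
    and isol: "isolated_in_spectrum (L 0) 1" and simple: "simple_eigenvalue (L 0) 1"
    and other: "\<And>z. z \<in> eigenvalues (L 0) \<Longrightarrow> z \<noteq> 1 \<Longrightarrow> cmod z < 1"
    and ess: "\<exists>\<rho><1. ess_spectrum (L 0) \<subseteq> cball 0 \<rho>"
  obtains d C \<theta> lam mu where "d > 0" "C > 0" "0 < \<theta>" "\<theta> < 1"
    "jet (Suc k) lam" "jet (Suc k) mu" "lam 0 = 1"
    "\<And>t N. \<bar>t\<bar> \<le> d \<Longrightarrow> N \<ge> 1 \<Longrightarrow> cmod (l (blpow (L t) N v) - lam t ^ N * mu t) \<le> C * \<theta> ^ N"
    "\<And>t N. \<bar>t\<bar> \<le> d \<Longrightarrow> N \<ge> 1 \<Longrightarrow>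
      cmod ((l (blpow (L t) N v) - lam t ^ N * mu t) - (l (blpow (L 0) N v) - lam 0 ^ N * mu 0)) \<le> C * N * \<theta> ^ N * \<bar>t\<bar>"
proof -
  obtain x0 p0 n where Tx0: "L 0 x0 = x0" and p0_lin: "clinear_fun p0" and p0x0: "p0 x0 = 1" and p0T: "\<And>x. p0 (L 0 x) = p0 x"
    and n: "0 < n" "norm (blpow (L 0 - rank_one x0 p0) n) \<le> 1/2"
    and inv: "\<And>z. cmod z \<le> 1 \<Longrightarrow> \<exists>S. is_inverse (id_blinfun - (cscale z o\<^sub>L (L 0 - rank_one x0 p0))) S"
    by (rule leading_eigenvalue_splitting[OF lin_L[of 0] isol simple other ess]) (assumption, assumption, rule that)
  let ?P = "rank_one x0 p0"
  have p0_scaleC: "p0 (c *\<^sub>C y) = c * p0 y" for c y using p0_lin by (simp add: clinear_fun_def)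
  have L_scaleC: "L t (c *\<^sub>C y) = c *\<^sub>C L t y" for t c y using lin_L[of t] by (simp add: clinear_op_def)
  have c1: "cscale 1 o\<^sub>L A = A" for A :: "'b \<Rightarrow>\<^sub>L 'b" by (rule blinfun_eqI) (simp add: scaleC_one)
  obtain S where S: "is_inverse (id_blinfun - (L 0 - ?P)) S"
    using inv[of 1] unfolding c1 by auto
  define E where "E t = L t - L 0" for t
  obtain W where W: "jet k W" "\<forall>\<^sub>F t in nhds 0. L t = L 0 + t *\<^sub>R W t"
    by (rule jet_Suc_expand[OF jet_L]) (rule that)
  have E0: "E 0 = 0" by (simp add: E_def)
  have jet_E: "jet (Suc k) E" unfolding E_def by (intro jet_diff jet_L jet_const)
  have EW: "\<forall>\<^sub>F t in nhds 0. E t = t *\<^sub>R W t"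
    using W(2) by eventually_elim (simp add: E_def)
  obtain \<eta> where \<eta>: "\<eta> > 0" "\<And>E :: 'b \<Rightarrow>\<^sub>L 'b. norm E \<le> \<eta> \<Longrightarrow>
    \<exists>x. norm (x - x0) \<le> 1 \<and> x = x0 + S (blinfun_apply E x - p0 (blinfun_apply E x) *\<^sub>C x) \<and> p0 x = 1 \<and> blinfun_apply (L 0 + E) x = (1 + p0 (blinfun_apply E x)) *\<^sub>C x"
    by (rule perturbed_eigenvector[OF Tx0 p0_lin p0x0 p0T S]) (rule that)
  have "\<forall>t. \<exists>x. norm (E t) \<le> \<eta> \<longrightarrow> norm (x - x0) \<le> 1 \<and> x = x0 + S (E t x - p0 (E t x) *\<^sub>C x) \<and> p0 x = 1
      \<and> (L 0 + E t) x = (1 + p0 (E t x)) *\<^sub>C x"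
    using \<eta>(2) by blast
  then obtain x where x: "\<And>t. norm (E t) \<le> \<eta> \<Longrightarrow> norm (x t - x0) \<le> 1"
    "\<And>t. norm (E t) \<le> \<eta> \<Longrightarrow> x t = x0 + S (E t (x t) - p0 (E t (x t)) *\<^sub>C x t)"
    "\<And>t. norm (E t) \<le> \<eta> \<Longrightarrow> p0 (x t) = 1"
    "\<And>t. norm (E t) \<le> \<eta> \<Longrightarrow> (L 0 + E t) (x t) = (1 + p0 (E t (x t))) *\<^sub>C x t"
    unfolding choice_iff by blast
  have small: "\<forall>\<^sub>F t in nhds 0. norm (E t) \<le> \<eta>"
    using jet_tendsto_0[OF jet_E, of \<eta>] \<eta>(1) by (simp add: E0 not_le)
  \<comment> \<open>Bootstrapping: because of the factor t in the fixed point equation, an expansion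
    of \<open>x\<close> of order j < k + 1 on the right gives order j + 1 on the left. It starts
    from mere boundedness.\<close>
  have jet_x: "jet j x" if "j \<le> Suc k" for j
    using that
  proof (induction j)
    case 0
    have "\<forall>\<^sub>F t in nhds 0. norm (x t) \<le> norm x0 + 1"
      using small
    proof eventually_elim
      case (elim t)
      then show ?case using x(1)[of t] norm_triangle_sub[of "x t" x0] by linarith
    qed
    then show ?case by auto
  next
    case (Suc j)
    have "\<forall>\<^sub>F t in nhds 0. x t = x0 + t *\<^sub>R S (W t (x t) - p0 (W t (x t)) *\<^sub>C x t)"
      using small EW
    proof eventually_elim
      case (elim t)
      have "E t (x t) - p0 (E t (x t)) *\<^sub>C x t = t *\<^sub>R (W t (x t) - p0 (W t (x t)) *\<^sub>C x t)"
        by (simp add: elim(2) blinfun.scaleR_left blinfun.scaleR_right scaleR_diff_right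
            bounded_bilinear.scaleR_left[OF bounded_bilinear_scaleC])
      then show ?case using x(2)[OF elim(1)] by (simp add: blinfun.scaleR_right)
    qed
    moreover have "jet j (\<lambda>t. S (W t (x t) - p0 (W t (x t)) *\<^sub>C x t))"
    proof -
      have jx: "jet j x" and jW: "jet j W" using Suc jet_mono[OF W(1)] by auto
      have jWx: "jet j (\<lambda>t. W t (x t))" by (rule jet_bilinear[OF bounded_bilinear_blinfun_apply jW jx])
      show ?thesis
        by (intro jet_linear[OF blinfun.bounded_linear_right] jet_diff jWx jet_bilinear[OF bounded_bilinear_scaleC] jx)
    qed
    ultimately show ?case by (rule jet_SucI'[rotated])
  qed
  have jx: "jet (Suc k) x" by (rule jet_x) simp
  have x_0: "x 0 = x0" using x(2)[of 0] \<eta>(1) by (simp add: E0 blinfun.zero_right)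
  define lam where "lam t = 1 + p0 (E t (x t))" for t
  have jlam: "jet (Suc k) lam" unfolding lam_def
    by (intro jet_add jet_const jet_linear[OF blinfun.bounded_linear_right] jet_bilinear[OF bounded_bilinear_blinfun_apply] jet_E jx)
  have lam0: "lam 0 = 1" by (simp add: lam_def E0)
  have away: "\<forall>\<^sub>F t in nhds 0. 1/2 \<le> cmod (f t)" if "jet (Suc k) f" "f 0 = 1" for f
    using jet_tendsto_0[OF that(1), of "1/2"]
  proof eventually_elim
    case (elim t)
    then show ?case using that(2) norm_triangle_ineq2[of 1 "1 - f t"] by (simp add: norm_minus_commute)
  qed
  \<comment> \<open>The left eigenvector is sought through an invertible operator:
    \<open>B t\<close> is a small perturbation of \<open>B 0\<close> = 1 - M, whose inverse is
    \<open>S\<close>, and \<zeta> is tuned so that lam t becomes the eigenvalue 1 of \<zeta> t L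
    t.\<close>
  define \<zeta> where "\<zeta> t = inverse (lam t)" for t
  have j\<zeta>: "jet (Suc k) \<zeta>" unfolding \<zeta>_def
    by (rule jet_inverse[OF jlam _ away[OF jlam lam0]]) simp
  define B where "B t = id_blinfun - (cscale (\<zeta> t) o\<^sub>L (L t - ?P))" for t
  have jB: "jet (Suc k) B" unfolding B_def
    by (intro jet_diff jet_const jet_bilinear[OF bounded_bilinear_blinfun_compose] jet_linear[OF bounded_linear_cscale] j\<zeta> jet_L)
  have B0: "B 0 = id_blinfun - (L 0 - ?P)" by (simp add: B_def \<zeta>_def lam0 c1)
  have SB: "is_inverse (B 0) S" using S unfolding B0 .
  obtain V where V: "jet k V" "\<forall>\<^sub>F t in nhds 0. B t = B 0 + t *\<^sub>R V t"
    by (rule jet_Suc_expand[OF jB]) (rule that)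
  have near: "\<forall>\<^sub>F t in nhds 0. norm (B t - B 0) * norm S \<le> 1/2"
  proof -
    have p: "1 / (2 * (norm S + 1)) > 0" by (simp add: add_nonneg_pos)
    show ?thesis using jet_tendsto_0[OF jB, of "1 / (2 * (norm S + 1))"]
    proof eventually_elim
      case (elim t)
      then have "norm (B t - B 0) * norm S \<le> (1 / (2 * (norm S + 1))) * (norm S + 1)"
        using p by (intro mult_mono) auto
      also have "\<dots> = 1/2"
      proof -
        have "norm S + 1 > 0" by (simp add: add_nonneg_pos)
        then show ?thesis using nonzero_divide_mult_cancel_right[of "norm S + 1" 2] by simp
      qed
      finally show ?case .
    qed
  qed
  have "\<exists>R. norm (B t - B 0) * norm S \<le> 1/2 \<longrightarrow> is_inverse (B t) R \<and> norm R \<le> 2 * norm S" for t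
  proof (cases "norm (B t - B 0) * norm S \<le> 1/2")
    case True
    then have "norm (B t - B 0) * norm S < 1" by linarith
    then obtain R where R: "is_inverse (B t) R" "norm R \<le> norm S / (1 - norm (B t - B 0) * norm S)"
      by (rule is_inverse_perturb[OF SB]) (rule that)
    have "norm S / (1 - norm (B t - B 0) * norm S) \<le> norm S / (1/2)"
      using True by (intro divide_left_mono) auto
    with R show ?thesis by (intro exI[of _ R]) auto
  qed auto
  then obtain R where R: "\<And>t. norm (B t - B 0) * norm S \<le> 1/2 \<Longrightarrow> is_inverse (B t) (R t)"
    "\<And>t. norm (B t - B 0) * norm S \<le> 1/2 \<Longrightarrow> norm (R t) \<le> 2 * norm S"
    by metis
  \<comment> \<open>The resolvent identity R = S - t R V S again carries a factor t, so expansions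
    of \<open>R\<close> gain one order per round, starting from the bound 2 norm S.\<close>
  have jet_R: "jet j R" if "j \<le> Suc k" for j
    using that
  proof (induction j)
    case 0
    from near have "\<forall>\<^sub>F t in nhds 0. norm (R t) \<le> 2 * norm S" by eventually_elim (rule R(2))
    then show ?case by auto
  next
    case (Suc j)
    have "\<forall>\<^sub>F t in nhds 0. R t = S + t *\<^sub>R (- (R t o\<^sub>L (V t o\<^sub>L S)))"
      using near V(2)
    proof eventually_elim
      case (elim t)
      show ?case
      proof (rule blinfun_eqI)
        fix y
        have "R t (B t (S y)) = S y" using R(1)[OF elim(1)] by blast
        moreover have "B t (S y) = y + t *\<^sub>R V t (S y)"
          using SB by (subst elim(2)) (simp add: blinfun.add_left blinfun.scaleR_left)
        ultimately have "R t y + t *\<^sub>R R t (V t (S y)) = S y" by (simp add: blinfun.add_right blinfun.scaleR_right)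
        then show "R t y = (S + t *\<^sub>R (- (R t o\<^sub>L (V t o\<^sub>L S)))) y"
          by (simp add: blinfun.bilinear_simps algebra_simps)
      qed
    qed
    moreover have "jet j (\<lambda>t. - (R t o\<^sub>L (V t o\<^sub>L S)))"
    proof -
      have jR: "jet j R" and jV: "jet j V" using Suc jet_mono[OF V(1)] by auto
      show ?thesis
        by (intro jet_minus jet_bilinear[OF bounded_bilinear_blinfun_compose] jR jV jet_const)
    qed
    ultimately show ?case by (rule jet_SucI'[rotated])
  qed
  have jR: "jet (Suc k) R" by (rule jet_R) simp
  have R0: "R 0 = S" using is_inverse_unique[OF _ SB, of "R 0"] R(1)[of 0] by simp
  have pS: "p0 (S y) = p0 y" for y
  proof -
    have "p0 (B 0 (S y)) = p0 y" using SB by simp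
    then show ?thesis by (simp add: B0 blinfun.diff_left blinfun.diff_right p0T p0_scaleC p0x0)
  qed
  \<comment> \<open>\<open>p t\<close> is the left eigenvector: \<open>p t o B t = p0\<close>, and \<open>B t\<close> differs from \<open>1 - \<zeta> t * L t\<close> by a multiple of \<open>rank_one x0 p0\<close>.\<close>
  define p where "p t = p0 o\<^sub>L R t" for t
  have jp: "jet (Suc k) p" unfolding p_def
    by (intro jet_bilinear[OF bounded_bilinear_blinfun_compose] jet_const jR)
  have p_0: "p 0 = p0" by (rule blinfun_eqI) (simp add: p_def R0 pS)
  define q where "q t = p t (x t)" for t
  have jq: "jet (Suc k) q" unfolding q_def by (intro jet_bilinear[OF bounded_bilinear_blinfun_apply] jp jx)
  have q_0: "q 0 = 1" by (simp add: q_def p_0 x_0 p0x0)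
  define y where "y t = inverse (q t) *\<^sub>C x t" for t
  have jy: "jet (Suc k) y" unfolding y_def
    by (intro jet_bilinear[OF bounded_bilinear_scaleC] jet_inverse[OF jq _ away[OF jq q_0]] jx) simp
  have y_0: "y 0 = x0" by (simp add: y_def q_0 x_0 scaleC_one)
  \<comment> \<open>At t = 0 this is the operator from the splitting, one of whose powers has norm
    at most 1/2; hence its powers decay geometrically, uniformly for t near 0.\<close>
  define Q where "Q t = L t - rank_one (lam t *\<^sub>C y t) (p t)" for t
  have jQ: "jet (Suc k) Q" unfolding Q_def
    by (intro jet_diff jet_L jet_bilinear[OF bounded_bilinear_rank_one] jet_bilinear[OF bounded_bilinear_scaleC] jlam jy jp)
  have Q_0: "Q 0 = L 0 - ?P" by (simp add: Q_def lam0 y_0 p_0 scaleC_one)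
  obtain dQ CQ \<theta> where geo: "dQ > 0" "CQ > 0" "0 < \<theta>" "\<theta> < 1"
    "\<And>A N. norm (A - Q 0) < dQ \<Longrightarrow> norm (blpow A N) \<le> CQ * \<theta> ^ N"
    by (rule blpow_locally_uniform_geometric_bound[OF n(2,1), folded Q_0]) (rule that)
  have nearQ: "\<forall>\<^sub>F t in nhds 0. norm (Q t - Q 0) \<le> dQ / 2"
    using jet_tendsto_0[OF jQ, of "dQ/2"] geo(1) by (simp add: not_le)
  obtain BQ where BQ: "BQ > 0" "\<forall>\<^sub>F t in nhds 0. norm (Q t - Q 0) \<le> BQ * \<bar>t\<bar>"
    by (rule jet_Suc_lipschitz[OF jQ]) (rule that)
  have "\<forall>\<^sub>F t in nhds 0. norm (E t) \<le> \<eta> \<and> 1/2 \<le> cmod (lam t) \<and> norm (B t - B 0) * norm S \<le> 1/2 \<and> 1/2 \<le> cmod (q t)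
      \<and> norm (Q t - Q 0) \<le> dQ / 2 \<and> norm (Q t - Q 0) \<le> BQ * \<bar>t\<bar>"
    using small away[OF jlam lam0] near away[OF jq q_0] nearQ BQ(2) by eventually_elim blast
  then obtain d where d: "d > 0" and good: "\<And>t. \<bar>t\<bar> \<le> d \<Longrightarrow> norm (E t) \<le> \<eta> \<and> 1/2 \<le> cmod (lam t) \<and> norm (B t - B 0) * norm S \<le> 1/2
      \<and> 1/2 \<le> cmod (q t) \<and> norm (Q t - Q 0) \<le> dQ / 2 \<and> norm (Q t - Q 0) \<le> BQ * \<bar>t\<bar>"
    by (rule eventually_nhds_0_obtain) blast
  have powers: "blpow (L t) (Suc N) u = (lam t ^ Suc N * p t u) *\<^sub>C y t + blpow (Q t) (Suc N) u"
    if t: "\<bar>t\<bar> \<le> d" for t N u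
  proof -
    from good[OF t] have Et: "norm (E t) \<le> \<eta>" and lamt: "lam t \<noteq> 0" and qt: "q t \<noteq> 0"
      and Rt: "is_inverse (B t) (R t)" using R(1)[of t] by auto
    have zl: "\<zeta> t * lam t = 1" using lamt by (simp add: \<zeta>_def)
    have Lx: "L t (x t) = lam t *\<^sub>C x t" using x(4)[OF Et] by (simp add: E_def lam_def)
    have Bap: "B t u = u - \<zeta> t *\<^sub>C L t u + (\<zeta> t * p0 u) *\<^sub>C x0" for u
      by (simp add: B_def blinfun.diff_left scaleC_diff_right scaleC_scaleC)
    have "clinear_op (B t)"
      by (simp add: clinear_op_def Bap L_scaleC p0_scaleC scaleC_diff_right scaleC_add_right scaleC_scaleC mult_ac)
    then have "clinear_op (R t)" using clinear_op_inverse Rt by blast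
    then have p_scaleC: "p t (c *\<^sub>C u) = c * p t u" for c u
      by (simp add: p_def clinear_op_def p0_scaleC)
    have pB: "p t (B t u) = p0 u" for u using Rt by (simp add: p_def)
    have pB': "p t u - \<zeta> t * p t (L t u) + (\<zeta> t * p0 u) * p t x0 = p0 u" for u
      using pB[of u] by (simp add: Bap blinfun.add_right blinfun.diff_right p_scaleC)
    have "\<zeta> t * p t (lam t *\<^sub>C x t) = p t (x t)" unfolding p_scaleC using zl by (simp add: mult.assoc[symmetric])
    \<comment> \<open>Evaluating p t o B t = p0 at the right eigenvector, where p0 (x t) = 1 and
      \<zeta> t L t is the identity, fixes this constant. The rank one terms then cancel, which
      leaves p t o L t = lam t p t.\<close>
    then have "\<zeta> t * p t x0 = 1" using pB'[of "x t"] x(3)[OF Et] by (simp add: Lx)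
    then have px0: "(\<zeta> t * p0 u) * p t x0 = p0 u" for u by (metis mult.assoc mult.commute mult.right_neutral)
    have "p t u = \<zeta> t * p t (L t u)" for u using pB'[of u] unfolding px0 by simp
    then have pL: "p t (L t u) = lam t * p t u" for u by (metis mult.assoc mult.commute mult.right_neutral zl)
    have py: "p t (y t) = 1" using qt by (simp add: y_def p_scaleC q_def)
    have Ly: "L t (y t) = lam t *\<^sub>C y t" by (simp add: y_def L_scaleC Lx scaleC_scaleC mult.commute)
    have LQ: "L t u = (lam t * p t u) *\<^sub>C y t + Q t u" for u
      by (simp add: Q_def blinfun.diff_left scaleC_scaleC mult.commute)
    have pQ: "p t (Q t u) = 0" for u
      by (simp add: Q_def blinfun.diff_left blinfun.diff_right p_scaleC pL py)
    show ?thesis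
    proof (induction N)
      case 0
      then show ?case by (simp add: LQ)
    next
      case (Suc N)
      have "blpow (L t) (Suc (Suc N)) u = L t (blpow (L t) (Suc N) u)" by simp
      also have "\<dots> = (lam t ^ Suc N * p t u) *\<^sub>C L t (y t) + L t (blpow (Q t) (Suc N) u)"
        unfolding Suc by (simp only: blinfun.add_right L_scaleC)
      also have "L t (blpow (Q t) (Suc N) u) = blpow (Q t) (Suc (Suc N)) u"
        using LQ[of "blpow (Q t) (Suc N) u"] pQ by simp
      finally show ?case unfolding Ly by (simp add: scaleC_scaleC mult_ac)
    qed
  qed
  define mu where "mu t = p t v * l (y t)" for t
  have jmu: "jet (Suc k) mu" unfolding mu_def
    by (intro jet_bilinear[OF bounded_bilinear_mult] jet_bilinear[OF bounded_bilinear_blinfun_apply] jp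
        jet_const jet_linear[OF blinfun.bounded_linear_right] jy)
  have eps: "l (blpow (L t) N v) - lam t ^ N * mu t = l (blpow (Q t) N v)" if "\<bar>t\<bar> \<le> d" "N \<ge> 1" for t N
  proof -
    obtain N' where N': "N = Suc N'" using \<open>N \<ge> 1\<close> by (cases N) auto
    have "l (c *\<^sub>C u) = c * l u" for c u using lin_l by (simp add: clinear_fun_def)
    then show ?thesis unfolding N' powers[OF that(1)] by (simp add: blinfun.add_right mu_def mult_ac)
  qed
  define C where "C = norm l * norm v * (CQ + CQ\<^sup>2 / \<theta> * BQ) + 1"
  have nn: "CQ\<^sup>2 / \<theta> * BQ \<ge> 0" using geo BQ by simp
  have Cge: "norm l * norm v * CQ \<le> C" "norm l * norm v * (CQ\<^sup>2 / \<theta> * BQ) \<le> C"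
  proof -
    have "norm l * norm v * CQ \<le> norm l * norm v * (CQ + CQ\<^sup>2 / \<theta> * BQ)"
      "norm l * norm v * (CQ\<^sup>2 / \<theta> * BQ) \<le> norm l * norm v * (CQ + CQ\<^sup>2 / \<theta> * BQ)"
      using geo(2) nn by (auto intro!: mult_left_mono simp del: times_divide_eq_left)
    then show "norm l * norm v * CQ \<le> C" "norm l * norm v * (CQ\<^sup>2 / \<theta> * BQ) \<le> C"
      unfolding C_def by linarith+
  qed
  have C: "C > 0" unfolding C_def using geo nn by (intro add_nonneg_pos mult_nonneg_nonneg) auto
  have Qgeo: "norm (blpow (Q t) N) \<le> CQ * \<theta> ^ N" if "\<bar>t\<bar> \<le> d" for t N
    using good[OF that] geo(1) by (intro geo(5)) linarith
  have lv: "cmod (l (A v)) \<le> norm l * norm v * norm A" for A :: "'b \<Rightarrow>\<^sub>L 'b"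
  proof -
    have "cmod (l (A v)) \<le> norm l * (norm A * norm v)"
      by (rule order_trans[OF norm_blinfun mult_left_mono[OF norm_blinfun norm_ge_zero]])
    then show ?thesis by (simp add: mult_ac)
  qed
  show ?thesis
  proof (rule that[OF d C geo(3,4) jlam jmu lam0])
    fix t :: real and N :: nat assume t: "\<bar>t\<bar> \<le> d" and N: "N \<ge> 1"
    have "cmod (l (blpow (Q t) N v)) \<le> norm l * norm v * (CQ * \<theta> ^ N)"
      by (rule order_trans[OF lv mult_left_mono[OF Qgeo[OF t]]]) simp
    also have "\<dots> \<le> C * \<theta> ^ N"
      using mult_right_mono[OF Cge(1), of "\<theta> ^ N"] geo(3) by (simp add: mult.assoc)
    finally show "cmod (l (blpow (L t) N v) - lam t ^ N * mu t) \<le> C * \<theta> ^ N" unfolding eps[OF t N] .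
    have d0: "\<bar>0\<bar> \<le> d" using d by simp
    have "norm (blpow (Q t) N - blpow (Q 0) N) \<le> (CQ\<^sup>2 / \<theta>) * N * \<theta> ^ N * norm (Q t - Q 0)"
      by (rule blpow_diff_bound[OF Qgeo[OF t] Qgeo[OF d0] geo(3,2)])
    also have "\<dots> \<le> (CQ\<^sup>2 / \<theta>) * N * \<theta> ^ N * (BQ * \<bar>t\<bar>)"
      using good[OF t] geo(2,3) by (intro mult_left_mono) auto
    finally have "norm l * norm v * norm (blpow (Q t) N - blpow (Q 0) N) \<le> norm l * norm v * ((CQ\<^sup>2 / \<theta>) * N * \<theta> ^ N * (BQ * \<bar>t\<bar>))"
      by (intro mult_left_mono) auto
    also have "\<dots> = (norm l * norm v * (CQ\<^sup>2 / \<theta> * BQ)) * (real N * \<theta> ^ N * \<bar>t\<bar>)" by (simp add: mult_ac)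
    also have "\<dots> \<le> C * (real N * \<theta> ^ N * \<bar>t\<bar>)" using geo(3) by (intro mult_right_mono Cge) auto
    finally have "cmod (l ((blpow (Q t) N - blpow (Q 0) N) v)) \<le> C * (real N * \<theta> ^ N * \<bar>t\<bar>)"
      using lv[of "blpow (Q t) N - blpow (Q 0) N"] by linarith
    then show "cmod ((l (blpow (L t) N v) - lam t ^ N * mu t) - (l (blpow (L 0) N v) - lam 0 ^ N * mu 0)) \<le> C * N * \<theta> ^ N * \<bar>t\<bar>"
      unfolding eps[OF t N] eps[OF d0 N] by (simp add: blinfun.diff_left blinfun.diff_right mult_ac)
  qed
qed


subsection \<open>Smoothing with the Fejer kernel\<close>

text \<open>The even triangle weight on [-T, T] folded onto [0, T], hence the factor 2. Folding
  makes all transforms cosine integrals, and only positive frequencies remain.\<close>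

definition fejer_weight :: "real \<Rightarrow> real \<Rightarrow> real" where
  "fejer_weight T t = 2 * (1 - t / T) * indicator {0..T} t"

lemma measurable_fejer_weight [measurable]: "fejer_weight T \<in> borel_measurable borel"
  unfolding fejer_weight_def by measurable

lemma integrable_indicator_interval [simp]:
  "integrable lborel (\<lambda>t. indicator {a..b} t :: real)" "integrable lborel (\<lambda>t. indicator {a<..b} t :: real)"
  for a b :: real
proof -
  have fin: "emeasure lborel {a..b} < \<infinity>" by (simp add: emeasure_lborel_Icc_eq)
  then show "integrable lborel (\<lambda>t. indicator {a..b} t :: real)" by (intro integrable_real_indicator) auto
  have "emeasure lborel {a<..b} \<le> emeasure lborel {a..b}" by (intro emeasure_mono) auto
  then have "emeasure lborel {a<..b} < \<infinity>" using fin by (rule le_less_trans)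
  then show "integrable lborel (\<lambda>t. indicator {a<..b} t :: real)" by (intro integrable_real_indicator) auto
qed

text \<open>The Fejer kernel with total mass independent of T; the value at 0 is its limit
  there.\<close>

definition fejer :: "real \<Rightarrow> real \<Rightarrow> real" where
  "fejer T w = (if w = 0 then T else 2 * (1 - cos (T * w)) / (T * w\<^sup>2))"

lemma measurable_fejer [measurable]: "fejer T \<in> borel_measurable borel"
  unfolding fejer_def by measurable

lemma fejer_weight_bounds: "T > 0 \<Longrightarrow> 0 \<le> fejer_weight T t" "T > 0 \<Longrightarrow> fejer_weight T t \<le> 2 * indicator {0..T} t"
  by (auto simp: fejer_weight_def indicator_def field_simps)

lemma fejer_weight_cos_integral:
  assumes "T > 0"
  shows "has_bochner_integral lborel (\<lambda>t. fejer_weight T t * cos (t * w)) (fejer T w)"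
proof (cases "w = 0")
  case True
  let ?F = "\<lambda>t. 2 * t - t\<^sup>2 / T"
  have "has_bochner_integral lborel (\<lambda>t. (2 * (1 - t / T)) * indicator {0..T} t) (?F T - ?F 0)"
    using assms by (intro has_bochner_integral_FTC_Icc_real)
      (auto intro!: derivative_eq_intros continuous_intros simp: field_simps)
  then show ?thesis using True assms by (simp add: fejer_weight_def fejer_def power2_eq_square)
next
  case False
  let ?F = "\<lambda>t. 2 * (1 - t / T) * sin (t * w) / w - 2 * cos (t * w) / (T * w\<^sup>2)"
  have "has_bochner_integral lborel (\<lambda>t. (2 * (1 - t / T) * cos (t * w)) * indicator {0..T} t) (?F T - ?F 0)"
  proof (rule has_bochner_integral_FTC_Icc_real)
    fix t
    show "DERIV ?F t :> 2 * (1 - t / T) * cos (t * w)"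
      using assms False
      by (auto intro!: derivative_eq_intros simp: power2_eq_square) (simp add: field_simps)
  qed (use assms in \<open>auto intro!: continuous_intros\<close>)
  moreover have "?F T - ?F 0 = fejer T w" using assms False by (simp add: fejer_def field_simps)
  ultimately show ?thesis by (simp add: fejer_weight_def mult_ac)
qed

lemma fejer_nonneg: "T > 0 \<Longrightarrow> 0 \<le> fejer T w"
  by (auto simp: fejer_def intro!: divide_nonneg_nonneg)

lemma fejer_le: 
  assumes "T > 0"
  shows "fejer T w \<le> T"
proof -
  have "fejer T w = (\<integral>t. fejer_weight T t * cos (t * w) \<partial>lborel)"
    using fejer_weight_cos_integral[OF assms] by (simp add: has_bochner_integral_iff)
  also have "\<dots> \<le> (\<integral>t. fejer_weight T t * cos (t * 0) \<partial>lborel)"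
    using fejer_weight_cos_integral[OF assms, of w] fejer_weight_cos_integral[OF assms, of 0] fejer_weight_bounds(1)[OF assms]
    by (intro integral_mono) (auto simp: has_bochner_integral_iff intro!: mult_left_le)
  also have "\<dots> = T" using fejer_weight_cos_integral[OF assms, of 0] by (simp add: has_bochner_integral_iff fejer_def)
  finally show ?thesis .
qed

lemma fejer_scale: "T > 0 \<Longrightarrow> fejer T w = T * fejer 1 (T * w)"
  by (simp add: fejer_def power2_eq_square field_simps)

lemma integrable_inverse_1_plus_sq: "integrable lborel (\<lambda>x::real. inverse (1 + x\<^sup>2))"
  using integrable_inverse_1_plus_square by (simp add: set_integrable_def einterval_def)

lemma integrable_fejer:
  assumes "T > 0"
  shows "integrable lborel (fejer T)"
proof -
  have "integrable lborel (fejer 1)"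
  proof (rule Bochner_Integration.integrable_bound)
    show "integrable lborel (\<lambda>x::real. 5 * inverse (1 + x\<^sup>2))"
      by (intro integrable_mult_right integrable_inverse_1_plus_sq)
    \<comment> \<open>The sum of the two bounds \<open>fejer 1 x\<close> \<le> 1 and x^2
      \<open>fejer 1 x\<close> \<le> 4.\<close>
    have "fejer 1 x \<le> 5 * inverse (1 + x\<^sup>2)" for x
    proof -
      have "fejer 1 x * x\<^sup>2 \<le> 4"
      proof -
        have "2 * (1 - cos x) \<le> 2 * (1 - (- 1))"
          by (intro mult_left_mono diff_left_mono cos_ge_minus_one) simp
        then have "2 * (1 - cos x) \<le> 4" by simp
        then show ?thesis by (auto simp: fejer_def)
      qed
      with fejer_le[of 1 x] have "fejer 1 x * (1 + x\<^sup>2) \<le> 5" by (simp add: algebra_simps)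
      moreover have "0 < 1 + x\<^sup>2" by (simp add: add_pos_nonneg)
      ultimately show ?thesis by (simp add: field_simps)
    qed
    then show "AE x in lborel. norm (fejer 1 x) \<le> norm (5 * inverse (1 + x\<^sup>2))"
      by (intro AE_I2) (simp add: fejer_nonneg order_trans[OF _ abs_ge_self])
  qed simp
  then have "integrable lborel (\<lambda>w. fejer 1 (0 + T * w))"
    using assms by (subst lborel_integrable_real_affine_iff) auto
  then have "integrable lborel (\<lambda>w. T * fejer 1 (T * w))" by simp
  then show ?thesis by (simp only: fejer_scale[OF assms, symmetric])
qed

section \<open>Distribution and characteristic functions of weighted measures\<close>

lemma integrable_pair_mult:
  fixes f :: "'a \<Rightarrow> real" and g :: "'b \<Rightarrow> real"
  assumes "sigma_finite_measure M" "sigma_finite_measure N" "integrable M f" "integrable N g"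
  shows "integrable (M \<Otimes>\<^sub>M N) (\<lambda>(x, y). f x * g y)"
proof -
  interpret pair_sigma_finite M N using assms by (simp add: pair_sigma_finite_def)
  have [measurable]: "f \<in> borel_measurable M" "g \<in> borel_measurable N" using assms by auto
  show ?thesis
  proof (rule Fubini_integrable)
    show "integrable M (\<lambda>x. \<integral>y. norm (case (x, y) of (x, y) \<Rightarrow> f x * g y) \<partial>N)"
      using assms by (simp add: abs_mult)
  qed (use assms in auto)
qed

lemma fubini_bounded_by_product:
  fixes f :: "'a \<Rightarrow> 'b \<Rightarrow> 'c::{banach, second_countable_topology}"
  assumes "sigma_finite_measure M" "sigma_finite_measure N" "integrable M u" "integrable N v"
    and [measurable]: "(\<lambda>(x, y). f x y) \<in> borel_measurable (M \<Otimes>\<^sub>M N)"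
    and "\<And>x y. norm (f x y) \<le> u x * v y"
  shows "(\<integral>x. (\<integral>y. f x y \<partial>N) \<partial>M) = (\<integral>y. (\<integral>x. f x y \<partial>M) \<partial>N)"
    and "integrable N (\<lambda>y. \<integral>x. f x y \<partial>M)"
proof -
  interpret pair_sigma_finite M N using assms by (simp add: pair_sigma_finite_def)
  have "integrable (M \<Otimes>\<^sub>M N) (\<lambda>(x, y). f x y)"
    using integrable_pair_mult[OF assms(1-4)]
    by (rule Bochner_Integration.integrable_bound)
      (auto intro!: AE_I2 order_trans[OF assms(6) abs_ge_self])
  then show "(\<integral>x. (\<integral>y. f x y \<partial>N) \<partial>M) = (\<integral>y. (\<integral>x. f x y \<partial>M) \<partial>N)" "integrable N (\<lambda>y. \<integral>x. f x y \<partial>M)"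
    by (auto simp: Fubini_integral integrable_snd)
qed

text \<open>One setting for both sides of the comparison: the law of the normalised sum with weight
  1, and Lebesgue measure with the approximating density, which need not be positive.\<close>

locale weighted_line =
  fixes M :: "real measure" and h :: "real \<Rightarrow> real"
  assumes sigma_finite: "sigma_finite_measure M" and sets_M [measurable_cong]: "sets M = sets borel"
    and h: "integrable M h"
begin

definition cdfw :: "real \<Rightarrow> real" where "cdfw z = (\<integral>x. h x * indicator {..z} x \<partial>M)"

definition charw :: "real \<Rightarrow> complex" where "charw t = (CLINT x|M. of_real (h x) * cis (t * x))"

lemma h_measurable [measurable]: "h \<in> borel_measurable borel"
  using h by (auto simp: sets_M cong: measurable_cong_sets dest: borel_measurable_integrable)

lemma sigma_finite_lborel: "sigma_finite_measure (lborel :: real measure)"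
  by (rule lborel.sigma_finite_measure_axioms)

lemma integrable_h_mult:
  fixes g :: "real \<Rightarrow> 'c::{real_normed_algebra_1, banach, second_countable_topology}"
  assumes [measurable]: "g \<in> borel_measurable borel" and "\<And>x. norm (g x) \<le> 1"
  shows "integrable M (\<lambda>x. h x *\<^sub>R g x)"
  by (rule Bochner_Integration.integrable_bound[OF h])
    (auto simp: sets_M cong: measurable_cong_sets intro!: AE_I2 mult_left_le assms(2))

lemma measurable_charw [measurable]: "charw \<in> borel_measurable borel"
proof -
  interpret sigma_finite_measure M by (rule sigma_finite)
  show ?thesis unfolding charw_def cis_conv_exp by measurable
qed

lemma norm_charw_le: "cmod (charw t) \<le> (\<integral>x. \<bar>h x\<bar> \<partial>M)"
  unfolding charw_def by (rule order_trans[OF integral_norm_bound]) (simp add: norm_mult)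

lemma abs_cdfw_le: "\<bar>cdfw z\<bar> \<le> (\<integral>x. \<bar>h x\<bar> \<partial>M)"
proof -
  have i: "integrable M (\<lambda>x. h x * indicator {..z} x)"
    using integrable_h_mult[of "indicator {..z} :: real \<Rightarrow> real"] by (simp add: indicator_def)
  have "\<bar>cdfw z\<bar> \<le> (\<integral>x. \<bar>h x * indicator {..z} x\<bar> \<partial>M)"
    unfolding cdfw_def by (rule integral_abs_bound)
  also have "\<dots> \<le> (\<integral>x. \<bar>h x\<bar> \<partial>M)"
    using i h by (intro integral_mono) (auto simp: indicator_def)
  finally show ?thesis .
qed

lemma measurable_cdfw [measurable]: "cdfw \<in> borel_measurable borel"
proof -
  interpret sigma_finite_measure M by (rule sigma_finite)
  have eq: "cdfw = (\<lambda>z. \<integral>x. h x * (if x \<le> z then 1 else 0) \<partial>M)"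
    by (rule ext) (auto simp: cdfw_def indicator_def intro!: Bochner_Integration.integral_cong)
  show ?thesis by (subst eq) measurable
qed

lemma cdfw_tendsto_zero: "(\<lambda>n. cdfw (z - real n)) \<longlonglongrightarrow> 0"
proof -
  have "(\<lambda>n. \<integral>x. h x * indicator {..z - real n} x \<partial>M) \<longlonglongrightarrow> (\<integral>x. 0 \<partial>M)"
  proof (rule integral_dominated_convergence[where w = "\<lambda>x. \<bar>h x\<bar>"])
    show "AE x in M. (\<lambda>n. h x * indicator {..z - real n} x) \<longlonglongrightarrow> 0"
    proof (rule AE_I2)
      fix x
      obtain m :: nat where m: "z - x < real m" using reals_Archimedean2 by blast
      have "\<forall>\<^sub>F n in sequentially. h x * indicator {..z - real n} x = 0"
        using eventually_ge_at_top[of m] by eventually_elim (use m in \<open>simp add: indicator_def\<close>)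
      then show "(\<lambda>n. h x * indicator {..z - real n} x) \<longlonglongrightarrow> 0" by (rule tendsto_eventually)
    qed
  qed (use h in \<open>auto simp: sets_M indicator_def cong: measurable_cong_sets\<close>)
  then show ?thesis by (simp add: cdfw_def)
qed

text \<open>The kernel is a cosine integral over [0, T], so by Fubini averaging against it sees the
  characteristic function only on that interval.\<close>

lemma fejer_average:
  assumes T: "T > 0"
  shows "(\<integral>x. h x * fejer T (x - u) \<partial>M) = (\<integral>t. fejer_weight T t * Re (cis (- (t * u)) * charw t) \<partial>lborel)"
proof -
  have "(\<integral>x. h x * fejer T (x - u) \<partial>M) = (\<integral>x. (\<integral>t. h x * (fejer_weight T t * cos (t * (x - u))) \<partial>lborel) \<partial>M)"
    using fejer_weight_cos_integral[OF T] by (simp add: has_bochner_integral_iff)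
  also have "\<dots> = (\<integral>t. (\<integral>x. h x * (fejer_weight T t * cos (t * (x - u))) \<partial>M) \<partial>lborel)"
  proof (rule fubini_bounded_by_product(1)[OF sigma_finite sigma_finite_lborel])
    show "integrable M (\<lambda>x. \<bar>h x\<bar>)" using h by simp
    show "integrable lborel (\<lambda>t. 2 * indicator {0..T} t :: real)" by simp
    show "norm (h x * (fejer_weight T t * cos (t * (x - u)))) \<le> \<bar>h x\<bar> * (2 * indicator {0..T} t)" for x t
      unfolding real_norm_def abs_mult[of "h x"]
    proof (intro mult_left_mono)
      have "\<bar>fejer_weight T t * cos (t * (x - u))\<bar> \<le> fejer_weight T t * 1"
        unfolding abs_mult using fejer_weight_bounds(1)[OF T, of t] by (intro mult_mono) auto
      then show "\<bar>fejer_weight T t * cos (t * (x - u))\<bar> \<le> 2 * indicator {0..T} t"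
        using fejer_weight_bounds(2)[OF T, of t] by linarith
    qed auto
  qed measurable
  also have "\<dots> = (\<integral>t. fejer_weight T t * Re (cis (- (t * u)) * charw t) \<partial>lborel)"
  proof (intro Bochner_Integration.integral_cong refl)
    fix t
    have i: "integrable M (\<lambda>x. h x *\<^sub>R cis (t * (x - u)))"
      by (rule integrable_h_mult) (auto simp: cis_conv_exp)
    have "cis (- (t * u)) * charw t = (CLINT x|M. cis (- (t * u)) * (of_real (h x) * cis (t * x)))"
      unfolding charw_def by simp
    also have "\<dots> = (CLINT x|M. h x *\<^sub>R cis (t * (x - u)))"
      by (intro Bochner_Integration.integral_cong refl)
        (simp add: scaleR_conv_of_real cis_mult algebra_simps flip: mult.assoc)
    finally have "Re (cis (- (t * u)) * charw t) = (\<integral>x. h x * cos (t * (x - u)) \<partial>M)"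
      by (simp only: integral_Re[OF i, symmetric]) simp
    moreover have "(\<integral>x. h x * (fejer_weight T t * cos (t * (x - u))) \<partial>M) = (\<integral>x. fejer_weight T t * (h x * cos (t * (x - u))) \<partial>M)"
      by (intro Bochner_Integration.integral_cong refl) (simp only: mult.left_commute)
    ultimately show "(\<integral>x. h x * (fejer_weight T t * cos (t * (x - u))) \<partial>M) = fejer_weight T t * Re (cis (- (t * u)) * charw t)"
      by (simp only: integral_mult_right_zero)
  qed
  finally show ?thesis .
qed

text \<open>Increments over (a, b] are used because their indicator is integrable, so Fubini
  applies; for a distribution function by itself the corresponding half-line indicator is
  not.\<close>

lemma fejer_cdfw_diff:
  assumes T: "T > 0" and ab: "a \<le> b"
  shows "(\<integral>w. fejer T w * (cdfw (b + w) - cdfw (a + w)) \<partial>lborel)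
      = (\<integral>u. indicator {a<..b} u * (\<integral>x. h x * fejer T (x - u) \<partial>M) \<partial>lborel)"
proof -
  have ind: "cdfw (b + w) - cdfw (a + w) = (\<integral>x. h x * indicator {a<..b} (x - w) \<partial>M)" for w
  proof -
    have i: "integrable M (\<lambda>x. h x * indicator {..z} x)" for z
      using integrable_h_mult[of "indicator {..z} :: real \<Rightarrow> real"] by (simp add: indicator_def)
    have "cdfw (b + w) - cdfw (a + w) = (\<integral>x. h x * indicator {..b+w} x - h x * indicator {..a+w} x \<partial>M)"
      unfolding cdfw_def by (rule Bochner_Integration.integral_diff[symmetric]) (rule i)+
    also have "\<dots> = (\<integral>x. h x * indicator {a<..b} (x - w) \<partial>M)"
      using ab by (intro Bochner_Integration.integral_cong refl) (auto simp: indicator_def)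
    finally show ?thesis .
  qed
  have "(\<integral>u. indicator {a<..b} u * (\<integral>x. h x * fejer T (x - u) \<partial>M) \<partial>lborel)
      = (\<integral>u. (\<integral>x. indicator {a<..b} u * (h x * fejer T (x - u)) \<partial>M) \<partial>lborel)"
    by simp
  also have "\<dots> = (\<integral>x. (\<integral>u. indicator {a<..b} u * (h x * fejer T (x - u)) \<partial>lborel) \<partial>M)"
  proof (rule fubini_bounded_by_product(1)[OF sigma_finite_lborel sigma_finite])
    show "integrable lborel (\<lambda>u. T * indicator {a<..b} u :: real)" by simp
    show "integrable M (\<lambda>x. \<bar>h x\<bar>)" using h by simp
    show "norm (indicator {a<..b} u * (h x * fejer T (x - u))) \<le> T * indicator {a<..b} u * \<bar>h x\<bar>" for u x
      using mult_left_mono[OF fejer_le[OF T, of "x - u"], of "\<bar>h x\<bar>"] fejer_nonneg[OF T, of "x - u"]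
      by (auto simp: abs_mult indicator_def mult.commute)
  qed measurable
  also have "\<dots> = (\<integral>x. (\<integral>w. indicator {a<..b} (x - w) * (h x * fejer T w) \<partial>lborel) \<partial>M)"
  proof (rule Bochner_Integration.integral_cong[OF refl])
    fix x
    show "(\<integral>u. indicator {a<..b} u * (h x * fejer T (x - u)) \<partial>lborel) = (\<integral>w. indicator {a<..b} (x - w) * (h x * fejer T w) \<partial>lborel)"
      using lborel_integral_real_affine[of "-1" "\<lambda>u. indicator {a<..b} u * (h x * fejer T (x - u))" x] by simp
  qed
  also have "\<dots> = (\<integral>w. (\<integral>x. indicator {a<..b} (x - w) * (h x * fejer T w) \<partial>M) \<partial>lborel)"
  proof (rule fubini_bounded_by_product(1)[OF sigma_finite sigma_finite_lborel])
    show "integrable lborel (fejer T)" by (rule integrable_fejer[OF T])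
    show "integrable M (\<lambda>x. \<bar>h x\<bar>)" using h by simp
    show "norm (indicator {a<..b} (x - w) * (h x * fejer T w)) \<le> \<bar>h x\<bar> * fejer T w" for x w
      using fejer_nonneg[OF T, of w] by (auto simp: abs_mult indicator_def)
  qed measurable
  also have "\<dots> = (\<integral>w. fejer T w * (cdfw (b + w) - cdfw (a + w)) \<partial>lborel)"
    unfolding ind
  proof (rule Bochner_Integration.integral_cong[OF refl])
    fix w
    have "(\<integral>x. indicator {a<..b} (x - w) * (h x * fejer T w) \<partial>M) = (\<integral>x. fejer T w * (h x * indicator {a<..b} (x - w)) \<partial>M)"
      by (intro Bochner_Integration.integral_cong refl) (simp only: mult_ac)
    then show "(\<integral>x. indicator {a<..b} (x - w) * (h x * fejer T w) \<partial>M) = fejer T w * (\<integral>x. h x * indicator {a<..b} (x - w) \<partial>M)"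
      by (simp only: integral_mult_right_zero)
  qed
  finally show ?thesis ..
qed

lemma integrable_fejer_cdfw:
  assumes T: "T > 0"
  shows "integrable lborel (\<lambda>w. fejer T w * cdfw (b + w))"
proof (rule Bochner_Integration.integrable_bound)
  show "integrable lborel (\<lambda>w. (\<integral>x. \<bar>h x\<bar> \<partial>M) * fejer T w)"
    by (intro integrable_mult_right integrable_fejer T)
  show "AE w in lborel. norm (fejer T w * cdfw (b + w)) \<le> norm ((\<integral>x. \<bar>h x\<bar> \<partial>M) * fejer T w)"
    using abs_cdfw_le fejer_nonneg[OF T]
    by (intro AE_I2) (auto simp: abs_mult mult.commute intro!: mult_left_mono order_trans[OF abs_cdfw_le abs_ge_self])
qed measurable

text \<open>Sending the left end point to minus infinity recovers the smoothed distribution function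
  from its increments.\<close>

lemma fejer_cdfw_tendsto:
  assumes T: "T > 0"
  shows "(\<lambda>n. \<integral>w. fejer T w * cdfw (b - real n + w) \<partial>lborel) \<longlonglongrightarrow> 0"
proof -
  have "(\<lambda>n. \<integral>w. fejer T w * cdfw (b - real n + w) \<partial>lborel) \<longlonglongrightarrow> (\<integral>w. 0 \<partial>(lborel :: real measure))"
  proof (rule integral_dominated_convergence[where w = "\<lambda>w. (\<integral>x. \<bar>h x\<bar> \<partial>M) * fejer T w"])
    show "integrable lborel (\<lambda>w. (\<integral>x. \<bar>h x\<bar> \<partial>M) * fejer T w)"
      by (intro integrable_mult_right integrable_fejer T)
    show "AE w in lborel. (\<lambda>n. fejer T w * cdfw (b - real n + w)) \<longlonglongrightarrow> 0"
    proof (intro AE_I2 tendsto_mult_right_zero)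
      fix w
      show "(\<lambda>n. cdfw (b - real n + w)) \<longlonglongrightarrow> 0"
        using cdfw_tendsto_zero[of "b + w"] by (simp add: algebra_simps)
    qed
    show "AE w in lborel. norm (fejer T w * cdfw (b - real n + w)) \<le> (\<integral>x. \<bar>h x\<bar> \<partial>M) * fejer T w" for n
      using abs_cdfw_le fejer_nonneg[OF T]
      by (intro AE_I2) (auto simp: abs_mult mult.commute intro!: mult_left_mono)
  qed measurable
  then show ?thesis by simp
qed

end


lemma has_vector_derivative_cis_mult:
  "((\<lambda>y. cis (a * y)) has_vector_derivative (\<i> * of_real a) * cis (a * y)) (at y within S)"
proof -
  have "((\<lambda>y. a * y) has_vector_derivative a) (at y within S)"
    by (auto intro!: derivative_eq_intros simp: has_vector_derivative_def)
  from vector_diff_chain_within[OF this has_vector_derivative_iexp]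
  show ?thesis by (simp add: cis_conv_exp o_def scaleR_conv_of_real mult_ac)
qed

lemma fejer_minus: "fejer T (- w) = fejer T w"
  by (simp add: fejer_def)

text \<open>The bound does not depend on the length of the interval, so it survives letting a tend
  to minus infinity. It is the source of the division by t in Esseen's argument.\<close>

lemma indicator_cis_integral_bound:
  assumes ab: "a \<le> b" and t: "t > 0"
  shows "cmod (\<integral>u. indicator {a<..b} u *\<^sub>R cis (- (t * u)) \<partial>lborel) \<le> 2 / t"
proof -
  let ?F = "\<lambda>u. (\<i> / of_real t) * exp (\<i> * of_real (- (t * u)))"
  have "(\<integral>u. indicator {a<..b} u *\<^sub>R cis (- (t * u)) \<partial>lborel) = (\<integral>u. indicator {a..b} u *\<^sub>R cis (- (t * u)) \<partial>lborel)"
  proof (rule integral_cong_AE)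
    show "AE u in lborel. indicator {a<..b} u *\<^sub>R cis (- (t * u)) = indicator {a..b} u *\<^sub>R cis (- (t * u))"
      using AE_lborel_singleton[of a] by eventually_elim (auto simp: indicator_def)
  qed (unfold cis_conv_exp, measurable)
  also have "\<dots> = ?F b - ?F a"
  proof (rule integral_FTC_Icc[OF ab])
    fix u
    have "((\<lambda>u. (\<i> / of_real t) * cis ((- t) * u)) has_vector_derivative (\<i> / of_real t) * ((\<i> * of_real (- t)) * cis ((- t) * u))) (at u within {a..b})"
      by (intro has_vector_derivative_mult_right has_vector_derivative_cis_mult)
    then show "(?F has_vector_derivative cis (- (t * u))) (at u within {a..b})"
      using t by (simp add: cis_conv_exp mult_ac)
  qed (unfold cis_conv_exp, intro continuous_intros)
  also have "cmod (?F b - ?F a) \<le> cmod (?F b) + cmod (?F a)" by (rule norm_triangle_ineq4)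
  also have "\<dots> = 2 / t" using t by (simp add: norm_mult norm_divide flip: cis_conv_exp)
  finally show ?thesis .
qed

lemma (in weighted_line) fejer_cdfw_fourier:
  assumes T: "T > 0" and ab: "a \<le> b"
  defines "q \<equiv> \<lambda>t. \<integral>u. indicator {a<..b} u *\<^sub>R cis (- (t * u)) \<partial>lborel"
  shows "(\<integral>w. fejer T w * (cdfw (b + w) - cdfw (a + w)) \<partial>lborel) = (\<integral>t. fejer_weight T t * Re (q t * charw t) \<partial>lborel)"
    and "integrable lborel (\<lambda>t. fejer_weight T t * Re (q t * charw t))"
proof -
  let ?c = "\<integral>x. \<bar>h x\<bar> \<partial>M"
  let ?f = "\<lambda>u t. indicator {a<..b} u * (fejer_weight T t * Re (cis (- (t * u)) * charw t))"
  have c: "?c \<ge> 0" by simp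
  have bound: "norm (?f u t) \<le> indicator {a<..b} u * ((2 * ?c) * indicator {0..T} t)" for u t
  proof -
    have "\<bar>Re (cis (- (t * u)) * charw t)\<bar> \<le> cmod (cis (- (t * u)) * charw t)" by (rule abs_Re_le_cmod)
    also have "\<dots> \<le> ?c" using norm_charw_le[of t] by (simp add: norm_mult)
    finally have "fejer_weight T t * \<bar>Re (cis (- (t * u)) * charw t)\<bar> \<le> (2 * indicator {0..T} t) * ?c"
      using fejer_weight_bounds[OF T, of t] c by (intro mult_mono) auto
    then have "indicator {a<..b} u * (fejer_weight T t * \<bar>Re (cis (- (t * u)) * charw t)\<bar>) \<le> indicator {a<..b} u * ((2 * indicator {0..T} t) * ?c)"
      by (intro mult_left_mono) auto
    moreover have "norm (?f u t) = indicator {a<..b} u * (fejer_weight T t * \<bar>Re (cis (- (t * u)) * charw t)\<bar>)"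
      using fejer_weight_bounds(1)[OF T, of t] by (simp only: real_norm_def abs_mult abs_of_nonneg) simp
    ultimately show ?thesis by (simp only: mult_ac)
  qed
  have int1: "integrable lborel (\<lambda>u. indicator {a<..b} u :: real)" by simp
  have int2: "integrable lborel (\<lambda>t. (2 * ?c) * indicator {0..T} t)" by (intro integrable_mult_right) simp
  have meas: "(\<lambda>(u, t). ?f u t) \<in> borel_measurable (lborel \<Otimes>\<^sub>M lborel)"
    unfolding cis_conv_exp by measurable
  note fub = fubini_bounded_by_product[OF sigma_finite_lborel sigma_finite_lborel int1 int2 meas bound]
  have inner: "(\<integral>u. ?f u t \<partial>lborel) = fejer_weight T t * Re (q t * charw t)" for t
  proof -
    have i: "integrable lborel (\<lambda>u. indicator {a<..b} u *\<^sub>R cis (- (t * u)))"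
      by (rule Bochner_Integration.integrable_bound[OF int1]) (auto simp: cis_conv_exp)
    have "Re (q t * charw t) = Re (\<integral>u. (indicator {a<..b} u *\<^sub>R cis (- (t * u))) * charw t \<partial>lborel)"
      by (simp only: integral_mult_left_zero q_def)
    also have "\<dots> = (\<integral>u. Re ((indicator {a<..b} u *\<^sub>R cis (- (t * u))) * charw t) \<partial>lborel)"
      by (intro integral_Re[symmetric] integrable_mult_left i)
    also have "\<dots> = (\<integral>u. indicator {a<..b} u * Re (cis (- (t * u)) * charw t) \<partial>lborel)"
      by (intro Bochner_Integration.integral_cong refl) (simp add: indicator_def)
    moreover have "(\<integral>u. ?f u t \<partial>lborel) = (\<integral>u. fejer_weight T t * (indicator {a<..b} u * Re (cis (- (t * u)) * charw t)) \<partial>lborel)"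
      by (intro Bochner_Integration.integral_cong refl) (simp only: mult.left_commute)
    ultimately show ?thesis by (simp only: integral_mult_right_zero)
  qed
  show "(\<integral>w. fejer T w * (cdfw (b + w) - cdfw (a + w)) \<partial>lborel) = (\<integral>t. fejer_weight T t * Re (q t * charw t) \<partial>lborel)"
    unfolding fejer_cdfw_diff[OF T ab] fejer_average[OF T] inner[symmetric] fub(1)[symmetric] by simp
  show "integrable lborel (\<lambda>t. fejer_weight T t * Re (q t * charw t))"
    using fub(2) unfolding inner .
qed

text \<open>Working with increments over (b - n, b] avoids an inversion formula with a singularity
  at 0. The constant 4 is 2 from the weight times 2 from the bound 2/t, whose 1/t cancels the factor
  t of the hypothesis.\<close>

lemma fejer_smoothed_difference_bound:
  assumes A: "weighted_line M1 h1" and B: "weighted_line M2 h2" and T: "T > 0"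
    and H: "\<And>t. 0 < t \<Longrightarrow> t \<le> T \<Longrightarrow> cmod (weighted_line.charw M1 h1 t - weighted_line.charw M2 h2 t) \<le> t * H t"
    and int_H: "integrable lborel (\<lambda>t. indicator {0..T} t * H t)"
  shows "\<bar>\<integral>w. fejer T w * (weighted_line.cdfw M1 h1 (b + w) - weighted_line.cdfw M2 h2 (b + w)) \<partial>lborel\<bar>
    \<le> 4 * (\<integral>t. indicator {0..T} t * H t \<partial>lborel)"
proof -
  interpret A: weighted_line M1 h1 by (rule A)
  interpret B: weighted_line M2 h2 by (rule B)
  define I where "I = (\<integral>t. indicator {0..T} t * H t \<partial>lborel)"
  let ?s = "\<lambda>n. (\<integral>w. fejer T w * A.cdfw (b + w) \<partial>lborel) - (\<integral>w. fejer T w * A.cdfw (b - real n + w) \<partial>lborel)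
    - ((\<integral>w. fejer T w * B.cdfw (b + w) \<partial>lborel) - (\<integral>w. fejer T w * B.cdfw (b - real n + w) \<partial>lborel))"
  have bound: "\<bar>?s n\<bar> \<le> 4 * I" for n
  proof -
    let ?a = "b - real n"
    have ab: "?a \<le> b" by simp
    define q where "q t = (\<integral>u. indicator {?a<..b} u *\<^sub>R cis (- (t * u)) \<partial>lborel)" for t
    have "?s n = (\<integral>w. fejer T w * (A.cdfw (b + w) - A.cdfw (?a + w)) \<partial>lborel) - (\<integral>w. fejer T w * (B.cdfw (b + w) - B.cdfw (?a + w)) \<partial>lborel)"
      unfolding right_diff_distrib
      by (subst (1 2) Bochner_Integration.integral_diff) (rule A.integrable_fejer_cdfw B.integrable_fejer_cdfw T refl)+
    also have "\<dots> = (\<integral>t. fejer_weight T t * Re (q t * A.charw t) \<partial>lborel) - (\<integral>t. fejer_weight T t * Re (q t * B.charw t) \<partial>lborel)"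
      unfolding q_def A.fejer_cdfw_fourier(1)[OF T ab] B.fejer_cdfw_fourier(1)[OF T ab] ..
    also have "\<dots> = (\<integral>t. fejer_weight T t * Re (q t * A.charw t) - fejer_weight T t * Re (q t * B.charw t) \<partial>lborel)"
      unfolding q_def by (intro Bochner_Integration.integral_diff[symmetric] A.fejer_cdfw_fourier(2)[OF T ab] B.fejer_cdfw_fourier(2)[OF T ab])
    finally have s: "?s n = (\<integral>t. fejer_weight T t * Re (q t * A.charw t) - fejer_weight T t * Re (q t * B.charw t) \<partial>lborel)" .
    have int: "integrable lborel (\<lambda>t. fejer_weight T t * Re (q t * A.charw t) - fejer_weight T t * Re (q t * B.charw t))"
      unfolding q_def by (intro Bochner_Integration.integrable_diff A.fejer_cdfw_fourier(2)[OF T ab] B.fejer_cdfw_fourier(2)[OF T ab])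
    have "norm (\<integral>t. fejer_weight T t * Re (q t * A.charw t) - fejer_weight T t * Re (q t * B.charw t) \<partial>lborel)
        \<le> (\<integral>t. norm (fejer_weight T t * Re (q t * A.charw t) - fejer_weight T t * Re (q t * B.charw t)) \<partial>lborel)"
      by (rule integral_norm_bound)
    also have "\<dots> \<le> (\<integral>t. 4 * (indicator {0..T} t * H t) \<partial>lborel)"
    proof (rule integral_mono_AE)
      show "integrable lborel (\<lambda>t. norm (fejer_weight T t * Re (q t * A.charw t) - fejer_weight T t * Re (q t * B.charw t)))"
        by (rule integrable_norm[OF int])
      show "AE t in lborel. norm (fejer_weight T t * Re (q t * A.charw t) - fejer_weight T t * Re (q t * B.charw t)) \<le> 4 * (indicator {0..T} t * H t)"
        using AE_lborel_singleton[of "0::real"]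
      proof eventually_elim
        case (elim t)
        show ?case
        proof (cases "t \<in> {0..T}")
          case True
          then have t: "0 < t" "t \<le> T" using elim by auto
          have "\<bar>Re (q t * A.charw t) - Re (q t * B.charw t)\<bar> = \<bar>Re (q t * (A.charw t - B.charw t))\<bar>"
            by (simp add: algebra_simps)
          also have "\<dots> \<le> cmod (q t) * cmod (A.charw t - B.charw t)"
            by (metis abs_Re_le_cmod norm_mult)
          also have "\<dots> \<le> (2 / t) * (t * H t)"
            unfolding q_def by (intro mult_mono indicator_cis_integral_bound[OF ab] H t) (use t in auto)
          finally have "\<bar>Re (q t * A.charw t) - Re (q t * B.charw t)\<bar> \<le> 2 * H t" using t by simp
          then have "fejer_weight T t * \<bar>Re (q t * A.charw t) - Re (q t * B.charw t)\<bar> \<le> 2 * (2 * H t)"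
            using fejer_weight_bounds[OF T, of t] True by (intro mult_mono) auto
          moreover have "norm (fejer_weight T t * Re (q t * A.charw t) - fejer_weight T t * Re (q t * B.charw t))
              = fejer_weight T t * \<bar>Re (q t * A.charw t) - Re (q t * B.charw t)\<bar>"
            using fejer_weight_bounds(1)[OF T, of t] by (simp only: right_diff_distrib[symmetric] real_norm_def abs_mult abs_of_nonneg)
          ultimately show ?thesis using True by simp
        qed (simp add: fejer_weight_def)
      qed
    qed (use int_H in simp)
    finally show ?thesis unfolding s I_def by simp
  qed
  have "?s \<longlonglongrightarrow> (\<integral>w. fejer T w * A.cdfw (b + w) \<partial>lborel) - 0 - ((\<integral>w. fejer T w * B.cdfw (b + w) \<partial>lborel) - 0)"
    by (intro tendsto_intros A.fejer_cdfw_tendsto B.fejer_cdfw_tendsto T)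
  then have "(\<lambda>n. \<bar>?s n\<bar>) \<longlonglongrightarrow> \<bar>(\<integral>w. fejer T w * A.cdfw (b + w) \<partial>lborel) - (\<integral>w. fejer T w * B.cdfw (b + w) \<partial>lborel)\<bar>"
    by (intro tendsto_rabs) simp
  then have "\<bar>(\<integral>w. fejer T w * A.cdfw (b + w) \<partial>lborel) - (\<integral>w. fejer T w * B.cdfw (b + w) \<partial>lborel)\<bar> \<le> 4 * I"
    by (rule LIMSEQ_le_const2) (use bound in blast)
  then show ?thesis
    unfolding right_diff_distrib I_def
    by (subst Bochner_Integration.integral_diff) (rule A.integrable_fejer_cdfw B.integrable_fejer_cdfw T | assumption)+
qed

text \<open>By scaling, the mass and its concentration on [-R/T, R/T] are those of the kernel with T
  = 1. Positivity of the mass is all that matters, so it is not evaluated.\<close>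

lemma fejer_mass:
  obtains R I where "R > 0" "I > 0"
    "\<And>T. T > 0 \<Longrightarrow> (\<integral>w. fejer T w \<partial>lborel) = I"
    "\<And>T. T > 0 \<Longrightarrow> 3/4 * I \<le> (\<integral>w. fejer T w * indicator {-(R/T)..R/T} w \<partial>lborel)"
proof -
  define I where "I = (\<integral>w. fejer 1 w \<partial>lborel)"
  have i1: "integrable lborel (fejer 1)" by (rule integrable_fejer) simp
  have "I > 0"
  proof -
    \<comment> \<open>On [1, 2] one has 1 - cos w \<ge> 1 - cos 1 and w^2 \<le> 4, so the kernel is
      at least \<open>c\<close> there.\<close>
    define c :: real where "c = (1 - cos 1) / 2"
    have "cos 1 < cos (0::real)" using pi_gt3 by (intro cos_monotone_0_pi) auto
    then have c: "c > 0" by (simp add: c_def)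
    have "c = (\<integral>w. c * indicator {1..2::real} w \<partial>lborel)" by simp
    also have "\<dots> \<le> I" unfolding I_def
    proof (rule integral_mono)
      fix w :: real
      show "c * indicator {1..2} w \<le> fejer 1 w"
      proof (cases "w \<in> {1..2}")
        case True
        then have "cos w \<le> cos 1" using pi_gt3 by (intro cos_monotone_0_pi_le) auto
        moreover have "w\<^sup>2 \<le> 4" using True power_mono[of w 2 2] by simp
        moreover have "cos 1 \<le> (1::real)" by simp
        ultimately have "(1 - cos 1) / 2 \<le> 2 * (1 - cos w) / w\<^sup>2"
          using True frac_le[of "2 * (1 - cos w)" "2 * (1 - cos 1)" "w\<^sup>2" 4] by (auto simp: field_simps)
        then show ?thesis using True by (simp add: fejer_def c_def)
      qed (simp add: fejer_nonneg)
    qed (use i1 in auto)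
    finally show ?thesis using c by simp
  qed
  have "(\<lambda>n. \<integral>w. fejer 1 w * indicator {-(real n)..real n} w \<partial>lborel) \<longlonglongrightarrow> I"
    unfolding I_def
  proof (rule integral_dominated_convergence[where w = "fejer 1"])
    show "AE w in lborel. (\<lambda>n. fejer 1 w * indicator {-(real n)..real n} w) \<longlonglongrightarrow> fejer 1 w"
    proof (rule AE_I2)
      fix w :: real
      obtain m :: nat where m: "\<bar>w\<bar> < real m" using reals_Archimedean2 by blast
      have "\<forall>\<^sub>F n in sequentially. fejer 1 w * indicator {-(real n)..real n} w = fejer 1 w"
        using eventually_ge_at_top[of m] by eventually_elim (use m in \<open>auto simp: indicator_def\<close>)
      then show "(\<lambda>n. fejer 1 w * indicator {-(real n)..real n} w) \<longlonglongrightarrow> fejer 1 w" by (rule tendsto_eventually)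
    qed
  qed (use i1 in \<open>auto simp: fejer_nonneg indicator_def\<close>)
  from order_tendstoD(1)[OF this, of "3/4 * I"] \<open>I > 0\<close>
  obtain n0 where n0: "\<And>n. n \<ge> n0 \<Longrightarrow> 3/4 * I < (\<integral>w. fejer 1 w * indicator {-(real n)..real n} w \<partial>lborel)"
    by (auto simp: eventually_sequentially)
  define R where "R = real (Suc n0)"
  show ?thesis
  proof (rule that[of R I])
    fix T :: real assume T: "T > 0"
    have "(\<integral>w. fejer T w \<partial>lborel) = (\<integral>w. T * fejer 1 (T * w) \<partial>lborel)" by (simp only: fejer_scale[OF T])
    also have "\<dots> = I" unfolding I_def using T lborel_integral_real_affine[of T "fejer 1" 0] by simp
    finally show "(\<integral>w. fejer T w \<partial>lborel) = I" .
    have "(\<integral>w. fejer T w * indicator {-(R/T)..R/T} w \<partial>lborel) = (\<integral>w. T * (fejer 1 (T * w) * indicator {-R..R} (T * w)) \<partial>lborel)"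
    proof (intro Bochner_Integration.integral_cong refl)
      fix w
      have "indicator {-(R/T)..R/T} w = (indicator {-R..R} (T * w) :: real)"
        using T by (auto simp: indicator_def field_simps)
      then show "fejer T w * indicator {-(R/T)..R/T} w = T * (fejer 1 (T * w) * indicator {-R..R} (T * w))"
        using fejer_scale[OF T, of w] by simp
    qed
    also have "\<dots> = (\<integral>w. fejer 1 w * indicator {-R..R} w \<partial>lborel)"
      using T lborel_integral_real_affine[of T "\<lambda>w. fejer 1 w * indicator {-R..R} w" 0] by simp
    finally show "3/4 * I \<le> (\<integral>w. fejer T w * indicator {-(R/T)..R/T} w \<partial>lborel)"
      using n0[of "Suc n0"] by (simp add: R_def)
  qed (use \<open>I > 0\<close> in \<open>auto simp: R_def\<close>)
qed

text \<open>If \<Delta> nearly attains its bound \<delta> at x, the one-sided slope condition keeps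
  it above v = \<Delta> x - 2 m h on [x, x + 2h]. A kernel centred at x + h gives weight at least
  3/4 to this interval and loses at most \<delta> elsewhere, so its average is large unless \<delta>
  is small.\<close>

lemma sup_bound_of_smoothed_one_sided:
  fixes \<Delta> :: "real \<Rightarrow> real"
  assumes T: "T > 0" and m: "m \<ge> 0" and h: "h > 0" and I: "I > 0" "(\<integral>w. fejer T w \<partial>lborel) = I"
      "3/4 * I \<le> (\<integral>w. fejer T w * indicator {-h..h} w \<partial>lborel)"
    and [measurable]: "\<Delta> \<in> borel_measurable borel"
    and bd: "\<And>x. \<bar>\<Delta> x\<bar> \<le> \<delta>"
    and lip: "\<And>x s. 0 \<le> s \<Longrightarrow> \<Delta> x - m * s \<le> \<Delta> (x + s)"
    and avg: "\<And>b. \<bar>\<integral>w. fejer T w * \<Delta> (b + w) \<partial>lborel\<bar> \<le> \<eta>"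
    and x: "3/4 * \<delta> \<le> \<Delta> x"
  shows "\<delta> \<le> 16/5 * (\<eta> / I) + 5 * m * h"
proof -
  have \<delta>0: "\<delta> \<ge> 0" using bd[of x] by linarith
  have \<eta>0: "\<eta> \<ge> 0" using avg[of 0] by linarith
  define v where "v = \<Delta> x - 2 * m * h"
  show ?thesis
  \<comment> \<open>Replacing the central mass J by its lower bound 3/4 I needs v + \<delta> \<ge>
    0. Otherwise \<delta> < 2 m h already.\<close>
  proof (cases "v + \<delta> \<ge> 0")
    case False
    then have "\<delta> < 2 * m * h" using x \<delta>0 by (simp add: v_def)
    moreover have "0 \<le> m * h" using m h by simp
    ultimately show ?thesis using divide_nonneg_pos[OF \<eta>0 I(1)] by linarith
  next
    case True
    define J where "J = (\<integral>w. fejer T w * indicator {-h..h} w \<partial>lborel)"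
    have iF: "integrable lborel (fejer T)" by (rule integrable_fejer[OF T])
    have iJ: "integrable lborel (\<lambda>w. fejer T w * indicator {-h..h} w)"
      by (rule Bochner_Integration.integrable_bound[OF iF]) (auto simp: indicator_def)
    have "(v + \<delta>) * J - \<delta> * I = (\<integral>w. (v + \<delta>) * (fejer T w * indicator {-h..h} w) - \<delta> * fejer T w \<partial>lborel)"
      using iF iJ by (simp add: J_def I(2))
    also have "\<dots> \<le> (\<integral>w. fejer T w * \<Delta> (x + h + w) \<partial>lborel)"
    proof (rule integral_mono)
      show "integrable lborel (\<lambda>w. (v + \<delta>) * (fejer T w * indicator {-h..h} w) - \<delta> * fejer T w)"
        using iF iJ by simp
      show "integrable lborel (\<lambda>w. fejer T w * \<Delta> (x + h + w))"
      proof (rule Bochner_Integration.integrable_bound)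
        show "integrable lborel (\<lambda>w. \<delta> * fejer T w)" using iF by simp
        show "AE w in lborel. norm (fejer T w * \<Delta> (x + h + w)) \<le> norm (\<delta> * fejer T w)"
          using bd \<delta>0 fejer_nonneg[OF T] by (intro AE_I2) (simp add: abs_mult mult.commute[of \<delta>] mult_left_mono)
      qed measurable
      fix w
      show "(v + \<delta>) * (fejer T w * indicator {-h..h} w) - \<delta> * fejer T w \<le> fejer T w * \<Delta> (x + h + w)"
      proof (cases "w \<in> {-h..h}")
        case True
        have "m * (h + w) \<le> m * (2 * h)" using True m by (intro mult_left_mono) auto
        then have "v \<le> \<Delta> (x + h + w)" using lip[of "h + w" x] True by (simp add: v_def add.assoc)
        from mult_left_mono[OF this fejer_nonneg[OF T, of w]] show ?thesis using True by (simp add: algebra_simps)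
      next
        case False
        have "- \<delta> \<le> \<Delta> (x + h + w)" using bd[of "x + h + w"] by linarith
        from mult_left_mono[OF this fejer_nonneg[OF T, of w]] show ?thesis using False by (simp add: algebra_simps)
      qed
    qed
    also have "\<dots> \<le> \<eta>" using avg[of "x + h"] by linarith
    finally have "(v + \<delta>) * J - \<delta> * I \<le> \<eta>" .
    moreover have "(v + \<delta>) * (3/4 * I) \<le> (v + \<delta>) * J" using True I(3) unfolding J_def by (intro mult_left_mono) auto
    moreover have "(v + \<delta>) * (3/4 * I) - \<delta> * I = (3/4 * v - 1/4 * \<delta>) * I" by (simp add: algebra_simps)
    ultimately have "(3/4 * v - 1/4 * \<delta>) * I \<le> \<eta>" by linarith
    then have "3/4 * v - 1/4 * \<delta> \<le> \<eta> / I" using I(1) by (simp add: field_simps)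
    moreover have "0 \<le> m * h" using m h by simp
    \<comment> \<open>With D \<ge> 3/4 \<delta> the left side is at least 5/16 \<delta> - 3/2 p, so
      \<delta> \<le> 16/5 e + 24/5 p, rounded up to 5 p.\<close>
    moreover have "\<delta> \<le> 16/5 * e + 5 * p"
      if "3/4 * (D - 2 * p) - 1/4 * \<delta> \<le> e" "0 \<le> p" "3/4 * \<delta> \<le> D" for e p D :: real
      using that by (simp add: field_simps)
    ultimately show ?thesis using x unfolding v_def mult.assoc by blast
  qed
qed

text \<open>A point with |\<Delta>| close to its supremum may have negative \<Delta>; passing to -
  \<Delta>(- y) preserves the slope condition, and evenness of the kernel preserves the
  averages.\<close>

lemma sup_bound_of_smoothed:
  obtains C where "C > 0"
    "\<And>(\<Delta> :: real \<Rightarrow> real) T m B \<eta> x. \<lbrakk>T > 0; m \<ge> 0; \<Delta> \<in> borel_measurable borel; \<And>x. \<bar>\<Delta> x\<bar> \<le> B;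
      \<And>x s. 0 \<le> s \<Longrightarrow> \<Delta> x - m * s \<le> \<Delta> (x + s);
      \<And>b. \<bar>\<integral>w. fejer T w * \<Delta> (b + w) \<partial>lborel\<bar> \<le> \<eta>\<rbrakk> \<Longrightarrow> \<bar>\<Delta> x\<bar> \<le> C * (\<eta> + m / T)"
proof -
  obtain R I where RI: "R > 0" "I > 0"
    "\<And>T. T > 0 \<Longrightarrow> (\<integral>w. fejer T w \<partial>lborel) = I"
    "\<And>T. T > 0 \<Longrightarrow> 3/4 * I \<le> (\<integral>w. fejer T w * indicator {-(R/T)..R/T} w \<partial>lborel)"
    by (rule fejer_mass) (rule that)
  define C where "C = 16 / (5 * I) + 5 * R"
  show ?thesis
  proof (rule that[of C])
    show "C > 0" using RI by (simp add: C_def add_pos_pos)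
    fix \<Delta> :: "real \<Rightarrow> real" and T m B \<eta> x
    assume T: "T > 0" and m: "m \<ge> 0" and meas[measurable]: "\<Delta> \<in> borel_measurable borel" and B: "\<And>x. \<bar>\<Delta> x\<bar> \<le> B"
      and lip: "\<And>x s. 0 \<le> s \<Longrightarrow> \<Delta> x - m * s \<le> \<Delta> (x + s)"
      and avg: "\<And>b. \<bar>\<integral>w. fejer T w * \<Delta> (b + w) \<partial>lborel\<bar> \<le> \<eta>"
    define \<delta> where "\<delta> = (SUP x. \<bar>\<Delta> x\<bar>)"
    have bdd: "bdd_above (range (\<lambda>x. \<bar>\<Delta> x\<bar>))" using B by (auto intro!: bdd_aboveI)
    have le: "\<bar>\<Delta> x\<bar> \<le> \<delta>" for x unfolding \<delta>_def by (rule cSUP_upper[OF _ bdd]) simp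
    have \<eta>0: "\<eta> \<ge> 0" using avg[of 0] by linarith
    have h: "R / T > 0" using RI(1) T by simp
    have "\<delta> \<le> 16/5 * (\<eta> / I) + 5 * m * (R / T)"
    proof (cases "\<delta> \<le> 0")
      case True
      have "0 \<le> 16/5 * (\<eta> / I) + 5 * m * (R / T)"
        using \<eta>0 m RI T by (intro add_nonneg_nonneg mult_nonneg_nonneg) auto
      with True show ?thesis by linarith
    next
      case False
      have "\<exists>x. 3/4 * \<delta> < \<bar>\<Delta> x\<bar>"
      proof (rule ccontr)
        assume "\<not> ?thesis"
        then have "\<bar>\<Delta> x\<bar> \<le> 3/4 * \<delta>" for x by (meson not_less)
        then have "(SUP x. \<bar>\<Delta> x\<bar>) \<le> 3/4 * \<delta>" by (intro cSUP_least) auto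
        then show False using False unfolding \<delta>_def[symmetric] by simp
      qed
      then obtain x where x: "3/4 * \<delta> < \<bar>\<Delta> x\<bar>" by blast
      show ?thesis
      proof (cases "\<Delta> x \<ge> 0")
        case True
        then show ?thesis
          using x by (intro sup_bound_of_smoothed_one_sided[OF T m h RI(2) RI(3)[OF T] RI(4)[OF T] meas le lip avg, of x]) auto
      next
        case neg: False
        have refl: "(\<integral>w. fejer T w * - \<Delta> (- (b + w)) \<partial>lborel) = - (\<integral>w. fejer T w * \<Delta> (- b + w) \<partial>lborel)" for b
        proof -
          have "(\<integral>w. fejer T w * \<Delta> (- b + w) \<partial>lborel) = (\<integral>w. fejer T w * \<Delta> (- (b + w)) \<partial>lborel)"
            using lborel_integral_real_affine[of "-1" "\<lambda>w. fejer T w * \<Delta> (- b + w)" 0] by (simp add: fejer_minus)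
          then show ?thesis by simp
        qed
        have l: "- \<Delta> (- x) - m * s \<le> - \<Delta> (- (x + s))" if "0 \<le> s" for x s
          using lip[OF that, of "- x - s"] by simp
        show ?thesis
        proof (rule sup_bound_of_smoothed_one_sided[OF T m h RI(2) RI(3)[OF T] RI(4)[OF T], of "\<lambda>y. - \<Delta> (- y)" \<delta> \<eta> "- x"])
          show "\<bar>\<integral>w. fejer T w * - \<Delta> (- (b + w)) \<partial>lborel\<bar> \<le> \<eta>" for b
            unfolding refl using avg[of "- b"] by simp
        qed (use le l x neg in auto)
      qed
    qed
    also have "\<dots> \<le> C * (\<eta> + m / T)"
    proof -
      have "C * (\<eta> + m / T) = 16/5 * (\<eta> / I) + 5 * m * (R / T) + (16 / (5 * I) * (m / T) + 5 * R * \<eta>)"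
        using T RI(2) by (simp add: C_def field_simps)
      moreover have "0 \<le> 16 / (5 * I) * (m / T) + 5 * R * \<eta>"
        using \<eta>0 m RI T by (intro add_nonneg_nonneg mult_nonneg_nonneg) auto
      ultimately show ?thesis by linarith
    qed
    finally show "\<bar>\<Delta> x\<bar> \<le> C * (\<eta> + m / T)" using le[of x] by linarith
  qed
qed


subsection \<open>Polynomials times the Gaussian density\<close>

lemma line_FTC:
  fixes F f :: "real \<Rightarrow> 'a::euclidean_space"
  assumes "\<And>x. (F has_vector_derivative f x) (at x)" "\<And>x. isCont f x" "integrable lborel f"
    and "(F \<longlongrightarrow> 0) at_bot" "(F \<longlongrightarrow> B) at_top"
  shows "(\<integral>x. f x \<partial>lborel) = B"
proof -
  have "(LBINT x=-\<infinity>..\<infinity>. f x) = B - 0"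
    by (rule interval_integral_FTC_integrable) (use assms in \<open>auto simp: ereal_tendsto_simps set_integrable_def\<close>)
  then show ?thesis by (simp add: interval_lebesgue_integral_def set_lebesgue_integral_def)
qed

lemma halfline_FTC:
  fixes F f :: "real \<Rightarrow> real"
  assumes "\<And>x. (F has_real_derivative f x) (at x)" "\<And>x. isCont f x" "integrable lborel f" "(F \<longlongrightarrow> 0) at_bot"
  shows "(\<integral>x. f x * indicator {..z} x \<partial>lborel) = F z"
proof -
  have i: "integrable lborel (\<lambda>x. indicator {..<z} x *\<^sub>R f x)"
    using assms(3) by (rule integrable_mult_indicator[rotated]) simp
  have "isCont F z" using assms(1) by (rule DERIV_isCont)
  then have "(F \<longlongrightarrow> F z) (at_left z)" by (simp add: isCont_def filterlim_at_split)
  then have "(LBINT x=-\<infinity>..ereal z. f x) = F z - 0"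
    by (intro interval_integral_FTC_integrable)
      (use assms i in \<open>auto simp: ereal_tendsto_simps set_integrable_def has_real_derivative_iff_has_vector_derivative\<close>)
  then have "(\<integral>x. indicator {..<z} x *\<^sub>R f x \<partial>lborel) = F z"
    by (simp add: interval_lebesgue_integral_def set_lebesgue_integral_def)
  moreover have "(\<integral>x. f x * indicator {..z} x \<partial>lborel) = (\<integral>x. indicator {..<z} x *\<^sub>R f x \<partial>lborel)"
  proof (rule integral_cong_AE)
    have [measurable]: "f \<in> borel_measurable borel" using assms(3) by (simp add: borel_measurable_integrable)
    show "(\<lambda>x. f x * indicator {..z} x) \<in> borel_measurable lborel" "(\<lambda>x. indicator {..<z} x *\<^sub>R f x) \<in> borel_measurable lborel"
      by measurable
    show "AE x in lborel. f x * indicator {..z} x = indicator {..<z} x *\<^sub>R f x"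
      using AE_lborel_singleton[of z] by eventually_elim (auto simp: indicator_def)
  qed
  ultimately show ?thesis by simp
qed

context
  fixes s :: real
  assumes s: "s > 0"
begin

definition gpoly :: "real poly \<Rightarrow> real \<Rightarrow> real" where "gpoly p y = poly p y * nfrak s y"

text \<open>Differentiating p n, with n the Gaussian density, acts on the polynomial factor alone;
  this is the resulting derivation, a form of the Hermite raising operator.\<close>

definition gderiv :: "real poly \<Rightarrow> real poly" where "gderiv p = pderiv p - smult (1/s) ([:0, 1:] * p)"

lemma nfrak_normal_density: "nfrak s y = normal_density 0 (sqrt s) y"
  using s by (simp add: nfrak_def normal_density_def)

lemma DERIV_gpoly: "(gpoly p has_real_derivative gpoly (gderiv p) y) (at y)"
proof -
  have "(nfrak s has_real_derivative (- y / s) * nfrak s y) (at y)"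
    unfolding nfrak_def using s by (auto intro!: derivative_eq_intros simp: field_simps)
  from DERIV_mult[OF poly_DERIV[of p y] this] show ?thesis
    unfolding gpoly_def gderiv_def by (rule DERIV_cong) (simp add: algebra_simps)
qed

lemma isCont_gpoly: "isCont (gpoly p) y"
  using DERIV_gpoly by (rule DERIV_isCont)

lemma integrable_gpoly: "integrable lborel (gpoly p)"
proof -
  have "integrable lborel (\<lambda>y. \<Sum>i\<le>degree p. coeff p i * (normal_density 0 (sqrt s) y * (y - 0) ^ i))"
    using s by (intro Bochner_Integration.integrable_sum integrable_mult_right integrable_normal_moment) auto
  moreover have "gpoly p = (\<lambda>y. \<Sum>i\<le>degree p. coeff p i * (normal_density 0 (sqrt s) y * (y - 0) ^ i))"
    by (rule ext) (simp add: gpoly_def poly_altdef nfrak_normal_density sum_distrib_left sum_distrib_right mult_ac)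
  ultimately show ?thesis by simp
qed

text \<open>For |y| \<ge> 1 each power |y|^i is at most y^(2i), a constant multiple of a power of
  y^2 / (2s). This reduces both ends of the line to x^i / exp x tending to 0.\<close>

lemma gpoly_tendsto_0:
  assumes F: "filterlim (\<lambda>y::real. y\<^sup>2 / (2 * s)) at_top F" and ge1: "\<forall>\<^sub>F y in F. 1 \<le> \<bar>y\<bar>"
  shows "(gpoly p \<longlongrightarrow> 0) F"
proof -
  have mono: "((\<lambda>y. y ^ i * nfrak s y) \<longlongrightarrow> 0) F" for i
  proof (rule Lim_null_comparison)
    let ?c = "1 / sqrt (2 * pi * s) * (2 * s) ^ i"
    show "\<forall>\<^sub>F y in F. norm (y ^ i * nfrak s y) \<le> ?c * ((y\<^sup>2 / (2 * s)) ^ i / exp (y\<^sup>2 / (2 * s)))"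
      using ge1
    proof eventually_elim
      case (elim y)
      have "\<bar>y\<bar> ^ i \<le> \<bar>y\<bar> ^ (2 * i)" using elim by (intro power_increasing) auto
      also have "\<dots> = ((2 * s) * (y\<^sup>2 / (2 * s))) ^ i" using s by (simp add: power_mult)
      also have "\<dots> = (2 * s) ^ i * (y\<^sup>2 / (2 * s)) ^ i" by (rule power_mult_distrib)
      finally have "\<bar>y\<bar> ^ i * nfrak s y \<le> ((2 * s) ^ i * (y\<^sup>2 / (2 * s)) ^ i) * nfrak s y"
        by (intro mult_right_mono) (auto simp: nfrak_normal_density)
      then show ?case
        by (simp add: abs_mult power_abs nfrak_normal_density) (simp add: nfrak_normal_density[symmetric] nfrak_def exp_minus field_simps)
    qed
    show "((\<lambda>y. ?c * ((y\<^sup>2 / (2 * s)) ^ i / exp (y\<^sup>2 / (2 * s)))) \<longlongrightarrow> 0) F"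
      by (intro tendsto_mult_right_zero filterlim_compose[OF tendsto_power_div_exp_0 F])
  qed
  have "((\<lambda>y. \<Sum>i\<le>degree p. coeff p i * (y ^ i * nfrak s y)) \<longlongrightarrow> (\<Sum>i\<le>degree p. coeff p i * 0)) F"
    by (intro tendsto_sum tendsto_mult tendsto_const mono)
  then show ?thesis by (simp add: gpoly_def[abs_def] poly_altdef sum_distrib_right mult.assoc)
qed

lemma gpoly_at_top: "(gpoly p \<longlongrightarrow> 0) at_top" and gpoly_at_bot: "(gpoly p \<longlongrightarrow> 0) at_bot"
proof -
  have "filterlim (\<lambda>y::real. y\<^sup>2 / (2 * s)) at_top at_top" "filterlim (\<lambda>y::real. y\<^sup>2 / (2 * s)) at_top at_bot"
    using s by real_asymp+
  moreover have "\<forall>\<^sub>F y in at_top. 1 \<le> \<bar>y::real\<bar>" "\<forall>\<^sub>F y in at_bot. 1 \<le> \<bar>y::real\<bar>"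
    by real_asymp+
  ultimately show "(gpoly p \<longlongrightarrow> 0) at_top" "(gpoly p \<longlongrightarrow> 0) at_bot" by (auto intro: gpoly_tendsto_0)
qed

lemma integral_gpoly_gderiv: "(\<integral>y. gpoly (gderiv p) y * indicator {..z} y \<partial>lborel) = gpoly p z"
  by (intro halfline_FTC DERIV_gpoly isCont_gpoly integrable_gpoly gpoly_at_bot)

lemma bounded_gpoly: obtains B where "B > 0" "\<And>y. \<bar>gpoly p y\<bar> \<le> B"
proof
  let ?B = "\<integral>y. \<bar>gpoly (gderiv p) y\<bar> \<partial>lborel"
  show "?B + 1 > 0" by (intro add_nonneg_pos) auto
  show "\<bar>gpoly p z\<bar> \<le> ?B + 1" for z
  proof -
    have i: "integrable lborel (\<lambda>y. gpoly (gderiv p) y * indicator {..z} y)"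
      using integrable_mult_indicator[OF _ integrable_gpoly[of "gderiv p"], of "{..z}"] by (simp add: mult.commute)
    have "\<bar>gpoly p z\<bar> \<le> (\<integral>y. \<bar>gpoly (gderiv p) y * indicator {..z} y\<bar> \<partial>lborel)"
      using integral_abs_bound[of lborel "\<lambda>y. gpoly (gderiv p) y * indicator {..z} y"]
      by (simp only: integral_gpoly_gderiv)
    also have "\<dots> \<le> ?B"
      using i integrable_gpoly[of "gderiv p"] by (intro integral_mono) (auto simp: indicator_def)
    finally show ?thesis by simp
  qed
qed

definition gfourier :: "real poly \<Rightarrow> real \<Rightarrow> complex" where
  "gfourier p t = (CLBINT y. of_real (gpoly p y) * cis (t * y))"

lemma integrable_gpoly_cis: "integrable lborel (\<lambda>y. of_real (gpoly p y) * cis (t * y))"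
  by (rule Bochner_Integration.integrable_bound[OF integrable_gpoly[of p]])
    (use integrable_gpoly[of p] in \<open>auto simp: norm_mult cis_conv_exp dest: borel_measurable_integrable\<close>)

text \<open>Integration by parts: the integrand is the derivative of a product that vanishes at both
  ends.\<close>

lemma gfourier_gderiv: "gfourier (gderiv p) t = - \<i> * of_real t * gfourier p t"
proof -
  let ?F = "\<lambda>y. complex_of_real (gpoly p y) * cis (t * y)"
  let ?f = "\<lambda>y. of_real (gpoly (gderiv p) y) * cis (t * y) + (\<i> * of_real t) * (of_real (gpoly p y) * cis (t * y))"
  have "(\<integral>y. ?f y \<partial>lborel) = 0"
  proof (rule line_FTC)
    fix y
    have 1: "((\<lambda>y. complex_of_real (gpoly p y)) has_vector_derivative of_real (gpoly (gderiv p) y)) (at y)"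
      by (rule bounded_linear.has_vector_derivative[OF bounded_linear_of_real
          DERIV_gpoly[unfolded has_real_derivative_iff_has_vector_derivative]])
    have 2: "((\<lambda>y. cis (t * y)) has_vector_derivative (\<i> * of_real t) * cis (t * y)) (at y)"
      by (rule has_vector_derivative_cis_mult)
    show "(?F has_vector_derivative ?f y) (at y)"
      using has_vector_derivative_mult[OF 1 2] by (rule has_vector_derivative_eq_rhs) (simp add: algebra_simps)
    show "isCont ?f y"
      unfolding cis_conv_exp by (intro continuous_intros isCont_gpoly)
  next
    show "integrable lborel ?f"
      by (intro Bochner_Integration.integrable_add integrable_mult_right integrable_gpoly_cis)
    have "(?F \<longlongrightarrow> 0) F" if "(gpoly p \<longlongrightarrow> 0) F" for F
      using that by (rule tendsto_0_le[where K = 1]) (auto simp: norm_mult)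
    then show "(?F \<longlongrightarrow> 0) at_bot" "(?F \<longlongrightarrow> 0) at_top" using gpoly_at_bot gpoly_at_top by auto
  qed
  moreover have "(\<integral>y. ?f y \<partial>lborel) = gfourier (gderiv p) t + (\<i> * of_real t) * gfourier p t"
    unfolding gfourier_def by (subst Bochner_Integration.integral_add) (auto intro!: integrable_gpoly_cis)
  ultimately have "gfourier (gderiv p) t + (\<i> * of_real t) * gfourier p t = 0" by simp
  then show ?thesis by (simp add: add_eq_0_iff2)
qed

lemma gpoly_add: "gpoly (p + q) y = gpoly p y + gpoly q y"
  and gpoly_smult: "gpoly (smult c p) y = c * gpoly p y"
  by (simp_all add: gpoly_def algebra_simps)

lemma gfourier_add: "gfourier (p + q) t = gfourier p t + gfourier q t"
proof -
  have "gfourier (p + q) t = (CLBINT y. of_real (gpoly p y) * cis (t * y) + of_real (gpoly q y) * cis (t * y))"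
    unfolding gfourier_def by (simp add: gpoly_add algebra_simps)
  then show ?thesis by (simp add: gfourier_def integrable_gpoly_cis)
qed

lemma gfourier_smult: "gfourier (smult c p) t = of_real c * gfourier p t"
  by (simp add: gfourier_def gpoly_smult mult.assoc)

lemma gfourier_1: "gfourier 1 t = exp (- (of_real (s * t\<^sup>2 / 2)))"
proof -
  have "(CLINT x|std_normal_distribution. iexp (sqrt s * t * x)) = complex_of_real (exp (- ((sqrt s * t)\<^sup>2) / 2))"
    using char_std_normal_distribution unfolding char_def by metis
  moreover have "(CLINT x|std_normal_distribution. iexp (sqrt s * t * x)) = (CLBINT x. std_normal_density x *\<^sub>R iexp (sqrt s * t * x))"
    by (subst integral_density) auto
  moreover have "(CLBINT y. of_real (gpoly 1 y) * cis (t * y)) = (CLBINT x. std_normal_density x *\<^sub>R iexp (sqrt s * t * x))"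
  proof -
    have "(CLBINT y. of_real (gpoly 1 y) * cis (t * y)) = \<bar>sqrt s\<bar> *\<^sub>R (CLBINT x. of_real (gpoly 1 (0 + sqrt s * x)) * cis (t * (0 + sqrt s * x)))"
      using s by (intro lborel_integral_real_affine) simp
    also have "\<dots> = (CLBINT x. sqrt s *\<^sub>R (of_real (gpoly 1 (0 + sqrt s * x)) * cis (t * (0 + sqrt s * x))))"
      using s by simp
    also have "\<dots> = (CLBINT x. std_normal_density x *\<^sub>R iexp (sqrt s * t * x))"
    proof (intro Bochner_Integration.integral_cong refl)
      fix x
      have "sqrt s * gpoly 1 (sqrt s * x) = std_normal_density x"
        using s by (simp add: gpoly_def nfrak_def std_normal_density_def power_mult_distrib real_sqrt_mult field_simps)
      then show "sqrt s *\<^sub>R (complex_of_real (gpoly 1 (0 + sqrt s * x)) * cis (t * (0 + sqrt s * x))) = std_normal_density x *\<^sub>R iexp (sqrt s * t * x)"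
        by (simp add: scaleR_conv_of_real cis_conv_exp mult_ac flip: of_real_mult)
    qed
    finally show ?thesis .
  qed
  ultimately have "gfourier 1 t = complex_of_real (exp (- ((sqrt s * t)\<^sup>2) / 2))" by (simp add: gfourier_def)
  also have "\<dots> = exp (- (of_real (s * t\<^sup>2 / 2)))"
    using s by (simp add: power_mult_distrib flip: exp_of_real)
  finally show ?thesis .
qed

text \<open>No moment integral is evaluated: differentiating the Gaussian twice expresses the
  transforms of y and y^2 through that of 1. Even quadratics are the shape that the correction
  polynomial will have.\<close>

lemma gfourier_even_quadratic:
  "gfourier [:a, 0, b:] t = (of_real (a + b * s - b * s\<^sup>2 * t\<^sup>2)) * exp (- (of_real (s * t\<^sup>2 / 2)))"
proof -
  let ?X = "[:0, 1:] :: real poly"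
  have d1: "gderiv 1 = smult (- 1 / s) ?X" by (simp add: gderiv_def)
  have d2: "gderiv ?X = 1 + smult (- 1 / s) [:0, 0, 1:]" by (simp add: gderiv_def pderiv_pCons one_pCons)
  have f1: "of_real (- 1 / s) * gfourier ?X t = - \<i> * of_real t * gfourier 1 t"
    using gfourier_gderiv[of 1 t] unfolding d1 gfourier_smult .
  have f2: "gfourier 1 t + of_real (- 1 / s) * gfourier [:0, 0, 1:] t = - \<i> * of_real t * gfourier ?X t"
    using gfourier_gderiv[of ?X t] unfolding d2 gfourier_add gfourier_smult .
  have s0: "complex_of_real s \<noteq> 0" using s by simp
  have X: "gfourier ?X t = \<i> * of_real (s * t) * gfourier 1 t"
    using f1 s0 by (simp add: field_simps)
  have XX: "gfourier [:0, 0, 1:] t = of_real (s - s\<^sup>2 * t\<^sup>2) * gfourier 1 t"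
    using f2 s0 unfolding X by (simp add: field_simps power2_eq_square)
  have "[:a, 0, b:] = smult a 1 + smult b [:0, 0, 1:]" by (simp add: one_pCons)
  then show ?thesis unfolding gfourier_1[symmetric]
    by (simp only: gfourier_add gfourier_smult XX) (simp add: algebra_simps)
qed

end


subsection \<open>Logarithm of the leading eigenvalue\<close>

text \<open>The tail of the logarithm series from the fourth power on is dominated by |w|^4 times a
  geometric series of ratio 1/2.\<close>

lemma Ln_cubic_approx:
  fixes w :: complex
  assumes "cmod w \<le> 1/2"
  shows "cmod (Ln (1 + w) - (w - w\<^sup>2 / 2 + w ^ 3 / 3)) \<le> 2 * cmod w ^ 4"
proof -
  let ?f = "\<lambda>n. - ((- w) ^ n) / of_nat n"
  have "?f sums Ln (1 + w)" using assms by (intro Ln_series') auto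
  then have s: "(\<lambda>n. ?f (n + 4)) sums (Ln (1 + w) - (\<Sum>i<4. ?f i))"
    by (rule sums_split_initial_segment)
  have "(\<Sum>i<4. ?f i) = w - w\<^sup>2 / 2 + w ^ 3 / 3"
    by (simp add: eval_nat_numeral)
  then have "Ln (1 + w) - (w - w\<^sup>2 / 2 + w ^ 3 / 3) = (\<Sum>n. ?f (n + 4))"
    using sums_unique[OF s] by simp
  also have "cmod \<dots> \<le> (\<Sum>n. cmod w ^ 4 * (1/2) ^ n)"
  proof (rule norm_suminf_le)
    fix n
    have "cmod (?f (n + 4)) = cmod w ^ (n + 4) / real (n + 4)" by (simp only: norm_divide norm_minus_cancel norm_power norm_of_nat)
    also have "\<dots> \<le> cmod w ^ (n + 4) / 1" by (intro divide_left_mono) auto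
    also have "\<dots> = cmod w ^ 4 * cmod w ^ n" by (simp add: power_add mult.commute)
    also have "\<dots> \<le> cmod w ^ 4 * (1/2) ^ n" using assms by (intro mult_left_mono power_mono) auto
    finally show "cmod (?f (n + 4)) \<le> cmod w ^ 4 * (1/2) ^ n" .
  qed (intro summable_mult summable_geometric, simp)
  also have "\<dots> = 2 * cmod w ^ 4" by (subst suminf_mult) (auto simp: suminf_geometric summable_geometric)
  finally show ?thesis .
qed

lemma jet_power: "jet k f \<Longrightarrow> jet k (\<lambda>t. f t ^ n :: complex)"
  by (induction n) (auto intro: jet_bilinear[OF bounded_bilinear_mult])

text \<open>F - 1 is O(t), so the cubic Taylor polynomial of the logarithm differs from it by
  O(t^4), while the polynomial itself stays within the algebra of expansions.\<close>

lemma jet_Ln: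
  fixes F :: "real \<Rightarrow> complex"
  assumes F: "jet 4 F" "F 0 = 1"
  shows "jet 4 (\<lambda>t. Ln (F t))" "\<forall>\<^sub>F t in nhds 0. cmod (F t - 1) \<le> 1/2"
proof -
  define w where "w t = F t - 1" for t
  have jw: "jet 4 w" unfolding w_def by (intro jet_diff F jet_const)
  have j4: "jet (Suc 3) F" using F(1) by (simp add: eval_nat_numeral)
  obtain B where B: "B > 0" "\<forall>\<^sub>F t in nhds 0. norm (F t - F 0) \<le> B * \<bar>t\<bar>"
    by (rule jet_Suc_lipschitz[OF j4]) (rule that)
  show small: "\<forall>\<^sub>F t in nhds 0. cmod (F t - 1) \<le> 1/2"
    using jet_tendsto_0[OF j4, of "1/2"] F(2) by simp
  let ?p = "\<lambda>w. w - (1/2) * w\<^sup>2 + (1/3) * w ^ 3 :: complex"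
  have 1: "jet 4 (\<lambda>t. ?p (w t))"
    by (intro jet_add jet_diff jw jet_bilinear[OF bounded_bilinear_mult] jet_power jet_const)
  have "\<forall>\<^sub>F t in nhds 0. norm ((Ln (F t) - ?p (w t)) - (\<Sum>j<4. t ^ j *\<^sub>R 0)) \<le> (2 * B ^ 4) * \<bar>t\<bar> ^ 4"
    using small B(2)
  proof eventually_elim
    case (elim t)
    have "norm (Ln (1 + w t) - ?p (w t)) \<le> 2 * cmod (w t) ^ 4"
      using Ln_cubic_approx[of "w t"] elim(1) by (simp add: w_def)
    also have "\<dots> \<le> 2 * (B * \<bar>t\<bar>) ^ 4"
      using elim(2) F(2) by (intro mult_left_mono power_mono) (auto simp: w_def)
    finally show ?case by (simp add: w_def power_mult_distrib)
  qed
  then have 2: "jet 4 (\<lambda>t. Ln (F t) - ?p (w t))"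
    unfolding jet_iff_taylor by (rule_tac exI[of _ "\<lambda>_. 0"], rule_tac exI[of _ "2 * B ^ 4"])
  show "jet 4 (\<lambda>t. Ln (F t))" using jet_add[OF 2 1] by simp
qed

lemma jet_cis: "jet k (\<lambda>t. cis (a * t))"
proof -
  have "jet k ((\<lambda>j t. (\<i> * of_real a) ^ j * cis (a * t)) 0)"
  proof (rule jet_of_derivatives[where \<delta> = 1])
    fix j and t :: real
    show "((\<lambda>t. (\<i> * of_real a) ^ j * cis (a * t)) has_vector_derivative (\<i> * of_real a) ^ Suc j * cis (a * t)) (at t within {- 1..1})"
      using has_vector_derivative_mult_right[OF has_vector_derivative_cis_mult[of a t], of "(\<i> * of_real a) ^ j"]
      by (simp add: mult_ac)
  next
    show "continuous_on {- 1..1} (\<lambda>t. (\<i> * of_real a) ^ k * cis (a * t))"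
      unfolding cis_conv_exp by (intro continuous_intros)
  qed simp
  then show ?thesis by simp
qed

text \<open>Taking the root of order k + 1 of \<theta> writes N^(k+1) \<theta>^N as a power of N
  r^N. The extra factor N avoids a root of order 0.\<close>

lemma power_geometric_bound:
  assumes "0 < \<theta>" "\<theta> < 1"
  obtains C where "C > 0" "\<And>N. N \<ge> 1 \<Longrightarrow> real N ^ k * \<theta> ^ N \<le> C"
proof -
  define r where "r = root (Suc k) \<theta>"
  have r: "0 < r" "r < 1" "r ^ Suc k = \<theta>" using assms by (auto simp: r_def simp del: power_Suc)
  have "(\<lambda>N. (real N * r ^ N) ^ Suc k) \<longlonglongrightarrow> 0 ^ Suc k"
    using r by (intro tendsto_power powser_times_n_limit_0) auto
  moreover have "(real N * r ^ N) ^ Suc k = real N ^ Suc k * \<theta> ^ N" for N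
    unfolding power_mult_distrib r(3)[symmetric] by (simp only: power_mult[symmetric] mult.commute)
  ultimately have "(\<lambda>N. real N ^ Suc k * \<theta> ^ N) \<longlonglongrightarrow> 0 ^ Suc k" by (simp only:)
  then have "(\<lambda>N. real N ^ Suc k * \<theta> ^ N) \<longlonglongrightarrow> 0" by (simp only: power_0_Suc)
  then have "Bseq (\<lambda>N. real N ^ Suc k * \<theta> ^ N)" by (intro convergent_imp_Bseq convergentI)
  then obtain C where "C > 0" and C: "\<And>N. norm (real N ^ Suc k * \<theta> ^ N) \<le> C" by (auto elim: BseqE)
  show ?thesis
  proof (rule that[OF \<open>C > 0\<close>])
    fix N :: nat assume "N \<ge> 1"
    then have "real N ^ k * \<theta> ^ N \<le> real N ^ Suc k * \<theta> ^ N"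
      using assms by (intro mult_right_mono power_increasing) auto
    also have "\<dots> \<le> C" using C[of N] by (simp add: abs_le_iff)
    finally show "real N ^ k * \<theta> ^ N \<le> C" .
  qed
qed

lemma norm_exp_minus_1_le: "cmod (exp z - 1) \<le> cmod z * exp (cmod z)"
proof -
  have "norm (exp z - exp 0) \<le> exp (cmod z) * norm (z - 0)"
  proof (rule field_differentiable_bound[of "cball 0 (cmod z)" exp exp])
    fix w :: complex assume w: "w \<in> cball 0 (cmod z)"
    show "(exp has_field_derivative exp w) (at w within cball 0 (cmod z))"
      by (rule DERIV_subset[OF DERIV_exp]) simp
    have "Re w \<le> cmod z" using complex_Re_le_cmod[of w] w by simp
    then show "cmod (exp w) \<le> exp (cmod z)" by simp
  qed auto
  then show ?thesis by (simp add: mult.commute)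
qed

text \<open>For t so small that |t c| < 1, the multiple of 2 pi in the imaginary part can only be
  zero.\<close>

lemma exp_multiples_eq_1_imp_zero:
  fixes c :: complex
  assumes "\<And>t. 0 < t \<Longrightarrow> exp (of_real t * c) = 1"
  shows "c = 0"
proof -
  define t where "t = 1 / (cmod c + 1)"
  have t: "t > 0" unfolding t_def by (intro divide_pos_pos add_nonneg_pos) auto
  have lt: "cmod (of_real t * c) < 1"
  proof -
    have "cmod (of_real t * c) = t * cmod c" using t by (simp add: norm_mult)
    also have "\<dots> = cmod c / (cmod c + 1)" by (simp add: t_def)
    also have "\<dots> < 1" by (subst pos_divide_less_eq) (auto intro: add_nonneg_pos)
    finally show ?thesis .
  qed
  from assms[OF t] obtain n :: int where n: "Re (of_real t * c) = 0" "Im (of_real t * c) = of_int (2 * n) * pi"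
    unfolding exp_eq_1 by blast
  have "\<bar>of_int (2 * n) * pi\<bar> < 1" using abs_Im_le_cmod[of "of_real t * c"] lt n(2) by linarith
  then have "\<bar>of_int (2 * n) :: real\<bar> * pi < 1" by (simp add: abs_mult)
  moreover have "2 * 3 \<le> \<bar>of_int (2 * n) :: real\<bar> * pi" if "n \<noteq> 0"
  proof (rule mult_mono)
    have "1 \<le> \<bar>n\<bar>" using that by simp
    then have "(1::real) \<le> of_int \<bar>n\<bar>" by (simp only: of_int_1_le_iff)
    then show "2 \<le> \<bar>of_int (2 * n) :: real\<bar>" by (simp add: abs_mult)
  qed (use pi_gt3 in auto)
  ultimately have "n = 0" by fastforce
  with n have "of_real t * c = 0" by (simp add: complex_eq_iff)
  with t show ?thesis by simp
qed

lemma coeff_eq_zero_of_higher_order: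
  fixes c :: complex
  assumes "d > 0" "\<And>t. 0 < t \<Longrightarrow> t \<le> d \<Longrightarrow> cmod (of_real t ^ k * c) \<le> B * t ^ Suc k"
  shows "c = 0"
proof (rule ccontr)
  assume c: "c \<noteq> 0"
  define b where "b = \<bar>B\<bar> + 1"
  have b: "b > 0" "B \<le> b" by (auto simp: b_def add_nonneg_pos)
  define t where "t = min d (cmod c / (2 * b))"
  have p: "cmod c / (2 * b) > 0" using c b by (intro divide_pos_pos) auto
  have t: "t > 0" "t \<le> d" using assms(1) p by (auto simp: t_def)
  have "t ^ k * cmod c \<le> t ^ k * (B * t)"
    using assms(2)[OF t] t by (simp add: norm_mult norm_power mult_ac)
  then have "cmod c \<le> B * t" using t by simp
  also have "\<dots> \<le> b * t" using t b by (intro mult_right_mono) auto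
  also have "\<dots> \<le> b * (cmod c / (2 * b))" by (intro mult_left_mono) (use b in \<open>auto simp: t_def\<close>)
  also have "\<dots> = cmod c / 2" using b by simp
  finally show False using c by simp
qed

text \<open>Of the four factors 1 + t^2, three absorb the polynomial factors of the error terms and
  one is left over, giving an integrable 1 / (1 + t^2).\<close>

lemma quartic_gaussian_bound:
  fixes c :: real
  assumes "c > 0"
  obtains C where "C > 0" "\<And>t. (1 + t\<^sup>2) ^ 4 * exp (- c * t\<^sup>2) \<le> C"
proof -
  let ?f = "\<lambda>x::real. (1 + x) ^ 4 * exp (- c * x)"
  have "(?f \<longlongrightarrow> 0) at_top" using assms by real_asymp
  then have "\<forall>\<^sub>F x in at_top. ?f x < 1" by (rule order_tendstoD) simp
  then obtain x0 where x0: "\<And>x. x \<ge> x0 \<Longrightarrow> ?f x < 1" by (auto simp: eventually_at_top_linorder)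
  have "compact (?f ` {0..max 0 x0})" by (intro compact_continuous_image continuous_intros) auto
  from compact_imp_bounded[OF this] obtain B where B: "\<forall>y\<in>?f ` {0..max 0 x0}. norm y \<le> B"
    unfolding bounded_iff by blast
  have "?f x \<le> \<bar>B\<bar> + 1" if "x \<ge> 0" for x
  proof (cases "x \<ge> x0")
    case False
    then have "norm (?f x) \<le> B" using that by (intro B[rule_format] imageI) auto
    then show ?thesis by auto
  qed (use x0[of x] in auto)
  then show ?thesis by (intro that[of "\<bar>B\<bar> + 1"]) auto
qed


subsection \<open>The characteristic function near the origin\<close>

lemma abs_le_1_plus_sq: "\<bar>t\<bar> \<le> 1 + t\<^sup>2" for t :: real
proof -
  have "0 \<le> (\<bar>t\<bar> - 1)\<^sup>2" by simp
  then have "2 * \<bar>t\<bar> \<le> 1 + t\<^sup>2" by (simp add: power2_diff)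
  then show ?thesis by linarith
qed

lemma inverse_1_plus_sq_bound:
  fixes t :: real
  assumes "(1 + t\<^sup>2) ^ 4 * e \<le> C" "e \<ge> 0"
  shows "(\<bar>t\<bar> + \<bar>t\<bar> ^ 3 + \<bar>t\<bar> ^ 5) * e \<le> 3 * C / (1 + t\<^sup>2)"
proof -
  have p: "1 + t\<^sup>2 \<ge> 1" by simp
  have a: "\<bar>t\<bar> \<le> 1 + t\<^sup>2" by (rule abs_le_1_plus_sq)
  have "\<bar>t\<bar> ^ 3 = \<bar>t\<bar> * t\<^sup>2" by (simp add: power3_eq_cube power2_eq_square)
  also have "\<dots> \<le> (1 + t\<^sup>2) * (1 + t\<^sup>2)" using a by (intro mult_mono) auto
  finally have b: "\<bar>t\<bar> ^ 3 \<le> (1 + t\<^sup>2) ^ 2" by (simp add: power2_eq_square)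
  have "\<bar>t\<bar> ^ 5 = \<bar>t\<bar> ^ 3 * t\<^sup>2" by (simp add: eval_nat_numeral)
  also have "\<dots> \<le> (1 + t\<^sup>2) ^ 2 * (1 + t\<^sup>2)" using b by (intro mult_mono) auto
  finally have c: "\<bar>t\<bar> ^ 5 \<le> (1 + t\<^sup>2) ^ 3" by (simp add: eval_nat_numeral)
  have "\<bar>t\<bar> + \<bar>t\<bar> ^ 3 + \<bar>t\<bar> ^ 5 \<le> 3 * (1 + t\<^sup>2) ^ 3"
    using a b c power_increasing[OF _ p, of 1 3] power_increasing[OF _ p, of 2 3] by simp
  then have "(\<bar>t\<bar> + \<bar>t\<bar> ^ 3 + \<bar>t\<bar> ^ 5) * e \<le> 3 * (1 + t\<^sup>2) ^ 3 * e" using assms(2) by (rule mult_right_mono)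
  also have "\<dots> = 3 * ((1 + t\<^sup>2) ^ 4 * e) / (1 + t\<^sup>2)"
    using p by (simp add: eval_nat_numeral)
  also have "\<dots> \<le> 3 * C / (1 + t\<^sup>2)" using assms(1) p by (intro divide_right_mono mult_left_mono) auto
  finally show ?thesis .
qed

text \<open>After centring, \<phi> N (t / sqrt N) is exp (N \<psi>) mu up to a geometric error. In N
  \<psi> (t / sqrt N) the quadratic term is the Gaussian exponent, the cubic term and the linear
  term of mu are of order N^(-1/2), and the rest is of order 1/N. The bound keeps a factor |t|
  throughout.\<close>

lemma edgeworth_char_expansion:
  fixes \<phi> :: "nat \<Rightarrow> real \<Rightarrow> complex" and lam mu :: "real \<Rightarrow> complex" and \<sigma>2 A d C \<theta> :: real
  assumes conj: "\<And>N t. N \<ge> 1 \<Longrightarrow> \<phi> N (- t) = cnj (\<phi> N t)" and \<phi>0: "\<And>N. N \<ge> 1 \<Longrightarrow> \<phi> N 0 = 1"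
    and d: "d > 0" and C: "C > 0" and \<theta>: "0 < \<theta>" "\<theta> < 1"
    and jlam: "jet 4 lam" and jmu: "jet 4 mu" and lam0: "lam 0 = 1"
    and eps1: "\<And>t N. \<bar>t\<bar> \<le> d \<Longrightarrow> N \<ge> 1 \<Longrightarrow> cmod (\<phi> N t - lam t ^ N * mu t) \<le> C * \<theta> ^ N"
    and eps2: "\<And>t N. \<bar>t\<bar> \<le> d \<Longrightarrow> N \<ge> 1 \<Longrightarrow>
      cmod ((\<phi> N t - lam t ^ N * mu t) - (\<phi> N 0 - lam 0 ^ N * mu 0)) \<le> C * N * \<theta> ^ N * \<bar>t\<bar>"
    and \<sigma>2: "\<sigma>2 > 0"
    and clt: "\<And>t. (\<lambda>N. \<phi> N (t / sqrt (real N)) * cis (- (t * sqrt (real N) * A))) \<longlonglongrightarrow> exp (- of_real (\<sigma>2 * t\<^sup>2 / 2))"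
  obtains \<kappa> \<mu>1 d' C' where "d' > 0" "C' > 0"
    "\<And>N t. N \<ge> 1 \<Longrightarrow> \<bar>t\<bar> \<le> d' * sqrt (real N) \<Longrightarrow>
      cmod (\<phi> N (t / sqrt (real N)) * cis (- (t * sqrt (real N) * A))
        - exp (- of_real (\<sigma>2 * t\<^sup>2 / 2)) * (1 + \<i> * of_real ((\<mu>1 * t + \<kappa> * t ^ 3) / sqrt (real N))))
      \<le> C' * \<bar>t\<bar> * (1 / (real N * (1 + t\<^sup>2)) + 1 / (real N)\<^sup>2)"
proof -
  define eps where "eps N t = \<phi> N t - lam t ^ N * mu t" for N t
  have \<theta>N: "(\<lambda>N. C * \<theta> ^ N) \<longlonglongrightarrow> 0"
    using \<theta> by (intro tendsto_mult_right_zero LIMSEQ_realpow_zero) auto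
  have eps_lim: "(\<lambda>N. eps N (u N)) \<longlonglongrightarrow> 0" if "\<forall>\<^sub>F N in sequentially. \<bar>u N\<bar> \<le> d" for u
  proof (rule Lim_null_comparison[OF _ \<theta>N])
    show "\<forall>\<^sub>F N in sequentially. norm (eps N (u N)) \<le> C * \<theta> ^ N"
      using that eventually_ge_at_top[of 1] by eventually_elim (simp add: eps_def eps1)
  qed
  have mu0: "mu 0 = 1"
  proof -
    have "(\<lambda>N. eps N 0) \<longlonglongrightarrow> 0" using d by (intro eps_lim) auto
    moreover have "\<forall>\<^sub>F N in sequentially. eps N 0 = 1 - mu 0"
      using eventually_ge_at_top[of 1] by eventually_elim (simp add: eps_def \<phi>0 lam0)
    ultimately have "(\<lambda>N::nat. 1 - mu 0) \<longlonglongrightarrow> 0" by (rule Lim_transform_eventually)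
    then show ?thesis by (simp add: LIMSEQ_const_iff)
  qed
  \<comment> \<open>\<open>\<phi> N 0\<close> = lam 0 = mu 0 = 1 makes the error vanish at t = 0, so
    the comparison with t = 0 becomes a bound with a factor |t|.\<close>
  have eps_le: "cmod (eps N t) \<le> C * N * \<theta> ^ N * \<bar>t\<bar>" if "\<bar>t\<bar> \<le> d" "N \<ge> 1" for N t
    using eps2[OF that] that by (simp add: eps_def \<phi>0 lam0 mu0)
  have j4: "jet (Suc 3) lam" "jet (Suc 3) mu" using jlam jmu by (simp_all add: eval_nat_numeral)
  \<comment> \<open>Any number strictly between \<theta> and 1 would do: |lam t| \<ge> \<rho> >
    \<theta> near 0, so the error is negligible against lam t ^ N.\<close>
  define \<rho> where "\<rho> = (1 + \<theta>) / 2"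
  have \<rho>: "\<theta> < \<rho>" "\<rho> < 1" using \<theta> by (auto simp: \<rho>_def)
  have "\<forall>\<^sub>F t in nhds 0. cmod (lam t - 1) \<le> 1 - \<rho>" "\<forall>\<^sub>F t in nhds 0. cmod (mu t - 1) \<le> 1/2"
    using jet_tendsto_0[OF j4(1), of "1 - \<rho>"] jet_tendsto_0[OF j4(2), of "1/2"] \<rho> by (simp_all add: lam0 mu0)
  then obtain d1 where d1: "d1 > 0" "\<And>t. \<bar>t\<bar> \<le> d1 \<Longrightarrow> cmod (lam t - 1) \<le> 1 - \<rho> \<and> cmod (mu t - 1) \<le> 1/2"
    using eventually_nhds_0_obtain[OF eventually_conj] by (metis (no_types, lifting))
  define d2 where "d2 = min d d1"
  have d2: "d2 > 0" using d d1 by (simp add: d2_def)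
  have lam_ge: "\<rho> \<le> cmod (lam t)" and mu_ge: "1/2 \<le> cmod (mu t)" and mu_le: "cmod (mu t) \<le> 2" if "\<bar>t\<bar> \<le> d2" for t
  proof -
    have "cmod (lam t - 1) \<le> 1 - \<rho>" "cmod (mu t - 1) \<le> 1/2" using d1(2)[of t] that by (auto simp: d2_def)
    then show "\<rho> \<le> cmod (lam t)" "1/2 \<le> cmod (mu t)" "cmod (mu t) \<le> 2"
      using norm_triangle_ineq2[of 1 "1 - lam t"] norm_triangle_ineq2[of 1 "1 - mu t"] norm_triangle_sub[of "mu t" 1]
      by (auto simp: norm_minus_commute)
  qed
  \<comment> \<open>For fixed small t, mu t and lam t are limits of expressions in \<phi> N t, by
    this claim and the next. So the symmetry of characteristic functions under t \<mapsto> - t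
    passes to them.\<close>
  have ratio: "(\<lambda>N. \<phi> N t / lam t ^ N) \<longlonglongrightarrow> mu t" if t: "\<bar>t\<bar> \<le> d2" for t
  proof -
    have l: "lam t \<noteq> 0" using lam_ge[OF t] \<rho> \<theta> by auto
    have "(\<lambda>N. eps N t / lam t ^ N) \<longlonglongrightarrow> 0"
    proof (rule Lim_null_comparison)
      show "\<forall>\<^sub>F N in sequentially. norm (eps N t / lam t ^ N) \<le> C * (\<theta> / \<rho>) ^ N"
        using eventually_ge_at_top[of 1]
      proof eventually_elim
        case (elim N)
        have "norm (eps N t / lam t ^ N) \<le> (C * \<theta> ^ N) / \<rho> ^ N"
          unfolding norm_divide norm_power using eps1[of t N] t elim lam_ge[OF t] \<rho> \<theta> C
          by (intro frac_le power_mono) (auto simp: eps_def d2_def)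
        then show ?case by (simp add: power_divide)
      qed
      show "(\<lambda>N. C * (\<theta> / \<rho>) ^ N) \<longlonglongrightarrow> 0"
        using \<rho> \<theta> by (intro tendsto_mult_right_zero LIMSEQ_realpow_zero) auto
    qed
    then have "(\<lambda>N. mu t + eps N t / lam t ^ N) \<longlonglongrightarrow> mu t + 0" by (intro tendsto_intros)
    moreover have "mu t + eps N t / lam t ^ N = \<phi> N t / lam t ^ N" for N
      using l by (simp add: eps_def field_simps)
    ultimately show ?thesis by simp
  qed
  have quot: "(\<lambda>N. \<phi> (Suc N) t / \<phi> N t) \<longlonglongrightarrow> lam t" if t: "\<bar>t\<bar> \<le> d2" for t
  proof -
    have l: "lam t \<noteq> 0" using lam_ge[OF t] \<rho> \<theta> by auto
    have m: "mu t \<noteq> 0" using mu_ge[OF t] by auto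
    have "(\<lambda>N. lam t * ((\<phi> (Suc N) t / lam t ^ Suc N) / (\<phi> N t / lam t ^ N))) \<longlonglongrightarrow> lam t * (mu t / mu t)"
      by (intro tendsto_intros LIMSEQ_Suc[OF ratio[OF t]] ratio[OF t] m)
    moreover have "lam t * ((\<phi> (Suc N) t / lam t ^ Suc N) / (\<phi> N t / lam t ^ N)) = \<phi> (Suc N) t / \<phi> N t" for N
      using l by simp
    ultimately have "(\<lambda>N. \<phi> (Suc N) t / \<phi> N t) \<longlonglongrightarrow> lam t * (mu t / mu t)" by (simp only:)
    then show ?thesis using m by simp
  qed
  have lam_cnj: "lam (- t) = cnj (lam t)" if t: "\<bar>t\<bar> \<le> d2" for t
  proof -
    have "(\<lambda>N. cnj (\<phi> (Suc N) t / \<phi> N t)) \<longlonglongrightarrow> cnj (lam t)" by (intro tendsto_cnj quot t)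
    moreover have "\<forall>\<^sub>F N in sequentially. cnj (\<phi> (Suc N) t / \<phi> N t) = \<phi> (Suc N) (- t) / \<phi> N (- t)"
      using eventually_ge_at_top[of 1] by eventually_elim (simp add: conj)
    ultimately have "(\<lambda>N. \<phi> (Suc N) (- t) / \<phi> N (- t)) \<longlonglongrightarrow> cnj (lam t)" by (rule Lim_transform_eventually)
    then show ?thesis using quot[of "- t"] t by (auto intro: LIMSEQ_unique)
  qed
  have mu_cnj: "mu (- t) = cnj (mu t)" if t: "\<bar>t\<bar> \<le> d2" for t
  proof -
    have "(\<lambda>N. cnj (\<phi> N t / lam t ^ N)) \<longlonglongrightarrow> cnj (mu t)" by (intro tendsto_cnj ratio t)
    moreover have "\<forall>\<^sub>F N in sequentially. cnj (\<phi> N t / lam t ^ N) = \<phi> N (- t) / lam (- t) ^ N"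
      using eventually_ge_at_top[of 1] by eventually_elim (simp add: conj lam_cnj[OF t])
    ultimately have "(\<lambda>N. \<phi> N (- t) / lam (- t) ^ N) \<longlonglongrightarrow> cnj (mu t)" by (rule Lim_transform_eventually)
    then show ?thesis using ratio[of "- t"] t by (auto intro: LIMSEQ_unique)
  qed
  \<comment> \<open>The factor \<open>cis (- A * t)\<close> centres the sums: its N-th power is the
    phase that belongs to subtracting N A.\<close>
  define F where "F t = lam t * cis (- A * t)" for t
  have jF: "jet 4 F" unfolding F_def by (intro jet_bilinear[OF bounded_bilinear_mult] jlam jet_cis)
  have F0: "F 0 = 1" by (simp add: F_def lam0)
  define \<psi> where "\<psi> t = Ln (F t)" for t
  have j\<psi>: "jet 4 \<psi>" and Fnear: "\<forall>\<^sub>F t in nhds 0. cmod (F t - 1) \<le> 1/2"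
    unfolding \<psi>_def using jet_Ln[OF jF F0] by auto
  obtain c B where cB: "\<forall>\<^sub>F t in nhds 0. norm (\<psi> t - (\<Sum>j<4. t ^ j *\<^sub>R c j)) \<le> B * \<bar>t\<bar> ^ 4"
    using j\<psi> unfolding jet_iff_taylor by blast
  obtain m Bm where mB: "\<forall>\<^sub>F t in nhds 0. norm (mu t - (\<Sum>j<2. t ^ j *\<^sub>R m j)) \<le> Bm * \<bar>t\<bar> ^ 2"
    using jet_mono[OF jmu, of 2] unfolding jet_iff_taylor by auto
  have c0: "c 0 = 0" using eventually_nhds_x_imp_x[OF cB] by (simp add: \<psi>_def F0 eval_nat_numeral)
  have m0: "m 0 = 1" using eventually_nhds_x_imp_x[OF mB] by (simp add: mu0 eval_nat_numeral)
  obtain d3 where d3: "d3 > 0" and near: "\<And>t. \<bar>t\<bar> \<le> d3 \<Longrightarrow> cmod (F t - 1) \<le> 1/2 \<and> norm (\<psi> t - (\<Sum>j<4. t ^ j *\<^sub>R c j)) \<le> B * \<bar>t\<bar> ^ 4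
      \<and> norm (mu t - (\<Sum>j<2. t ^ j *\<^sub>R m j)) \<le> Bm * \<bar>t\<bar> ^ 2"
    by (rule eventually_nhds_0_obtain[OF eventually_conj[OF Fnear eventually_conj[OF cB mB]]]) blast
  define d4 where "d4 = min d2 d3"
  have d4: "d4 > 0" "d4 \<le> d" using d2 d3 by (auto simp: d4_def d2_def)
  define B' where "B' = \<bar>B\<bar> + \<bar>Bm\<bar> + 1"
  have B': "B' > 0" by (simp add: B'_def)
  have \<psi>4: "cmod (\<psi> t - (of_real t * c 1 + of_real (t\<^sup>2) * c 2 + of_real (t ^ 3) * c 3)) \<le> B' * \<bar>t\<bar> ^ 4" if "\<bar>t\<bar> \<le> d4" for t
  proof -
    have "norm (\<psi> t - (\<Sum>j<4. t ^ j *\<^sub>R c j)) \<le> B * \<bar>t\<bar> ^ 4" using near[of t] that by (simp add: d4_def)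
    also have "\<dots> \<le> B' * \<bar>t\<bar> ^ 4" by (intro mult_right_mono) (auto simp: B'_def)
    finally show ?thesis by (simp add: eval_nat_numeral c0 scaleR_conv_of_real algebra_simps)
  qed
  have mu2: "cmod (mu t - (1 + of_real t * m 1)) \<le> B' * \<bar>t\<bar> ^ 2" if "\<bar>t\<bar> \<le> d4" for t
  proof -
    have "norm (mu t - (\<Sum>j<2. t ^ j *\<^sub>R m j)) \<le> Bm * \<bar>t\<bar> ^ 2" using near[of t] that by (simp add: d4_def)
    also have "\<dots> \<le> B' * \<bar>t\<bar> ^ 2" by (intro mult_right_mono) (auto simp: B'_def)
    finally show ?thesis by (simp add: eval_nat_numeral m0 scaleR_conv_of_real)
  qed
  have exp_\<psi>: "exp (\<psi> t) = F t" if "\<bar>t\<bar> \<le> d4" for t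
  proof -
    have "cmod (F t - 1) \<le> 1/2" using near[of t] that by (simp add: d4_def)
    then have "F t \<noteq> 0" by auto
    then show ?thesis by (simp add: \<psi>_def)
  qed
  have \<psi>_cnj: "\<psi> (- t) = cnj (\<psi> t)" if t: "\<bar>t\<bar> \<le> d4" for t
  proof -
    have "F (- t) = cnj (F t)" using lam_cnj[of t] t by (simp add: F_def d4_def cis_cnj)
    moreover have "F t \<notin> \<real>\<^sub>\<le>\<^sub>0"
    proof
      assume "F t \<in> \<real>\<^sub>\<le>\<^sub>0"
      then have "Re (F t - 1) \<le> - 1" by (auto simp: complex_nonpos_Reals_iff)
      moreover have "cmod (F t - 1) \<le> 1/2" using near[of t] t by (simp add: d4_def)
      ultimately show False using abs_Re_le_cmod[of "F t - 1"] by linarith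
    qed
    ultimately show ?thesis by (simp add: \<psi>_def cnj_Ln)
  qed
  have core: "\<phi> N u * cis (- (A * real N * u)) = exp (of_nat N * \<psi> u) * mu u + eps N u * cis (- (A * real N * u))"
    if u: "\<bar>u\<bar> \<le> d4" for N u
  proof -
    have "F u ^ N = lam u ^ N * cis (- (A * real N * u))"
      by (simp add: F_def power_mult_distrib Complex.DeMoivre mult_ac)
    then have "exp (of_nat N * \<psi> u) = lam u ^ N * cis (- (A * real N * u))"
      using exp_\<psi>[OF u] by (simp add: exp_of_nat_mult)
    then show ?thesis by (simp add: eps_def algebra_simps)
  qed
  \<comment> \<open>Along \<open>N = k\<^sup>2\<close> the linear term of \<open>N * \<psi> (t / sqrt N)\<close> is \<open>k * t * c 1\<close>, an integer multiple of \<open>t * c 1\<close>.\<close>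
  have limit: "(\<lambda>k. exp (of_nat k * (of_real t * c 1))) \<longlonglongrightarrow> exp (- of_real (t\<^sup>2) * (of_real (\<sigma>2 / 2) + c 2))" for t :: real
  proof -
    let ?u = "\<lambda>k::nat. t / real k"
    have u0: "?u \<longlonglongrightarrow> 0" by real_asymp
    have ev: "\<forall>\<^sub>F k in sequentially. \<bar>?u k\<bar> < d4"
      using tendsto_rabs[OF u0] d4(1) by (intro order_tendstoD) auto
    have sq: "filterlim (\<lambda>k::nat. k\<^sup>2) at_top at_top" by (rule filterlim_subseq) (auto simp: strict_mono_def power_strict_mono)
    have L1: "(\<lambda>k. \<phi> (k\<^sup>2) (t / sqrt (real (k\<^sup>2))) * cis (- (t * sqrt (real (k\<^sup>2)) * A))) \<longlonglongrightarrow> exp (- of_real (\<sigma>2 * t\<^sup>2 / 2))"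
      using filterlim_compose[OF clt[of t] sq] .
    have e0: "(\<lambda>k. eps (k\<^sup>2) (?u k) * cis (- (A * real (k\<^sup>2) * ?u k))) \<longlonglongrightarrow> 0"
    proof (rule Lim_null_comparison)
      show "\<forall>\<^sub>F k in sequentially. norm (eps (k\<^sup>2) (?u k) * cis (- (A * real (k\<^sup>2) * ?u k))) \<le> C * \<theta> ^ (k\<^sup>2)"
        using ev eventually_ge_at_top[of 1]
        by eventually_elim (use eps1 d4 in \<open>auto simp: norm_mult eps_def\<close>)
      show "(\<lambda>k. C * \<theta> ^ (k\<^sup>2)) \<longlonglongrightarrow> 0" by (rule filterlim_compose[OF \<theta>N sq])
    qed
    have mu1: "(\<lambda>k. mu (?u k)) \<longlonglongrightarrow> 1"
    proof -
      have "(\<lambda>k. mu (?u k) - (1 + of_real (?u k) * m 1)) \<longlonglongrightarrow> 0"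
      proof (rule Lim_null_comparison)
        show "\<forall>\<^sub>F k in sequentially. norm (mu (?u k) - (1 + of_real (?u k) * m 1)) \<le> B' * \<bar>?u k\<bar> ^ 2"
          using ev by eventually_elim (rule mu2, simp)
        have "(\<lambda>k. B' * \<bar>?u k\<bar> ^ 2) \<longlonglongrightarrow> B' * \<bar>0\<bar> ^ 2" by (intro tendsto_intros u0)
        then show "(\<lambda>k. B' * \<bar>?u k\<bar> ^ 2) \<longlonglongrightarrow> 0" by simp
      qed
      moreover have "(\<lambda>k. 1 + of_real (?u k) * m 1) \<longlonglongrightarrow> 1 + of_real 0 * m 1" by (intro tendsto_intros u0)
      ultimately have "(\<lambda>k. (mu (?u k) - (1 + of_real (?u k) * m 1)) + (1 + of_real (?u k) * m 1)) \<longlonglongrightarrow> 0 + (1 + of_real 0 * m 1)"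
        by (rule tendsto_add)
      then show ?thesis by simp
    qed
    \<comment> \<open>The cubic and higher part of k^2 \<psi> (t / k), which is of order
      1/k.\<close>
    define r where "r k = of_nat (k\<^sup>2) * \<psi> (?u k) - (of_nat k * (of_real t * c 1) + of_real (t\<^sup>2) * c 2)" for k
    have r0: "r \<longlonglongrightarrow> 0"
    proof (rule Lim_null_comparison)
      show "\<forall>\<^sub>F k in sequentially. norm (r k) \<le> B' * t ^ 4 / (real k)\<^sup>2 + \<bar>t\<bar> ^ 3 * cmod (c 3) / real k"
        using ev eventually_ge_at_top[of 1]
      proof eventually_elim
        case (elim k)
        then have k: "real k > 0" by simp
        let ?z = "\<psi> (?u k) - (of_real (?u k) * c 1 + of_real ((?u k)\<^sup>2) * c 2 + of_real ((?u k) ^ 3) * c 3)"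
        have "r k = of_real ((real k)\<^sup>2) * ?z + of_real (t ^ 3 / real k) * c 3"
          using k by (simp add: r_def field_simps power2_eq_square power3_eq_cube)
        then have "norm (r k) \<le> norm (of_real ((real k)\<^sup>2) * ?z) + norm (of_real (t ^ 3 / real k) * c 3)"
          by (metis norm_triangle_ineq)
        also have "norm (of_real ((real k)\<^sup>2) * ?z) = (real k)\<^sup>2 * norm ?z" by (simp add: norm_mult norm_power)
        also have "\<dots> \<le> (real k)\<^sup>2 * (B' * \<bar>?u k\<bar> ^ 4)" using elim by (intro mult_left_mono \<psi>4) auto
        also have "\<dots> = B' * t ^ 4 / (real k)\<^sup>2" using k by (simp add: power_divide power_even_abs eval_nat_numeral)
        also have "norm (of_real (t ^ 3 / real k) * c 3) = \<bar>t\<bar> ^ 3 * cmod (c 3) / real k"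
          using k by (simp add: norm_mult norm_divide norm_power)
        finally show ?case by simp
      qed
      have "(\<lambda>k::nat. B' * t ^ 4 / (real k)\<^sup>2) \<longlonglongrightarrow> 0" "(\<lambda>k::nat. \<bar>t\<bar> ^ 3 * cmod (c 3) / real k) \<longlonglongrightarrow> 0"
        by real_asymp+
      from tendsto_add[OF this]
      show "(\<lambda>k. B' * t ^ 4 / (real k)\<^sup>2 + \<bar>t\<bar> ^ 3 * cmod (c 3) / real k) \<longlonglongrightarrow> 0" by simp
    qed
    have "\<forall>\<^sub>F k in sequentially. ((\<phi> (k\<^sup>2) (t / sqrt (real (k\<^sup>2))) * cis (- (t * sqrt (real (k\<^sup>2)) * A))
          - eps (k\<^sup>2) (?u k) * cis (- (A * real (k\<^sup>2) * ?u k))) / mu (?u k)) * exp (- r k - of_real (t\<^sup>2) * c 2)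
        = exp (of_nat k * (of_real t * c 1))"
      using ev eventually_ge_at_top[of 1]
    proof eventually_elim
      case (elim k)
      then have k: "real k > 0" and u: "\<bar>?u k\<bar> \<le> d4" by auto
      have m: "mu (?u k) \<noteq> 0" using mu_ge[of "?u k"] u by (auto simp: d4_def)
      have "\<phi> (k\<^sup>2) (t / sqrt (real (k\<^sup>2))) * cis (- (t * sqrt (real (k\<^sup>2)) * A)) = \<phi> (k\<^sup>2) (?u k) * cis (- (A * real (k\<^sup>2) * ?u k))"
        using k by (simp add: power2_eq_square mult_ac)
      note eq = this[unfolded core[OF u, of "k\<^sup>2"]]
      have "(\<phi> (k\<^sup>2) (t / sqrt (real (k\<^sup>2))) * cis (- (t * sqrt (real (k\<^sup>2)) * A))
          - eps (k\<^sup>2) (?u k) * cis (- (A * real (k\<^sup>2) * ?u k))) / mu (?u k) = exp (of_nat (k\<^sup>2) * \<psi> (?u k))"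
        unfolding eq using m by simp
      then show ?case by (simp add: r_def flip: exp_add)
    qed
    moreover have "(\<lambda>k. ((\<phi> (k\<^sup>2) (t / sqrt (real (k\<^sup>2))) * cis (- (t * sqrt (real (k\<^sup>2)) * A))
          - eps (k\<^sup>2) (?u k) * cis (- (A * real (k\<^sup>2) * ?u k))) / mu (?u k)) * exp (- r k - of_real (t\<^sup>2) * c 2))
        \<longlonglongrightarrow> ((exp (- of_real (\<sigma>2 * t\<^sup>2 / 2)) - 0) / 1) * exp (- 0 - of_real (t\<^sup>2) * c 2)"
      by (intro tendsto_intros L1 e0 mu1 r0) simp
    ultimately have "(\<lambda>k. exp (of_nat k * (of_real t * c 1))) \<longlonglongrightarrow> ((exp (- of_real (\<sigma>2 * t\<^sup>2 / 2)) - 0) / 1) * exp (- 0 - of_real (t\<^sup>2) * c 2)"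
      by (rule Lim_transform_eventually[rotated])
    moreover have "((exp (- of_real (\<sigma>2 * t\<^sup>2 / 2)) - 0) / 1) * exp (- 0 - of_real (t\<^sup>2) * c 2) = exp (- of_real (t\<^sup>2) * (of_real (\<sigma>2 / 2) + c 2))"
      by (simp add: algebra_simps flip: exp_add)
    ultimately show ?thesis by simp
  qed
  \<comment> \<open>The limit in \<open>limit\<close> is nonzero, so quotients of consecutive terms
    tend to 1; but these quotients are all equal to exp (t c 1).\<close>
  have c1: "c 1 = 0"
  proof (rule exp_multiples_eq_1_imp_zero)
    fix t :: real
    let ?q = "exp (- of_real (t\<^sup>2) * (of_real (\<sigma>2 / 2) + c 2))"
    have "(\<lambda>k. exp (of_nat (Suc k) * (of_real t * c 1)) / exp (of_nat k * (of_real t * c 1))) \<longlonglongrightarrow> ?q / ?q"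
      by (intro tendsto_intros LIMSEQ_Suc[OF limit[of t]] limit) simp
    moreover have "exp (of_nat (Suc k) * (of_real t * c 1)) / exp (of_nat k * (of_real t * c 1)) = exp (of_real t * c 1)" for k
      by (simp add: algebra_simps flip: exp_diff)
    ultimately have "(\<lambda>k::nat. exp (of_real t * c 1)) \<longlonglongrightarrow> 1" by simp
    then show "exp (of_real t * c 1) = 1" by (simp add: LIMSEQ_const_iff)
  qed
  \<comment> \<open>With c 1 = 0 the sequence in \<open>limit\<close> is constantly 1, so its limit
    is 1 as well. The square root turns t^2 into an arbitrary positive number.\<close>
  have c2: "c 2 = - of_real (\<sigma>2 / 2)"
  proof -
    have "- (of_real (\<sigma>2 / 2) + c 2) = 0"
    proof (rule exp_multiples_eq_1_imp_zero)
      fix t :: real assume t: "0 < t"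
      have "(\<lambda>k::nat. 1) \<longlonglongrightarrow> exp (- of_real ((sqrt t)\<^sup>2) * (of_real (\<sigma>2 / 2) + c 2))"
        using limit[of "sqrt t", unfolded c1] by simp
      then have "exp (- of_real ((sqrt t)\<^sup>2) * (of_real (\<sigma>2 / 2) + c 2)) = 1" by (simp add: LIMSEQ_const_iff)
      moreover have "of_real t * - (of_real (\<sigma>2 / 2) + c 2) = - of_real ((sqrt t)\<^sup>2) * (of_real (\<sigma>2 / 2) + c 2)"
        using t by (simp add: algebra_simps)
      ultimately show "exp (of_real t * - (of_real (\<sigma>2 / 2) + c 2)) = 1" by metis
    qed
    then show ?thesis by (simp add: add_eq_0_iff)
  qed
  \<comment> \<open>From \<psi>(- t) = cnj (\<psi> t), the odd coefficients are imaginary; comparing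
    both sides leaves t^3 (c 3 + cnj (c 3)) = O(t^4).\<close>
  have "c 3 + cnj (c 3) = 0"
  proof (rule coeff_eq_zero_of_higher_order[OF d4(1)])
    fix t :: real assume t: "0 < t" "t \<le> d4"
    let ?e = "\<lambda>t. \<psi> t - (of_real t * c 1 + of_real (t\<^sup>2) * c 2 + of_real (t ^ 3) * c 3)"
    have "of_real t ^ 3 * (c 3 + cnj (c 3)) = ?e (- t) - cnj (?e t)"
      using \<psi>_cnj[of t] t unfolding c1 c2 by (simp add: algebra_simps)
    then have "cmod (of_real t ^ 3 * (c 3 + cnj (c 3))) \<le> cmod (?e (- t)) + cmod (cnj (?e t))"
      by (metis norm_triangle_ineq4)
    also have "\<dots> \<le> B' * \<bar>- t\<bar> ^ 4 + B' * \<bar>t\<bar> ^ 4"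
      unfolding complex_mod_cnj using t by (intro add_mono \<psi>4) auto
    also have "\<dots> = (2 * B') * t ^ Suc 3" using t by (simp add: eval_nat_numeral)
    finally show "cmod (of_real t ^ 3 * (c 3 + cnj (c 3))) \<le> (2 * B') * t ^ Suc 3" .
  qed
  then have Re3: "Re (c 3) = 0" by (simp add: complex_eq_iff)
  have "m 1 + cnj (m 1) = 0"
  proof (rule coeff_eq_zero_of_higher_order[OF d4(1)])
    fix t :: real assume t: "0 < t" "t \<le> d4"
    let ?e = "\<lambda>t. mu t - (1 + of_real t * m 1)"
    have "of_real t ^ 1 * (m 1 + cnj (m 1)) = ?e (- t) - cnj (?e t)"
      using mu_cnj[of t] t by (simp add: d4_def algebra_simps)
    then have "cmod (of_real t ^ 1 * (m 1 + cnj (m 1))) \<le> cmod (?e (- t)) + cmod (cnj (?e t))"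
      by (metis norm_triangle_ineq4)
    also have "\<dots> \<le> B' * \<bar>- t\<bar> ^ 2 + B' * \<bar>t\<bar> ^ 2"
      unfolding complex_mod_cnj using t by (intro add_mono mu2) auto
    also have "\<dots> = (2 * B') * t ^ Suc 1" using t by (simp add: eval_nat_numeral)
    finally show "cmod (of_real t ^ 1 * (m 1 + cnj (m 1))) \<le> (2 * B') * t ^ Suc 1" .
  qed
  then have Re1: "Re (m 1) = 0" by (simp add: complex_eq_iff)
  define \<kappa> where "\<kappa> = Im (c 3)"
  define \<mu>1 where "\<mu>1 = Im (m 1)"
  have c3: "c 3 = \<i> * of_real \<kappa>" and m1: "m 1 = \<i> * of_real \<mu>1"
    using Re3 Re1 by (simp_all add: complex_eq_iff \<kappa>_def \<mu>1_def)
  \<comment> \<open>On this range |R| \<le> \<sigma>2 t^2 / 4, so exp |R| uses up only half of the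
    Gaussian decay exp (- \<sigma>2 t^2 / 2).\<close>
  define d' where "d' = min d4 (sqrt (\<sigma>2 / (4 * B')))"
  have d': "d' > 0" "d' \<le> d4" using d4 \<sigma>2 B' by (auto simp: d'_def)
  have d'sq: "B' * d'\<^sup>2 \<le> \<sigma>2 / 4"
  proof -
    have "d'\<^sup>2 \<le> (sqrt (\<sigma>2 / (4 * B')))\<^sup>2" using d' by (intro power_mono) (auto simp: d'_def)
    also have "\<dots> = \<sigma>2 / (4 * B')" using \<sigma>2 B' by simp
    finally show ?thesis using B' by (simp add: field_simps)
  qed
  obtain G where G: "G > 0" "\<And>t. (1 + t\<^sup>2) ^ 4 * exp (- (\<sigma>2 / 4) * t\<^sup>2) \<le> G"
    by (rule quartic_gaussian_bound[of "\<sigma>2 / 4"]) (use \<sigma>2 in \<open>auto intro: that\<close>)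
  obtain G2 where G2: "G2 > 0" "\<And>N. N \<ge> 1 \<Longrightarrow> real N ^ 3 * \<theta> ^ N \<le> G2"
    by (rule power_geometric_bound[OF \<theta>]) (rule that)
  \<comment> \<open>The coefficients of the four errors collected in \<open>main\<close>: 2 B' from
    R (with |mu| \<le> 2) and B' from \<nu>, then the quadratic remainder of exp Y, and the product
    Y Z.\<close>
  define Q where "Q = 3 * B' + \<kappa>\<^sup>2 * (1 + \<bar>\<mu>1\<bar> * d') + \<bar>\<kappa>\<bar> * \<bar>\<mu>1\<bar>"
  have Q: "Q > 0" unfolding Q_def using B' d' by (intro add_pos_nonneg mult_nonneg_nonneg) auto
  define C' where "C' = 3 * Q * G + C * G2"
  have C': "C' > 0" "3 * Q * G \<le> C'" "C * G2 \<le> C'"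
    using Q G(1) C G2(1) by (auto simp: C'_def add_pos_pos less_imp_le)
  show ?thesis
  proof (rule that[OF d'(1) C'(1)])
    fix N :: nat and t :: real
    assume N: "N \<ge> 1" and t: "\<bar>t\<bar> \<le> d' * sqrt (real N)"
    define n where "n = sqrt (real N)"
    have n: "n > 0" "n\<^sup>2 = real N" using N by (auto simp: n_def)
    have n1: "n \<ge> 1" using N by (simp add: n_def)
    define u where "u = t / n"
    have u: "\<bar>u\<bar> \<le> d'" using t n by (simp add: u_def n_def[symmetric] field_simps)
    then have u4: "\<bar>u\<bar> \<le> d4" using d' by simp
    have tu: "t = u * n" using n by (simp add: u_def)
    have Nu: "real N * u\<^sup>2 = t\<^sup>2" by (simp add: tu power_mult_distrib n)
    define X where "X = - complex_of_real (\<sigma>2 * t\<^sup>2 / 2)"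
    define Y where "Y = \<i> * of_real (\<kappa> * t ^ 3 / n)"
    define Z where "Z = \<i> * of_real (\<mu>1 * t / n)"
    \<comment> \<open>Exponent X + Y + R and prefactor 1 + Z + \<nu>: X is the Gaussian part, Y and
      Z are of order 1/n, and R and \<nu> are of order 1/N.\<close>
    define R where "R = of_nat N * \<psi> u - (X + Y)"
    define \<nu> where "\<nu> = mu u - (1 + Z)"
    have R_eq: "R = of_nat N * (\<psi> u - (of_real u * c 1 + of_real (u\<^sup>2) * c 2 + of_real (u ^ 3) * c 3))"
    proof -
      have "of_nat N * (of_real (u\<^sup>2) * c 2) = X"
        unfolding X_def c2 Nu[symmetric] by simp
      moreover have "of_nat N * (of_real (u ^ 3) * c 3) = Y"
      proof -
        have "real N * u ^ 3 = t ^ 3 / n"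
          using n by (simp add: tu power3_eq_cube power2_eq_square flip: n(2))
        then have "complex_of_real (real N * u ^ 3) * (\<i> * of_real \<kappa>) = of_real (t ^ 3 / n) * (\<i> * of_real \<kappa>)" by simp
        then show ?thesis by (simp add: Y_def c3 mult_ac)
      qed
      ultimately show ?thesis unfolding R_def c1 by (simp add: algebra_simps)
    qed
    have R_le: "cmod R \<le> B' * t ^ 4 / N"
    proof -
      have "cmod R = real N * cmod (\<psi> u - (of_real u * c 1 + of_real (u\<^sup>2) * c 2 + of_real (u ^ 3) * c 3))"
        by (simp add: R_eq norm_mult)
      also have "\<dots> \<le> real N * (B' * \<bar>u\<bar> ^ 4)" by (intro mult_left_mono \<psi>4 u4) auto
      also have "\<dots> = B' * (real N * u\<^sup>2)\<^sup>2 / N" using N by (simp add: power2_eq_square eval_nat_numeral)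
      finally show ?thesis unfolding Nu by simp
    qed
    have R_le2: "cmod R \<le> \<sigma>2 / 4 * t\<^sup>2"
    proof -
      have "t ^ 4 = (real N * u\<^sup>2) * t\<^sup>2" unfolding Nu by (simp add: eval_nat_numeral)
      then have "B' * t ^ 4 / N = (B' * u\<^sup>2) * t\<^sup>2" using N by simp
      also have "\<dots> \<le> (B' * d'\<^sup>2) * t\<^sup>2"
        using u B' abs_le_square_iff[of u d'] d' by (intro mult_right_mono mult_left_mono) auto
      also have "\<dots> \<le> \<sigma>2 / 4 * t\<^sup>2" by (intro mult_right_mono d'sq) auto
      finally show ?thesis using R_le by linarith
    qed
    have Z_eq: "Z = of_real u * m 1" unfolding Z_def u_def m1 by (simp add: mult_ac)
    have \<nu>_le: "cmod \<nu> \<le> B' * t\<^sup>2 / N"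
    proof -
      have "cmod \<nu> \<le> B' * \<bar>u\<bar> ^ 2" unfolding \<nu>_def Z_eq by (rule mu2[OF u4])
      also have "\<dots> = B' * t\<^sup>2 / N" using N Nu[symmetric] by simp
      finally show ?thesis .
    qed
    have eY: "cmod (exp Y) = 1" by (simp add: Y_def)
    have Y_abs: "cmod Y = \<bar>\<kappa>\<bar> * \<bar>t\<bar> ^ 3 / n" using n by (simp add: Y_def norm_mult norm_divide norm_power)
    have Z_abs: "cmod Z = \<bar>\<mu>1\<bar> * \<bar>t\<bar> / n" using n by (simp add: Z_def norm_mult norm_divide)
    have Z_le: "cmod Z \<le> \<bar>\<mu>1\<bar> * d'" using mult_left_mono[OF u, of "\<bar>\<mu>1\<bar>"] unfolding Z_eq m1 by (simp add: norm_mult mult.commute)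
    have EY: "cmod (exp Y - 1 - Y) \<le> \<kappa>\<^sup>2 * t ^ 6 / N"
    proof -
      have "cmod (exp Y - 1 - Y) \<le> (\<bar>\<kappa> * t ^ 3 / n\<bar>)\<^sup>2 / 2"
        using iexp_approx1[of "\<kappa> * t ^ 3 / n" 1] by (simp add: Y_def eval_nat_numeral algebra_simps)
      also have "\<dots> = \<kappa>\<^sup>2 * t ^ 6 / N / 2"
        unfolding n(2)[symmetric] by (simp add: power_divide power_mult_distrib flip: power_mult)
      also have "\<dots> \<le> \<kappa>\<^sup>2 * t ^ 6 / N"
      proof -
        have half: "x / 2 \<le> x" if "0 \<le> x" for x :: real using that by simp
        show ?thesis by (rule half) (intro divide_nonneg_nonneg mult_nonneg_nonneg, auto)
      qed
      finally show ?thesis .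
    qed
    have YZ: "cmod (Y * Z) = \<bar>\<kappa>\<bar> * \<bar>\<mu>1\<bar> * t ^ 4 / N"
      unfolding norm_mult Y_abs Z_abs n(2)[symmetric] by (simp add: power2_eq_square eval_nat_numeral)
    have main: "cmod (exp (of_nat N * \<psi> u) * mu u - exp X * (1 + (Y + Z))) \<le> 3 * Q * G * \<bar>t\<bar> * (1 / (real N * (1 + t\<^sup>2)))"
    proof -
      have "exp (of_nat N * \<psi> u) = exp X * exp Y * exp R" by (simp add: R_def flip: exp_add)
      moreover have "mu u = 1 + Z + \<nu>" by (simp add: \<nu>_def)
      ultimately have "exp (of_nat N * \<psi> u) * mu u - exp X * (1 + (Y + Z))
          = exp X * (exp Y * (exp R - 1) * mu u + exp Y * \<nu> + (exp Y - 1 - Y) * (1 + Z) + Y * Z)"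
        by (simp add: algebra_simps)
      then have "cmod (exp (of_nat N * \<psi> u) * mu u - exp X * (1 + (Y + Z)))
          = exp (- (\<sigma>2 * t\<^sup>2 / 2)) * cmod (exp Y * (exp R - 1) * mu u + exp Y * \<nu> + (exp Y - 1 - Y) * (1 + Z) + Y * Z)"
        by (simp add: norm_mult X_def)
      also have "\<dots> \<le> exp (- (\<sigma>2 * t\<^sup>2 / 2)) * (exp (\<sigma>2 / 4 * t\<^sup>2) * (Q * ((t\<^sup>2 + t ^ 4 + t ^ 6) / N)))"
      proof (intro mult_left_mono)
        let ?E = "exp (\<sigma>2 / 4 * t\<^sup>2)"
        have E1: "?E \<ge> 1" using \<sigma>2 by simp
        have p: "0 \<le> t\<^sup>2 / N" "0 \<le> t ^ 4 / N" "0 \<le> t ^ 6 / N" by auto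
        have "cmod (exp Y * (exp R - 1) * mu u) \<le> (cmod R * exp (cmod R)) * 2"
          unfolding norm_mult eY using norm_exp_minus_1_le[of R] mu_le[of u] u4
          by (auto simp: d4_def intro!: mult_mono)
        also have "\<dots> \<le> ((B' * t ^ 4 / N) * ?E) * 2"
          using R_le R_le2 B' by (intro mult_right_mono mult_mono) auto
        finally have a1: "cmod (exp Y * (exp R - 1) * mu u) \<le> ?E * (2 * B' * (t ^ 4 / N))" by (simp add: mult_ac)
        have "cmod (exp Y * \<nu>) \<le> 1 * (B' * t\<^sup>2 / N)" unfolding norm_mult eY using \<nu>_le by simp
        also have "\<dots> \<le> ?E * (B' * t\<^sup>2 / N)" using E1 B' by (intro mult_right_mono) auto
        finally have a2: "cmod (exp Y * \<nu>) \<le> ?E * (B' * (t\<^sup>2 / N))" by simp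
        have "cmod ((exp Y - 1 - Y) * (1 + Z)) \<le> (\<kappa>\<^sup>2 * t ^ 6 / N) * (1 + \<bar>\<mu>1\<bar> * d')"
          unfolding norm_mult using EY Z_le norm_triangle_ineq[of 1 Z] by (intro mult_mono) auto
        also have "\<dots> = 1 * (\<kappa>\<^sup>2 * (1 + \<bar>\<mu>1\<bar> * d') * (t ^ 6 / N))" by simp
        also have "\<dots> \<le> ?E * (\<kappa>\<^sup>2 * (1 + \<bar>\<mu>1\<bar> * d') * (t ^ 6 / N))"
          using E1 p d' by (intro mult_right_mono mult_nonneg_nonneg) auto
        finally have a3: "cmod ((exp Y - 1 - Y) * (1 + Z)) \<le> ?E * (\<kappa>\<^sup>2 * (1 + \<bar>\<mu>1\<bar> * d') * (t ^ 6 / N))" .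
        have "cmod (Y * Z) = 1 * (\<bar>\<kappa>\<bar> * \<bar>\<mu>1\<bar> * (t ^ 4 / N))" using YZ by simp
        also have "\<dots> \<le> ?E * (\<bar>\<kappa>\<bar> * \<bar>\<mu>1\<bar> * (t ^ 4 / N))"
          using E1 p by (intro mult_right_mono mult_nonneg_nonneg) auto
        finally have a4: "cmod (Y * Z) \<le> ?E * (\<bar>\<kappa>\<bar> * \<bar>\<mu>1\<bar> * (t ^ 4 / N))" .
        have "cmod (exp Y * (exp R - 1) * mu u + exp Y * \<nu> + (exp Y - 1 - Y) * (1 + Z) + Y * Z)
            \<le> cmod (exp Y * (exp R - 1) * mu u) + cmod (exp Y * \<nu>) + cmod ((exp Y - 1 - Y) * (1 + Z)) + cmod (Y * Z)"
          by (intro order_trans[OF norm_triangle_ineq] add_mono order_refl)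
        also have "\<dots> \<le> ?E * (2 * B' * (t ^ 4 / N)) + ?E * (B' * (t\<^sup>2 / N)) + ?E * (\<kappa>\<^sup>2 * (1 + \<bar>\<mu>1\<bar> * d') * (t ^ 6 / N))
            + ?E * (\<bar>\<kappa>\<bar> * \<bar>\<mu>1\<bar> * (t ^ 4 / N))"
          by (intro add_mono a1 a2 a3 a4)
        also have "\<dots> = ?E * ((2 * B' + \<bar>\<kappa>\<bar> * \<bar>\<mu>1\<bar>) * (t ^ 4 / N) + B' * (t\<^sup>2 / N) + \<kappa>\<^sup>2 * (1 + \<bar>\<mu>1\<bar> * d') * (t ^ 6 / N))"
          by (simp only: algebra_simps)
        also have "\<dots> \<le> ?E * (Q * (t ^ 4 / N) + Q * (t\<^sup>2 / N) + Q * (t ^ 6 / N))"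
        proof (intro mult_left_mono add_mono mult_right_mono p)
          have "0 \<le> \<kappa>\<^sup>2 * (1 + \<bar>\<mu>1\<bar> * d')" "0 \<le> \<bar>\<kappa>\<bar> * \<bar>\<mu>1\<bar>" using d' by auto
          then show "2 * B' + \<bar>\<kappa>\<bar> * \<bar>\<mu>1\<bar> \<le> Q" "B' \<le> Q" "\<kappa>\<^sup>2 * (1 + \<bar>\<mu>1\<bar> * d') \<le> Q"
            using B' unfolding Q_def by linarith+
        qed auto
        also have "\<dots> = ?E * (Q * ((t\<^sup>2 + t ^ 4 + t ^ 6) / N))"
          by (simp add: add_divide_distrib distrib_left)
        finally show "cmod (exp Y * (exp R - 1) * mu u + exp Y * \<nu> + (exp Y - 1 - Y) * (1 + Z) + Y * Z)
            \<le> ?E * (Q * ((t\<^sup>2 + t ^ 4 + t ^ 6) / N))" .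
      qed auto
      \<comment> \<open>Every error term contains at least t^2, so one factor |t| can be pulled out
        for the later division by t.\<close>
      also have "\<dots> = (Q * \<bar>t\<bar> / N) * ((\<bar>t\<bar> + \<bar>t\<bar> ^ 3 + \<bar>t\<bar> ^ 5) * exp (- (\<sigma>2 / 4) * t\<^sup>2))"
      proof -
        have "exp (- (\<sigma>2 * t\<^sup>2 / 2)) * exp (\<sigma>2 / 4 * t\<^sup>2) = exp (- (\<sigma>2 / 4) * t\<^sup>2)"
          by (simp flip: exp_add)
        moreover have "t\<^sup>2 + t ^ 4 + t ^ 6 = \<bar>t\<bar> * (\<bar>t\<bar> + \<bar>t\<bar> ^ 3 + \<bar>t\<bar> ^ 5)"
          by (simp add: distrib_left eval_nat_numeral)
        ultimately show ?thesis by (simp add: mult_ac)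
      qed
      also have "\<dots> \<le> (Q * \<bar>t\<bar> / N) * (3 * G / (1 + t\<^sup>2))"
        using Q by (intro mult_left_mono inverse_1_plus_sq_bound G) auto
      finally show ?thesis by (simp add: mult_ac)
    qed
    \<comment> \<open>Geometric decay beats N^3, which is traded for the N^(-2) wanted
      later.\<close>
    have small: "cmod (eps N u) \<le> C * G2 * \<bar>t\<bar> * (1 / (real N)\<^sup>2)"
    proof -
      have "cmod (eps N u) \<le> C * N * \<theta> ^ N * \<bar>u\<bar>" using u4 d4 N by (intro eps_le) auto
      also have "\<bar>u\<bar> \<le> \<bar>t\<bar>"
        using mult_right_mono[OF n1, of "\<bar>t\<bar>"] n by (simp add: u_def field_simps)
      then have "C * N * \<theta> ^ N * \<bar>u\<bar> \<le> C * N * \<theta> ^ N * \<bar>t\<bar>" using C \<theta> by (intro mult_left_mono) auto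
      also have "C * N * \<theta> ^ N * \<bar>t\<bar> = C * (real N ^ 3 * \<theta> ^ N) * \<bar>t\<bar> * (1 / (real N)\<^sup>2)"
        using N by (simp add: power3_eq_cube power2_eq_square)
      also have "\<dots> \<le> C * G2 * \<bar>t\<bar> * (1 / (real N)\<^sup>2)"
        using C G2(2)[OF N] by (intro mult_right_mono mult_left_mono) auto
      finally show ?thesis .
    qed
    have "A * real N * u = t * sqrt (real N) * A" using n by (simp add: u_def n_def[symmetric] power2_eq_square flip: n(2))
    then have e1: "\<phi> N (t / sqrt (real N)) * cis (- (t * sqrt (real N) * A))
        = exp (of_nat N * \<psi> u) * mu u + eps N u * cis (- (A * real N * u))"
      using core[OF u4, of N] by (simp add: u_def n_def)
    have e2: "exp (- complex_of_real (\<sigma>2 * t\<^sup>2 / 2)) * (1 + \<i> * of_real ((\<mu>1 * t + \<kappa> * t ^ 3) / sqrt (real N))) = exp X * (1 + (Y + Z))"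
      by (simp add: X_def Y_def Z_def n_def add_divide_distrib algebra_simps)
    have "cmod (\<phi> N (t / sqrt (real N)) * cis (- (t * sqrt (real N) * A))
        - exp (- of_real (\<sigma>2 * t\<^sup>2 / 2)) * (1 + \<i> * of_real ((\<mu>1 * t + \<kappa> * t ^ 3) / sqrt (real N))))
      = cmod ((exp (of_nat N * \<psi> u) * mu u - exp X * (1 + (Y + Z))) + eps N u * cis (- (A * real N * u)))"
      unfolding e1 e2 by (simp add: algebra_simps)
    also have "\<dots> \<le> cmod (exp (of_nat N * \<psi> u) * mu u - exp X * (1 + (Y + Z))) + cmod (eps N u * cis (- (A * real N * u)))"
      by (rule norm_triangle_ineq)
    also have "\<dots> \<le> 3 * Q * G * \<bar>t\<bar> * (1 / (real N * (1 + t\<^sup>2))) + C * G2 * \<bar>t\<bar> * (1 / (real N)\<^sup>2)"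
      using main small by (simp add: norm_mult)
    also have "\<dots> \<le> C' * \<bar>t\<bar> * (1 / (real N * (1 + t\<^sup>2))) + C' * \<bar>t\<bar> * (1 / (real N)\<^sup>2)"
      using C' by (intro add_mono mult_right_mono) auto
    finally show "cmod (\<phi> N (t / sqrt (real N)) * cis (- (t * sqrt (real N) * A))
        - exp (- of_real (\<sigma>2 * t\<^sup>2 / 2)) * (1 + \<i> * of_real ((\<mu>1 * t + \<kappa> * t ^ 3) / sqrt (real N))))
      \<le> C' * \<bar>t\<bar> * (1 / (real N * (1 + t\<^sup>2)) + 1 / (real N)\<^sup>2)"
      by (simp add: distrib_left)
  qed
qed


subsection \<open>Bounds away from the origin\<close>

text \<open>Beyond d sqrt N the comparison transform is tiny, but the bound must have the shape used
  near 0. The factor 1/N comes from N \<le> t^2 / d^2 and the factor t from 1 \<le> t / d, hence d^3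
  in the constant.\<close>

lemma gaussian_tail_bound:
  fixes \<sigma>2 \<mu>1 \<kappa> d :: real
  assumes "\<sigma>2 > 0" "d > 0"
  obtains C where "C > 0" "\<And>N t. N \<ge> 1 \<Longrightarrow> d * sqrt (real N) \<le> t \<Longrightarrow>
    cmod (exp (- of_real (\<sigma>2 * t\<^sup>2 / 2)) * (1 + \<i> * of_real ((\<mu>1 * t + \<kappa> * t ^ 3) / sqrt (real N))))
      \<le> C * t * (1 / (real N * (1 + t\<^sup>2)))"
proof -
  obtain G where G: "G > 0" "\<And>t. (1 + t\<^sup>2) ^ 4 * exp (- (\<sigma>2 / 2) * t\<^sup>2) \<le> G"
    by (rule quartic_gaussian_bound[of "\<sigma>2 / 2"]) (use assms in \<open>auto intro: that\<close>)
  define a where "a = 1 + \<bar>\<mu>1\<bar> + \<bar>\<kappa>\<bar>"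
  have a: "a > 0" by (simp add: a_def add_pos_nonneg)
  define C where "C = a * G / d ^ 3"
  show ?thesis
  proof (rule that[of C])
    show "C > 0" using a G assms by (simp add: C_def)
    fix N :: nat and t :: real assume N: "N \<ge> 1" and t: "d * sqrt (real N) \<le> t"
    have n1: "1 \<le> sqrt (real N)" using N by simp
    have "d * 1 \<le> d * sqrt (real N)" using assms by (intro mult_left_mono n1) auto
    then have td: "d \<le> t" using t by linarith
    then have t0: "t > 0" using assms by simp
    have tsq: "d\<^sup>2 * real N \<le> t\<^sup>2"
      using power_mono[OF t, of 2] assms by (simp add: power_mult_distrib)
    let ?q = "1 + t\<^sup>2"
    have q: "?q \<ge> 1" by simp
    have p1: "t \<le> ?q" using abs_le_1_plus_sq[of t] t0 by simp
    have "t ^ 3 = t * t\<^sup>2" by (simp add: power3_eq_cube power2_eq_square)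
    also have "\<dots> \<le> ?q * ?q" using p1 t0 by (intro mult_mono) auto
    finally have p3: "t ^ 3 \<le> ?q\<^sup>2" by (simp add: power2_eq_square)
    have p1': "t \<le> ?q\<^sup>2" "1 \<le> ?q\<^sup>2"
      using p1 q power_increasing[of 1 2 ?q] by auto
    have "cmod (1 + \<i> * of_real ((\<mu>1 * t + \<kappa> * t ^ 3) / sqrt (real N))) \<le> 1 + \<bar>(\<mu>1 * t + \<kappa> * t ^ 3) / sqrt (real N)\<bar>"
    proof -
      have "cmod (\<i> * of_real x) = \<bar>x\<bar>" for x by (simp add: norm_mult)
      then show ?thesis
        using norm_triangle_ineq[of 1 "\<i> * of_real ((\<mu>1 * t + \<kappa> * t ^ 3) / sqrt (real N))"]
        by (simp only: norm_one)
    qed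
    also have "\<bar>(\<mu>1 * t + \<kappa> * t ^ 3) / sqrt (real N)\<bar> \<le> \<bar>\<mu>1 * t + \<kappa> * t ^ 3\<bar> / 1"
      unfolding abs_divide using n1 by (intro divide_left_mono) auto
    also have "\<bar>\<mu>1 * t + \<kappa> * t ^ 3\<bar> / 1 \<le> \<bar>\<mu>1\<bar> * t + \<bar>\<kappa>\<bar> * t ^ 3"
      using abs_triangle_ineq[of "\<mu>1 * t" "\<kappa> * t ^ 3"] t0 by (simp add: abs_mult)
    also have "1 + (\<bar>\<mu>1\<bar> * t + \<bar>\<kappa>\<bar> * t ^ 3) \<le> ?q\<^sup>2 + (\<bar>\<mu>1\<bar> * ?q\<^sup>2 + \<bar>\<kappa>\<bar> * ?q\<^sup>2)"
      using p3 p1' by (intro add_mono mult_left_mono) auto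
    also have "\<dots> = a * ?q\<^sup>2" by (simp add: a_def algebra_simps)
    finally have 1: "cmod (1 + \<i> * of_real ((\<mu>1 * t + \<kappa> * t ^ 3) / sqrt (real N))) \<le> a * ?q\<^sup>2" by simp
    let ?e = "exp (- (\<sigma>2 / 2) * t\<^sup>2)"
    have ce: "cmod (exp (- of_real (\<sigma>2 * t\<^sup>2 / 2))) = ?e" by (simp add: norm_exp_eq_Re)
    have "?e * ?q\<^sup>2 * (?q * (d\<^sup>2 * real N)) \<le> ?e * ?q\<^sup>2 * (?q * ?q)"
      using tsq q by (intro mult_left_mono) auto
    also have "\<dots> = ?q ^ 4 * ?e" by (simp add: eval_nat_numeral)
    also have "\<dots> \<le> G" by (rule G)
    finally have 2: "?e * ?q\<^sup>2 * (?q * (d\<^sup>2 * real N)) \<le> G" .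
    have pos: "0 < ?q * (d\<^sup>2 * real N)" using assms N less_le_trans[OF zero_less_one q] by (intro mult_pos_pos) auto
    have "cmod (exp (- of_real (\<sigma>2 * t\<^sup>2 / 2)) * (1 + \<i> * of_real ((\<mu>1 * t + \<kappa> * t ^ 3) / sqrt (real N)))) \<le> ?e * (a * ?q\<^sup>2)"
      unfolding norm_mult ce by (intro mult_left_mono 1) auto
    also have "\<dots> = a * (?e * ?q\<^sup>2)" by simp
    also have "\<dots> \<le> a * (G / (?q * (d\<^sup>2 * real N)))"
    proof (intro mult_left_mono)
      show "?e * ?q\<^sup>2 \<le> G / (?q * (d\<^sup>2 * real N))" using 2 by (simp only: pos_le_divide_eq[OF pos])
    qed (use a in simp)
    also have "\<dots> \<le> a * (G / (?q * (d\<^sup>2 * real N))) * (t / d)"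
    proof -
      have "1 \<le> t / d" using td assms by simp
      moreover have "0 \<le> a * (G / (?q * (d\<^sup>2 * real N)))"
        using a G(1) pos by (intro mult_nonneg_nonneg divide_nonneg_nonneg) auto
      ultimately have "a * (G / (?q * (d\<^sup>2 * real N))) * 1 \<le> a * (G / (?q * (d\<^sup>2 * real N))) * (t / d)"
        by (rule mult_left_mono)
      then show ?thesis by (simp only: mult_1_right)
    qed
    also have "\<dots> = C * t * (1 / (real N * ?q))"
      using assms by (simp add: C_def power2_eq_square power3_eq_cube)
    finally show "cmod (exp (- of_real (\<sigma>2 * t\<^sup>2 / 2)) * (1 + \<i> * of_real ((\<mu>1 * t + \<kappa> * t ^ 3) / sqrt (real N))))
      \<le> C * t * (1 / (real N * (1 + t\<^sup>2)))" .
  qed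
qed

lemma resolvent_of_spectrum_in_ball:
  fixes T :: "'b::{complex_normed_vector,banach} \<Rightarrow>\<^sub>L 'b"
  assumes spec: "op_spectrum T \<subseteq> ball 0 1" and z: "cmod z \<le> 1"
  shows "\<exists>S. is_inverse (id_blinfun - (cscale z o\<^sub>L T)) S"
proof (cases "z = 0")
  case True
  then show ?thesis by (intro exI[of _ id_blinfun]) (simp add: blinfun.diff_left)
next
  case False
  define w where "w = inverse z"
  have w: "z * w = 1" "w * z = 1" using False by (auto simp: w_def)
  have "1 \<le> inverse (cmod z)" using False z by (simp add: one_le_inverse)
  then have "w \<notin> op_spectrum T" using spec by (auto simp: w_def norm_inverse subset_eq)
  then obtain S where S: "is_inverse (T - cscale w) S" unfolding op_spectrum_iff by blast
  have Tw: "(T - cscale w) x = T x - w *\<^sub>C x" for x by (simp add: blinfun.diff_left)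
  have S1: "T (S x) - w *\<^sub>C S x = x" for x using S unfolding Tw by blast
  have S2: "S (T x - w *\<^sub>C x) = x" for x using S unfolding Tw by blast
  have ap: "(id_blinfun - (cscale z o\<^sub>L T)) x = - (z *\<^sub>C (T x - w *\<^sub>C x))" for x
    by (simp add: blinfun.diff_left scaleC_diff_right scaleC_scaleC w scaleC_one)
  show ?thesis
  proof (intro exI conjI allI)
    fix x
    show "(S o\<^sub>L cscale (- w)) ((id_blinfun - (cscale z o\<^sub>L T)) x) = x"
      unfolding ap by (simp add: scaleC_minus_left scaleC_minus_right scaleC_scaleC w scaleC_one S2)
    show "(id_blinfun - (cscale z o\<^sub>L T)) ((S o\<^sub>L cscale (- w)) x) = x"
      unfolding ap by (simp add: S1 scaleC_minus_left scaleC_minus_right scaleC_scaleC w scaleC_one)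
  qed
qed

text \<open>One natural number encodes both constants: \<open>n\<close> as the prefactor and 1 -
  1/(n + 2) as the ratio, both increasing in n, so the compactness lemma yields a common
  pair.\<close>

lemma compact_uniform_geometric_bound:
  fixes L :: "real \<Rightarrow> ('b::{complex_normed_vector,banach} \<Rightarrow>\<^sub>L 'b)"
  assumes lin: "\<And>t. clinear_op (L t)" and cont: "continuous_on UNIV L" and K: "compact K"
    and spec: "\<And>t. t \<in> K \<Longrightarrow> op_spectrum (L t) \<subseteq> ball 0 1"
  obtains C \<theta> where "C > 0" "0 < \<theta>" "\<theta> < 1" "\<And>t N. t \<in> K \<Longrightarrow> norm (blpow (L t) N) \<le> C * \<theta> ^ N"
proof -
  define \<theta> where "\<theta> n = 1 - 1 / (real n + 2)" for n :: nat
  have \<theta>: "0 < \<theta> n" "\<theta> n < 1" for n by (auto simp: \<theta>_def field_simps)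
  define P where "P n t \<longleftrightarrow> (\<forall>N. norm (blpow (L t) N) \<le> real n * \<theta> n ^ N)" for n t
  obtain n where n: "\<And>t. t \<in> K \<Longrightarrow> P n t"
  proof (rule compact_uniform_nat_bound[OF K, of P])
    fix i j t assume P: "P i t" and ij: "i \<le> j"
    have "\<theta> i \<le> \<theta> j" using ij by (simp add: \<theta>_def frac_le)
    then have "real i * \<theta> i ^ N \<le> real j * \<theta> j ^ N" for N
      using ij \<theta>(1)[of i] by (intro mult_mono power_mono) auto
    then show "P j t" using P unfolding P_def by (meson order_trans)
  next
    fix t assume t: "t \<in> K"
    obtain k where k: "0 < k" "norm (blpow (L t) k) \<le> 1/2"
      by (rule spectral_radius_less_one[OF lin resolvent_of_spectrum_in_ball[OF spec[OF t]]]) (assumption, rule that)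
    obtain d C \<tau> where d: "d > 0" "C > 0" "0 < \<tau>" "\<tau> < 1"
      "\<And>T N. norm (T - L t) < d \<Longrightarrow> norm (blpow T N) \<le> C * \<tau> ^ N"
      by (rule blpow_locally_uniform_geometric_bound[OF k(2,1)]) (rule that)
    have "isCont L t" using cont by (simp add: continuous_on_eq_continuous_at)
    then obtain e where e: "e > 0" "\<And>y. dist y t < e \<Longrightarrow> dist (L y) (L t) < d"
      using d(1) unfolding continuous_at_eps_delta by blast
    obtain m :: nat where m: "max C (1 / (1 - \<tau>)) < real m" using reals_Archimedean2 by blast
    have "\<tau> \<le> \<theta> m"
    proof -
      have "1 / (1 - \<tau>) \<le> real m + 2" using m by simp
      then have "1 / (real m + 2) \<le> 1 - \<tau>" using d(4) by (simp add: field_simps)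
      then show ?thesis by (simp add: \<theta>_def)
    qed
    have "P m y" if y: "dist y t < e" for y
      unfolding P_def
    proof
      fix N
      have "norm (blpow (L y) N) \<le> C * \<tau> ^ N" using e(2)[OF y] by (intro d(5)) (simp add: dist_norm)
      also have "\<dots> \<le> real m * \<theta> m ^ N"
        using m d \<open>\<tau> \<le> \<theta> m\<close> by (intro mult_mono power_mono) auto
      finally show "norm (blpow (L y) N) \<le> real m * \<theta> m ^ N" .
    qed
    then show "\<exists>e>0. \<exists>n. \<forall>y\<in>K. dist y t < e \<longrightarrow> P n y" using e(1) by blast
  qed (rule that)
  show ?thesis
  proof (rule that[of "real n + 1" "\<theta> n"])
    fix t N assume "t \<in> K"
    then have "norm (blpow (L t) N) \<le> real n * \<theta> n ^ N" using n by (simp add: P_def)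
    also have "\<dots> \<le> (real n + 1) * \<theta> n ^ N" using \<theta>(1)[of n] by (intro mult_right_mono) auto
    finally show "norm (blpow (L t) N) \<le> (real n + 1) * \<theta> n ^ N" .
  qed (use \<theta> in auto)
qed

text \<open>Splitting \<open>N\<close> into \<open>m\<close> nearly equal blocks turns the power \<open>N powr - r2\<close> into an arbitrarily high one,
  at the price of a constant factor in the range of \<open>t\<close>.\<close>

lemma large_frequency_bound:
  fixes L :: "real \<Rightarrow> ('b::real_normed_vector \<Rightarrow>\<^sub>L 'b)"
  assumes pos: "r1 > 0" "r2 > 0"
    and A4: "\<And>t N. real N > N0 \<Longrightarrow> K \<le> \<bar>t\<bar> \<Longrightarrow> \<bar>t\<bar> \<le> real N powr r1 \<Longrightarrow>
        norm (blpow (L t) N) \<le> real N powr (- r2)"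
  obtains c C N1 where "c > 0" "C > 0" "\<And>t N. N \<ge> N1 \<Longrightarrow> K \<le> \<bar>t\<bar> \<Longrightarrow> \<bar>t\<bar> \<le> c * real N powr r1 \<Longrightarrow>
    norm (blpow (L t) N) \<le> C / (real N)\<^sup>2"
proof -
  \<comment> \<open>\<open>p\<close> blocks with decay q^(- r2) each give at least the power -2 of
    q.\<close>
  obtain p :: nat where p: "2 / r2 < real p" using reals_Archimedean2 by blast
  have rp: "2 \<le> r2 * real p" using p pos by (simp add: field_simps)
  define m where "m = real p + 1"
  \<comment> \<open>Large enough for the block length q to be at least N / (2m) and to exceed
    \<open>N0\<close>, so that (A4) applies to every block.\<close>
  obtain N2 :: nat where N2: "2 * m * (\<bar>N0\<bar> + 1) < real N2" using reals_Archimedean2 by blast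
  have m1: "m \<ge> 1" by (simp add: m_def)
  show ?thesis
  proof (rule that[of "(1 / (2 * m)) powr r1" "(2 * m)\<^sup>2" N2])
    fix t N assume N: "N \<ge> N2" and tK: "K \<le> \<bar>t\<bar>" and t: "\<bar>t\<bar> \<le> (1 / (2 * m)) powr r1 * real N powr r1"
    define q where "q = N div Suc p"
    define r where "r = N mod Suc p"
    \<comment> \<open>The remainder r is merged into the last block, since (A4) says nothing about
      short blocks; that block is merely bounded by 1.\<close>
    have Nq: "N = q * p + (q + r)"
      unfolding q_def r_def by (metis add.assoc add.commute div_mult_mod_eq mult_Suc_right)
    have "r < Suc p" by (simp add: r_def)
    then have "real N < m * real q + m" unfolding m_def by (subst Nq) (simp add: algebra_simps)
    moreover have "2 * m * (\<bar>N0\<bar> + 1) < real N" using N2 N by simp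
    moreover have "2 * m \<le> 2 * m * (\<bar>N0\<bar> + 1)" using m1 by (simp add: mult_le_cancel_left1)
    ultimately have "real N \<le> 2 * m * real q" by linarith
    then have qN: "real N / (2 * m) \<le> real q" using m1 by (simp add: field_simps)
    have "\<bar>N0\<bar> + 1 < real N / (2 * m)" using \<open>2 * m * (\<bar>N0\<bar> + 1) < real N\<close> m1 by (simp add: field_simps)
    then have qN0: "real q > N0" "real q \<ge> 1" using qN by linarith+
    have "(1 / (2 * m)) powr r1 * real N powr r1 = (real N / (2 * m)) powr r1"
      using m1 by (simp add: powr_mult[symmetric])
    also have "\<dots> \<le> real q powr r1" using qN pos m1 by (intro powr_mono2) auto
    finally have tq: "\<bar>t\<bar> \<le> real q powr r1" using t by linarith
    have tqr: "\<bar>t\<bar> \<le> real (q + r) powr r1"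
      using tq powr_mono2[of r1 "real q" "real (q + r)"] pos by simp
    have "norm (blpow (L t) N) \<le> norm (blpow (L t) (q * p)) * norm (blpow (L t) (q + r))"
      by (subst Nq) (rule norm_blpow_add)
    also have "\<dots> \<le> (real q powr (- r2)) ^ p * 1"
    proof (intro mult_mono)
      have "norm (blpow (L t) (q * p)) \<le> norm (blpow (L t) q) ^ p" by (rule norm_blpow_mult)
      also have "\<dots> \<le> (real q powr (- r2)) ^ p" by (intro power_mono A4 qN0 tK tq) auto
      finally show "norm (blpow (L t) (q * p)) \<le> (real q powr (- r2)) ^ p" .
      have "norm (blpow (L t) (q + r)) \<le> real (q + r) powr (- r2)"
        using qN0 by (intro A4 tK tqr) auto
      also have "\<dots> \<le> real (q + r) powr 0" using qN0 pos by (intro powr_mono) auto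
      finally show "norm (blpow (L t) (q + r)) \<le> 1" using qN0 by simp
    qed auto
    also have "\<dots> = real q powr (- (r2 * real p))"
      using qN0 by (simp add: powr_realpow[symmetric] powr_powr)
    also have "\<dots> \<le> real q powr (- 2)" using rp qN0 by (intro powr_mono) auto
    also have "\<dots> = 1 / (real q)\<^sup>2" using qN0 by (simp add: powr_minus_divide)
    also have "\<dots> \<le> 1 / (real N / (2 * m))\<^sup>2"
      using qN qN0 m1 \<open>\<bar>N0\<bar> + 1 < real N / (2 * m)\<close> by (intro divide_left_mono power_mono mult_pos_pos zero_less_power) auto
    also have "\<dots> = (2 * m)\<^sup>2 / (real N)\<^sup>2" by (simp add: power_divide)
    finally show "norm (blpow (L t) N) \<le> (2 * m)\<^sup>2 / (real N)\<^sup>2" .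
  qed (use m1 in auto)
qed

lemma cdfw_lipschitz:
  assumes "weighted_line lborel h" and m: "\<And>x. \<bar>h x\<bar> \<le> m" and s: "0 \<le> s"
  shows "weighted_line.cdfw lborel h (x + s) - weighted_line.cdfw lborel h x \<le> m * s"
proof -
  interpret weighted_line lborel h by fact
  have i: "integrable lborel (\<lambda>y. h y * indicator {..z} y)" for z
    using integrable_h_mult[of "indicator {..z} :: real \<Rightarrow> real"] by (simp add: indicator_def)
  have "cdfw (x + s) - cdfw x = (\<integral>y. h y * indicator {..x + s} y - h y * indicator {..x} y \<partial>lborel)"
    unfolding cdfw_def by (intro Bochner_Integration.integral_diff[symmetric] i)
  also have "\<dots> \<le> (\<integral>y. m * indicator {x<..x + s} y \<partial>lborel)"
  proof (rule integral_mono)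
    show "integrable lborel (\<lambda>y. h y * indicator {..x + s} y - h y * indicator {..x} y)"
      by (intro Bochner_Integration.integrable_diff i)
    show "integrable lborel (\<lambda>y. m * indicator {x<..x + s} y)" by simp
    show "h y * indicator {..x + s} y - h y * indicator {..x} y \<le> m * indicator {x<..x + s} y" for y
      using m[of y] s by (auto simp: indicator_def abs_le_iff)
  qed
  also have "\<dots> = m * s" using s by simp
  finally show ?thesis .
qed


subsection \<open>The Edgeworth expansion\<close>

lemma char_normal_distribution: 
  assumes "s > 0"
  shows "char (density lborel (normal_density 0 (sqrt s))) t = exp (- of_real (s * t\<^sup>2 / 2))"
proof -
  have "char (density lborel (normal_density 0 (sqrt s))) t = (CLBINT x. normal_density 0 (sqrt s) x *\<^sub>R iexp (t * x))"
    unfolding char_def by (subst integral_density) auto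
  also have "\<dots> = gfourier s 1 t"
    unfolding gfourier_def[OF assms]
    by (intro Bochner_Integration.integral_cong refl)
      (simp add: gpoly_def[OF assms] nfrak_normal_density[OF assms] scaleR_conv_of_real cis_conv_exp)
  finally show ?thesis unfolding gfourier_1[OF assms] .
qed

lemma char_estimate_integral:
  fixes T a b :: real
  assumes "T > 0" "a \<ge> 0" "b \<ge> 0"
  shows "integrable lborel (\<lambda>t. indicator {0..T} t * (a * inverse (1 + t\<^sup>2) + b))"
    and "(\<integral>t. indicator {0..T} t * (a * inverse (1 + t\<^sup>2) + b) \<partial>lborel) \<le> a * (\<integral>t. inverse (1 + t\<^sup>2) \<partial>lborel) + b * T"
proof -
  have i1: "integrable lborel (\<lambda>t. indicator {0..T} t * inverse (1 + t\<^sup>2))"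
    by (rule Bochner_Integration.integrable_bound[OF integrable_inverse_1_plus_sq]) (auto simp: indicator_def)
  have eq: "indicator {0..T} t * (a * inverse (1 + t\<^sup>2) + b) = a * (indicator {0..T} t * inverse (1 + t\<^sup>2)) + b * indicator {0..T} t" for t
    by (simp add: algebra_simps)
  show "integrable lborel (\<lambda>t. indicator {0..T} t * (a * inverse (1 + t\<^sup>2) + b))"
    unfolding eq by (intro Bochner_Integration.integrable_add integrable_mult_right i1 integrable_indicator_interval)
  have "(\<integral>t. indicator {0..T} t * (a * inverse (1 + t\<^sup>2) + b) \<partial>lborel)
      = a * (\<integral>t. indicator {0..T} t * inverse (1 + t\<^sup>2) \<partial>lborel) + b * T"
    unfolding eq using i1 assms by simp
  also have "(\<integral>t. indicator {0..T} t * inverse (1 + t\<^sup>2) \<partial>lborel) \<le> (\<integral>t. inverse (1 + t\<^sup>2) \<partial>lborel)"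
    using i1 integrable_inverse_1_plus_sq by (intro integral_mono) (auto simp: indicator_def)
  finally show "(\<integral>t. indicator {0..T} t * (a * inverse (1 + t\<^sup>2) + b) \<partial>lborel) \<le> a * (\<integral>t. inverse (1 + t\<^sup>2) \<partial>lborel) + b * T"
    using assms(2) by (simp add: mult_left_mono)
qed

theorem theorem2p3:
  fixes M :: "'a measure" and X :: "nat \<Rightarrow> 'a \<Rightarrow> real"
    and L :: "real \<Rightarrow> ('b::{complex_normed_vector, banach} \<Rightarrow>\<^sub>L 'b)"
    and v :: 'b and l :: "'b \<Rightarrow>\<^sub>L complex"
    and s :: nat and \<delta> K r1 r2 N0 A \<sigma>2 :: real
  assumes prob: "prob_space M"
    and rv: "\<And>n. X n \<in> borel_measurable M"
    and lin_L: "\<And>t. clinear_op (L t)"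
    and lin_l: "clinear_fun l"
    and charf: "\<And>t N. N \<ge> 1 \<Longrightarrow>
        (CLINT \<omega>|M. cis (t * (\<Sum>n=1..N. X n \<omega>))) = l (blpow (L t) N v)"
    (* (A1) *)
    and A1_cont: "continuous_on UNIV L"
    and A1_s: "s \<ge> 4" and A1_delta: "\<delta> > 0"
    and A1_diff: "\<exists>D :: nat \<Rightarrow> real \<Rightarrow> ('b \<Rightarrow>\<^sub>L 'b).
        (\<forall>t\<in>{-\<delta>..\<delta>}. D 0 t = L t) \<and>
        (\<forall>k<s. \<forall>t\<in>{-\<delta>..\<delta>}. (D k has_vector_derivative D (Suc k) t) (at t within {-\<delta>..\<delta>})) \<and>
        continuous_on {-\<delta>..\<delta>} (D s)"
    (* (A2) *)
    and A2_isol: "isolated_in_spectrum (L 0) 1"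
    and A2_simple: "simple_eigenvalue (L 0) 1"
    and A2_other: "\<And>z. z \<in> eigenvalues (L 0) \<Longrightarrow> z \<noteq> 1 \<Longrightarrow> cmod z < 1"
    and A2_ess: "\<exists>\<rho><1. ess_spectrum (L 0) \<subseteq> cball 0 \<rho>"
    (* (A3) *)
    and A3: "\<And>t. t \<noteq> 0 \<Longrightarrow> op_spectrum (L t) \<subseteq> ball 0 1"
    (* (A4) *)
    and A4_pos: "K > 0" "r1 > 0" "r2 > 0" "N0 > 0"
    and A4: "\<And>t N. real N > N0 \<Longrightarrow> K \<le> \<bar>t\<bar> \<Longrightarrow> \<bar>t\<bar> \<le> real N powr r1 \<Longrightarrow>
        norm (blpow (L t) N) \<le> real N powr (- r2)"
    (* CLT with A and positive variance *)
    and sigma_pos: "\<sigma>2 > 0"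
    and CLT: "weak_conv_m
        (\<lambda>N. distr M borel (\<lambda>\<omega>. ((\<Sum>n=1..N. X n \<omega>) - real N * A) / sqrt (real N)))
        (density lborel (normal_density 0 (sqrt \<sigma>2)))"
  shows "\<exists>P1 :: real poly. \<exists>C N1. \<forall>N \<ge> N1. \<forall>z.
     \<bar>measure M {\<omega> \<in> space M. ((\<Sum>n=1..N. X n \<omega>) - real N * A) / sqrt (real N) \<le> z}
       - (Nfrak \<sigma>2 z + poly P1 z / sqrt (real N) * nfrak \<sigma>2 z)\<bar>
     \<le> C / real N powr (min 1 (1/2 + r1))"
proof -

  \<comment> \<open>Characteristic functions of the normalised sums\<close>
  interpret prob_space M by (rule prob)
  note [measurable] = rv
  define \<phi> where "\<phi> N t = l (blpow (L t) N v)" for N t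
  define S where "S N \<omega> = (\<Sum>n=1..N. X n \<omega>)" for N \<omega>
  have S_meas [measurable]: "S N \<in> borel_measurable M" for N unfolding S_def by measurable
  have \<phi>: "\<phi> N t = (CLINT \<omega>|M. cis (t * S N \<omega>))" if "N \<ge> 1" for N t
    using charf[OF that] by (simp add: \<phi>_def S_def)
  have \<phi>_conj: "\<phi> N (- t) = cnj (\<phi> N t)" if "N \<ge> 1" for N t
  proof -
    have "\<phi> N (- t) = (CLINT \<omega>|M. cnj (cis (t * S N \<omega>)))" unfolding \<phi>[OF that] by (simp add: cis_cnj)
    then show ?thesis unfolding \<phi>[OF that] by simp
  qed
  have \<phi>_0: "\<phi> N 0 = 1" if "N \<ge> 1" for N
    unfolding \<phi>[OF that] by (simp add: prob_space)
  obtain D :: "nat \<Rightarrow> real \<Rightarrow> ('b \<Rightarrow>\<^sub>L 'b)" where D: "\<forall>t\<in>{-\<delta>..\<delta>}. D 0 t = L t"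
    "\<forall>k<s. \<forall>t\<in>{-\<delta>..\<delta>}. (D k has_vector_derivative D (Suc k) t) (at t within {-\<delta>..\<delta>})"
    "continuous_on {-\<delta>..\<delta>} (D s)"
    using A1_diff by blast
  have "jet s (D 0)" by (rule jet_of_derivatives[where D = D and s = s, OF A1_delta _ D(3)]) (use D(2) in blast)
  moreover have "\<forall>\<^sub>F t in nhds 0. D 0 t = L t"
    using eventually_abs_le_nhds_0[OF A1_delta] by eventually_elim (use D(1) in \<open>simp add: abs_le_iff\<close>)
  ultimately have "jet s L" by (rule jet_cong[rotated])
  then have jet_L: "jet (Suc 3) L" by (rule jet_mono) (use A1_s in simp)
  obtain d C \<theta> lam mu where loc: "d > 0" "C > 0" "0 < \<theta>" "\<theta> < 1"
    "jet (Suc 3) lam" "jet (Suc 3) mu" "lam 0 = 1"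
    "\<And>t N. \<bar>t\<bar> \<le> d \<Longrightarrow> N \<ge> 1 \<Longrightarrow> cmod (l (blpow (L t) N v) - lam t ^ N * mu t) \<le> C * \<theta> ^ N"
    "\<And>t N. \<bar>t\<bar> \<le> d \<Longrightarrow> N \<ge> 1 \<Longrightarrow>
      cmod ((l (blpow (L t) N v) - lam t ^ N * mu t) - (l (blpow (L 0) N v) - lam 0 ^ N * mu 0)) \<le> C * N * \<theta> ^ N * \<bar>t\<bar>"
    by (rule leading_term_of_powers[OF lin_L lin_l jet_L A2_isol A2_simple A2_other A2_ess, where v = v])
      (assumption, assumption, rule that)
  have jets: "jet 4 lam" "jet 4 mu"
  proof -
    have four: "(4::nat) = Suc 3" by simp
    show "jet 4 lam" "jet 4 mu" unfolding four by (rule loc(5), rule loc(6))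
  qed
  define Y where "Y N \<omega> = (S N \<omega> - real N * A) / sqrt (real N)" for N \<omega>
  have Y_meas [measurable]: "Y N \<in> borel_measurable M" for N unfolding Y_def by measurable
  define \<mu> where "\<mu> N = distr M borel (Y N)" for N
  have rd: "real_distribution (\<mu> N)" for N unfolding \<mu>_def by (rule real_distribution_distr) simp
  have char_\<mu>: "(CLINT x|\<mu> N. cis (t * x)) = \<phi> N (t / sqrt (real N)) * cis (- (t * sqrt (real N) * A))" if N: "N \<ge> 1" for N t
  proof -
    have n: "sqrt (real N) > 0" using N by simp
    have "(CLINT x|\<mu> N. cis (t * x)) = (CLINT \<omega>|M. cis (t * Y N \<omega>))"
      unfolding \<mu>_def cis_conv_exp by (rule integral_distr) auto
    also have "\<dots> = (CLINT \<omega>|M. cis (t / sqrt (real N) * S N \<omega>) * cis (- (t * sqrt (real N) * A)))"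
    proof (intro Bochner_Integration.integral_cong refl)
      fix \<omega>
      have "t * Y N \<omega> = t / sqrt (real N) * S N \<omega> + - (t * (real N / sqrt (real N)) * A)"
        by (simp add: Y_def diff_divide_distrib right_diff_distrib)
      also have "real N / sqrt (real N) = sqrt (real N)" by (simp add: real_div_sqrt)
      finally have "t * Y N \<omega> = t / sqrt (real N) * S N \<omega> + - (t * sqrt (real N) * A)" .
      then show "cis (t * Y N \<omega>) = cis (t / sqrt (real N) * S N \<omega>) * cis (- (t * sqrt (real N) * A))"
        by (simp add: cis_mult)
    qed
    also have "\<dots> = \<phi> N (t / sqrt (real N)) * cis (- (t * sqrt (real N) * A))"
      unfolding \<phi>[OF N] by (rule integral_mult_left_zero)
    finally show ?thesis .
  qed
  \<comment> \<open>Levy's continuity theorem turns the assumed limit law into the form that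
    determines the Taylor coefficients.\<close>
  have clt: "(\<lambda>N. \<phi> N (t / sqrt (real N)) * cis (- (t * sqrt (real N) * A))) \<longlonglongrightarrow> exp (- of_real (\<sigma>2 * t\<^sup>2 / 2))" for t
  proof -
    have "real_distribution (density lborel (normal_density 0 (sqrt \<sigma>2)))"
      unfolding real_distribution_def real_distribution_axioms_def
      using prob_space_normal_density[of "sqrt \<sigma>2" 0] sigma_pos by simp
    then have "(\<lambda>N. char (\<mu> N) t) \<longlonglongrightarrow> char (density lborel (normal_density 0 (sqrt \<sigma>2))) t"
      using CLT rd by (intro levy_continuity1) (simp_all add: \<mu>_def Y_def[abs_def] S_def)
    moreover have "\<forall>\<^sub>F N in sequentially. char (\<mu> N) t = \<phi> N (t / sqrt (real N)) * cis (- (t * sqrt (real N) * A))"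
      using eventually_ge_at_top[of 1]
      by eventually_elim (simp only: char_def cis_conv_exp[symmetric] char_\<mu>)
    ultimately show ?thesis
      unfolding char_normal_distribution[OF sigma_pos] by (rule Lim_transform_eventually)
  qed
  obtain \<kappa> \<mu>1 d' C' where edge: "d' > 0" "C' > 0"
    "\<And>N t. N \<ge> 1 \<Longrightarrow> \<bar>t\<bar> \<le> d' * sqrt (real N) \<Longrightarrow>
      cmod (\<phi> N (t / sqrt (real N)) * cis (- (t * sqrt (real N) * A))
        - exp (- of_real (\<sigma>2 * t\<^sup>2 / 2)) * (1 + \<i> * of_real ((\<mu>1 * t + \<kappa> * t ^ 3) / sqrt (real N))))
      \<le> C' * \<bar>t\<bar> * (1 / (real N * (1 + t\<^sup>2)) + 1 / (real N)\<^sup>2)"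
    by (rule edgeworth_char_expansion[OF \<phi>_conj \<phi>_0 loc(1-4) jets loc(7) loc(8,9)[folded \<phi>_def] sigma_pos clt])
      (assumption | rule that)+

  \<comment> \<open>Frequencies away from the origin\<close>
  define K' where "K' = max K d'"
  have "op_spectrum (L t) \<subseteq> ball 0 1" if "t \<in> {d'..K'}" for t
    using that edge(1) by (intro A3) auto
  then obtain C2 \<theta>2 where mid: "C2 > 0" "0 < \<theta>2" "\<theta>2 < 1" "\<And>t N. t \<in> {d'..K'} \<Longrightarrow> norm (blpow (L t) N) \<le> C2 * \<theta>2 ^ N"
    using compact_uniform_geometric_bound[OF lin_L A1_cont compact_Icc] by metis
  obtain G2 where G2: "G2 > 0" "\<And>N. N \<ge> 1 \<Longrightarrow> real N ^ 2 * \<theta>2 ^ N \<le> G2"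
    by (rule power_geometric_bound[OF mid(2,3)]) (rule that)
  obtain c C3 N2 where big: "c > 0" "C3 > 0" "\<And>t N. N \<ge> N2 \<Longrightarrow> K \<le> \<bar>t\<bar> \<Longrightarrow> \<bar>t\<bar> \<le> c * real N powr r1 \<Longrightarrow>
    norm (blpow (L t) N) \<le> C3 / (real N)\<^sup>2"
    by (rule large_frequency_bound[OF A4_pos(2,3) A4]) (assumption | rule that)+
  obtain C4 where tail: "C4 > 0" "\<And>N t. N \<ge> 1 \<Longrightarrow> d' * sqrt (real N) \<le> t \<Longrightarrow>
    cmod (exp (- of_real (\<sigma>2 * t\<^sup>2 / 2)) * (1 + \<i> * of_real ((\<mu>1 * t + \<kappa> * t ^ 3) / sqrt (real N))))
      \<le> C4 * t * (1 / (real N * (1 + t\<^sup>2)))"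
    by (rule gaussian_tail_bound[OF sigma_pos edge(1)]) (rule that)
  define k where "k = min 1 (1/2 + r1)"
  have k: "k \<le> 1" "k - 1/2 \<le> r1" "0 \<le> k" using A4_pos(2) by (auto simp: k_def)
  \<comment> \<open>At the scale of the unnormalised sums the cut-off is c N^(k - 1/2) \<le> c N^r1,
    the range covered by \<open>big\<close>.\<close>
  define T where "T N = c * real N powr k" for N :: nat
  \<comment> \<open>The division by d' prepares for the factor t required by the smoothing bound: in
    this range t \<ge> d'.\<close>
  define C5 where "C5 = norm l * norm v * (C2 * G2 + C3) / d'"
  have C5: "C5 \<ge> 0" using mid(1) G2(1) big(2) edge(1) by (simp add: C5_def)
  have \<phi>_far: "cmod (\<phi> N u) \<le> C5 * d' * (1 / (real N)\<^sup>2)"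
    if N: "N \<ge> 1" "N \<ge> N2" and u: "d' \<le> u" "u \<le> c * real N powr r1" for N u
  proof -
    have "norm (blpow (L u) N) \<le> (C2 * G2 + C3) / (real N)\<^sup>2"
    proof (cases "u \<le> K'")
      case True
      have "norm (blpow (L u) N) \<le> C2 * \<theta>2 ^ N" using u True by (intro mid(4)) auto
      also have "\<dots> = C2 * (real N ^ 2 * \<theta>2 ^ N) / (real N)\<^sup>2" using N by simp
      also have "\<dots> \<le> (C2 * G2 + C3) / (real N)\<^sup>2"
      proof (rule divide_right_mono)
        have "C2 * (real N ^ 2 * \<theta>2 ^ N) \<le> C2 * G2" using mid(1) by (intro mult_left_mono G2(2) N) auto
        then show "C2 * (real N ^ 2 * \<theta>2 ^ N) \<le> C2 * G2 + C3" using big(2) by linarith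
      qed simp
      finally show ?thesis .
    next
      case False
      have "norm (blpow (L u) N) \<le> C3 / (real N)\<^sup>2"
        using False u edge(1) N by (intro big(3)) (auto simp: K'_def)
      also have "\<dots> \<le> (C2 * G2 + C3) / (real N)\<^sup>2" using mid(1) G2(1) by (intro divide_right_mono) auto
      finally show ?thesis .
    qed
    then have "norm l * (norm (blpow (L u) N) * norm v) \<le> norm l * (((C2 * G2 + C3) / (real N)\<^sup>2) * norm v)"
      by (intro mult_left_mono mult_right_mono) auto
    moreover have "cmod (\<phi> N u) \<le> norm l * (norm (blpow (L u) N) * norm v)"
      unfolding \<phi>_def by (rule order_trans[OF norm_blinfun mult_left_mono[OF norm_blinfun norm_ge_zero]])
    ultimately have "cmod (\<phi> N u) \<le> norm l * (((C2 * G2 + C3) / (real N)\<^sup>2) * norm v)" by (rule order_trans[rotated])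
    also have "\<dots> = C5 * d' * (1 / (real N)\<^sup>2)" using edge(1) by (simp add: C5_def mult_ac)
    finally show ?thesis .
  qed
  define C6 where "C6 = C' + C4 + C5"
  have C6: "C6 > 0" "C' \<le> C6" "C4 \<le> C6" "C5 \<le> C6" using edge(2) tail(1) C5 by (auto simp: C6_def)
  \<comment> \<open>The first term is integrable over the whole line. The second is constant in t
    and is integrated over [0, T N] with T N \<le> c N, so both contribute O(1/N).\<close>
  define H where "H N t = (C6 / real N) * inverse (1 + t\<^sup>2) + C6 / (real N)\<^sup>2" for N :: nat and t :: real
  have main: "cmod (\<phi> N (t / sqrt (real N)) * cis (- (t * sqrt (real N) * A))
        - exp (- of_real (\<sigma>2 * t\<^sup>2 / 2)) * (1 + \<i> * of_real ((\<mu>1 * t + \<kappa> * t ^ 3) / sqrt (real N))))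
      \<le> t * H N t" if N: "N \<ge> 1" "N \<ge> N2" and t: "0 < t" "t \<le> T N" for N t
  proof -
    have H_eq: "t * H N t = C6 * t * (1 / (real N * (1 + t\<^sup>2))) + C6 * t * (1 / (real N)\<^sup>2)"
    proof -
      have "t * ((C6 / n) * inverse q + C6 / n2) = C6 * t * (1 / (n * q)) + C6 * t * (1 / n2)" for n q n2 :: real
        by (simp add: divide_inverse algebra_simps inverse_mult_distrib)
      then show ?thesis unfolding H_def .
    qed
    have pos: "0 \<le> t * (1 / (real N * (1 + t\<^sup>2)))" "0 \<le> t * (1 / (real N)\<^sup>2)" using t by auto
    show ?thesis
    proof (cases "t \<le> d' * sqrt (real N)")
      case True
      have "C' * \<bar>t\<bar> * (1 / (real N * (1 + t\<^sup>2)) + 1 / (real N)\<^sup>2) = C' * (t * (1 / (real N * (1 + t\<^sup>2)))) + C' * (t * (1 / (real N)\<^sup>2))"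
        using t by (simp add: distrib_left)
      also have "\<dots> \<le> C6 * (t * (1 / (real N * (1 + t\<^sup>2)))) + C6 * (t * (1 / (real N)\<^sup>2))"
        by (intro add_mono mult_right_mono C6 pos)
      also have "\<dots> = t * H N t" unfolding H_eq by simp
      finally have le: "C' * \<bar>t\<bar> * (1 / (real N * (1 + t\<^sup>2)) + 1 / (real N)\<^sup>2) \<le> t * H N t" .
      have "\<bar>t\<bar> \<le> d' * sqrt (real N)" using True t by simp
      from order_trans[OF edge(3)[OF N(1) this] le] show ?thesis .
    next
      case False
      have n: "sqrt (real N) \<ge> 1" using N by simp
      let ?u = "t / sqrt (real N)"
      have u: "d' \<le> ?u" using False n by (simp add: pos_le_divide_eq)
      have "?u \<le> T N / sqrt (real N)" using t n by (intro divide_right_mono) auto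
      also have "\<dots> = c * real N powr (k - 1/2)" using N by (simp add: T_def powr_diff powr_half_sqrt)
      also have "\<dots> \<le> c * real N powr r1" using N k big(1) by (intro mult_left_mono powr_mono) auto
      finally have u2: "?u \<le> c * real N powr r1" .
      have td: "d' \<le> t"
      proof -
        have "d' * 1 \<le> d' * sqrt (real N)" using edge(1) n by (intro mult_left_mono) auto
        then show ?thesis using False by simp
      qed
      have "cmod (\<phi> N ?u * cis (- (t * sqrt (real N) * A))) \<le> C5 * d' * (1 / (real N)\<^sup>2)"
        using \<phi>_far[OF N u u2] by (simp add: norm_mult)
      also have "\<dots> \<le> C6 * t * (1 / (real N)\<^sup>2)"
        using C6 C5 td edge(1) by (intro mult_right_mono mult_mono) auto
      finally have 1: "cmod (\<phi> N ?u * cis (- (t * sqrt (real N) * A))) \<le> C6 * t * (1 / (real N)\<^sup>2)" .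
      have "cmod (exp (- of_real (\<sigma>2 * t\<^sup>2 / 2)) * (1 + \<i> * of_real ((\<mu>1 * t + \<kappa> * t ^ 3) / sqrt (real N)))) \<le> C4 * t * (1 / (real N * (1 + t\<^sup>2)))"
        using False by (intro tail(2) N) auto
      also have "\<dots> \<le> C6 * t * (1 / (real N * (1 + t\<^sup>2)))"
        using C6 t by (intro mult_right_mono) auto
      finally have 2: "cmod (exp (- of_real (\<sigma>2 * t\<^sup>2 / 2)) * (1 + \<i> * of_real ((\<mu>1 * t + \<kappa> * t ^ 3) / sqrt (real N)))) \<le> C6 * t * (1 / (real N * (1 + t\<^sup>2)))" .
      show ?thesis unfolding H_eq
        by (rule order_trans[OF norm_triangle_ineq4]) (use 1 2 in linarith)
    qed
  qed

  \<comment> \<open>The comparison density\<close>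
  define b where "b = \<kappa> / \<sigma>2\<^sup>2"
  \<comment> \<open>Matching - i t times the transform of P with i (\<mu>1 t + \<kappa> t^3) times
    the Gaussian means a + b \<sigma>2 - b \<sigma>2^2 t^2 = - \<mu>1 - \<kappa> t^2, which
    determines a and b.\<close>
  define a where "a = - \<mu>1 - \<kappa> / \<sigma>2"
  define P where "P = [:a, 0, b:]"
  define p where "p N = 1 + smult (1 / sqrt (real N)) (gderiv \<sigma>2 P)" for N :: nat
  have gP: "gfourier \<sigma>2 P t = of_real (- \<mu>1 - \<kappa> * t\<^sup>2) * exp (- of_real (\<sigma>2 * t\<^sup>2 / 2))" for t
  proof -
    have "a + b * \<sigma>2 - b * \<sigma>2\<^sup>2 * t\<^sup>2 = - \<mu>1 - \<kappa> * t\<^sup>2"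
      using sigma_pos by (simp add: a_def b_def field_simps power2_eq_square)
    then show ?thesis unfolding P_def gfourier_even_quadratic[OF sigma_pos] by simp
  qed
  have gp: "gfourier \<sigma>2 (p N) t = exp (- of_real (\<sigma>2 * t\<^sup>2 / 2)) * (1 + \<i> * of_real ((\<mu>1 * t + \<kappa> * t ^ 3) / sqrt (real N)))" for N t
    unfolding p_def gfourier_add[OF sigma_pos] gfourier_smult[OF sigma_pos] gfourier_gderiv[OF sigma_pos] gP gfourier_1[OF sigma_pos]
    by (simp add: algebra_simps add_divide_distrib power2_eq_square power3_eq_cube)
  obtain B0 where B0: "B0 > 0" "\<And>y. \<bar>gpoly \<sigma>2 1 y\<bar> \<le> B0" by (rule bounded_gpoly[OF sigma_pos]) (rule that)
  obtain B1 where B1: "B1 > 0" "\<And>y. \<bar>gpoly \<sigma>2 (gderiv \<sigma>2 P) y\<bar> \<le> B1" by (rule bounded_gpoly[OF sigma_pos]) (rule that)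
  \<comment> \<open>A bound on the comparison density for all N \<ge> 1, hence a slope bound for its
    distribution function.\<close>
  define m where "m = B0 + B1"
  have m: "m \<ge> 0" using B0 B1 by (simp add: m_def)
  have gp_le: "\<bar>gpoly \<sigma>2 (p N) y\<bar> \<le> m" if N: "N \<ge> 1" for N y
  proof -
    have "\<bar>gpoly \<sigma>2 (p N) y\<bar> \<le> \<bar>gpoly \<sigma>2 1 y\<bar> + (1 / sqrt (real N)) * \<bar>gpoly \<sigma>2 (gderiv \<sigma>2 P) y\<bar>"
      unfolding p_def gpoly_add[OF sigma_pos] gpoly_smult[OF sigma_pos]
      by (rule order_trans[OF abs_triangle_ineq]) (simp add: abs_mult)
    also have "\<dots> \<le> B0 + 1 * B1"
      using N by (intro add_mono mult_mono B0 B1) auto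
    finally show ?thesis by (simp add: m_def)
  qed
  have W1: "weighted_line (\<mu> N) (\<lambda>_. 1)" for N
  proof (rule weighted_line.intro)
    have pd: "prob_space (\<mu> N)" unfolding \<mu>_def by (rule prob_space_distr) simp
    show "sigma_finite_measure (\<mu> N)" by (rule prob_space_imp_sigma_finite[OF pd])
    show "sets (\<mu> N) = sets borel" by (simp add: \<mu>_def)
    show "integrable (\<mu> N) (\<lambda>_. 1 :: real)"
      by (rule finite_measure.integrable_const[OF prob_space.finite_measure[OF pd]])
  qed
  have W2: "weighted_line lborel (gpoly \<sigma>2 q)" for q
    by unfold_locales (auto intro!: integrable_gpoly[OF sigma_pos] simp: lborel.sigma_finite_countable)
  have cdf1: "weighted_line.cdfw (\<mu> N) (\<lambda>_. 1) z = measure M {\<omega> \<in> space M. Y N \<omega> \<le> z}" for N z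
  proof -
    interpret r: real_distribution "\<mu> N" by (rule rd)
    have "measure (\<mu> N) {..z} = measure M (Y N -` {..z} \<inter> space M)"
      unfolding \<mu>_def by (rule measure_distr) auto
    also have "Y N -` {..z} \<inter> space M = {\<omega> \<in> space M. Y N \<omega> \<le> z}" by auto
    finally show ?thesis by (simp add: weighted_line.cdfw_def[OF W1] r.emeasure_eq_measure)
  qed
  have cdf2: "weighted_line.cdfw lborel (gpoly \<sigma>2 (p N)) z = Nfrak \<sigma>2 z + poly P z / sqrt (real N) * nfrak \<sigma>2 z" for N z
  proof -
    have i: "integrable lborel (\<lambda>y. gpoly \<sigma>2 q y * indicator {..z} y)" for q
      using integrable_mult_indicator[OF _ integrable_gpoly[OF sigma_pos, of q], of "{..z}"] by (simp add: mult.commute)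
    have "weighted_line.cdfw lborel (gpoly \<sigma>2 (p N)) z
        = (\<integral>y. gpoly \<sigma>2 1 y * indicator {..z} y + (1 / sqrt (real N)) * (gpoly \<sigma>2 (gderiv \<sigma>2 P) y * indicator {..z} y) \<partial>lborel)"
      unfolding weighted_line.cdfw_def[OF W2] p_def gpoly_add[OF sigma_pos] gpoly_smult[OF sigma_pos]
      by (simp add: algebra_simps)
    also have "\<dots> = (\<integral>y. gpoly \<sigma>2 1 y * indicator {..z} y \<partial>lborel) + (1 / sqrt (real N)) * gpoly \<sigma>2 P z"
      using i by (simp add: integral_gpoly_gderiv[OF sigma_pos])
    also have "(\<integral>y. gpoly \<sigma>2 1 y * indicator {..z} y \<partial>lborel) = Nfrak \<sigma>2 z"
      by (simp add: Nfrak_def set_lebesgue_integral_def gpoly_def[OF sigma_pos] mult.commute)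
    finally show ?thesis by (simp add: gpoly_def[OF sigma_pos, of P z])
  qed

  \<comment> \<open>Smoothing and conclusion\<close>
  obtain C0 where C0: "C0 > 0"
    "\<And>(\<Delta> :: real \<Rightarrow> real) T m B \<eta> x. \<lbrakk>T > 0; m \<ge> 0; \<Delta> \<in> borel_measurable borel; \<And>x. \<bar>\<Delta> x\<bar> \<le> B;
      \<And>x s. 0 \<le> s \<Longrightarrow> \<Delta> x - m * s \<le> \<Delta> (x + s);
      \<And>b. \<bar>\<integral>w. fejer T w * \<Delta> (b + w) \<partial>lborel\<bar> \<le> \<eta>\<rbrakk> \<Longrightarrow> \<bar>\<Delta> x\<bar> \<le> C0 * (\<eta> + m / T)"
    by (rule sup_bound_of_smoothed) blast
  define J where "J = (\<integral>t. inverse (1 + (t::real)\<^sup>2) \<partial>lborel)"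
  have J: "J \<ge> 0" unfolding J_def by (intro integral_nonneg_AE) (auto intro!: AE_I2 add_nonneg_nonneg)
  define C7 where "C7 = C0 * (4 * (C6 * J + C6 * c) + m / c)"
  have final: "\<bar>measure M {\<omega> \<in> space M. Y N \<omega> \<le> z} - (Nfrak \<sigma>2 z + poly P z / sqrt (real N) * nfrak \<sigma>2 z)\<bar> \<le> C7 / real N powr k"
    if N: "N \<ge> max 1 N2" for N z
  proof -
    have N1: "N \<ge> 1" "N \<ge> N2" "real N \<ge> 1" using N by auto
    interpret a: weighted_line "\<mu> N" "\<lambda>_. 1" by (rule W1)
    interpret b: weighted_line lborel "gpoly \<sigma>2 (p N)" by (rule W2)
    have Tpos: "T N > 0" using big(1) N1 by (simp add: T_def)
    have NkN: "real N powr k \<le> real N" using powr_mono[of k 1 "real N"] k N1 by simp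
    have Nkpos: "real N powr k > 0" using N1 by simp
    have bound: "\<bar>\<integral>w. fejer (T N) w * (a.cdfw (y + w) - b.cdfw (y + w)) \<partial>lborel\<bar> \<le> 4 * ((C6 * J + C6 * c) / real N powr k)" for y
    proof -
      have nonneg: "C6 / real N \<ge> 0" "C6 / (real N)\<^sup>2 \<ge> 0" using C6 by auto
      have "\<bar>\<integral>w. fejer (T N) w * (a.cdfw (y + w) - b.cdfw (y + w)) \<partial>lborel\<bar> \<le> 4 * (\<integral>t. indicator {0..T N} t * H N t \<partial>lborel)"
      proof (rule fejer_smoothed_difference_bound[OF W1 W2 Tpos])
        show "integrable lborel (\<lambda>t. indicator {0..T N} t * H N t)"
          unfolding H_def by (rule char_estimate_integral(1)[OF Tpos nonneg])
        fix t assume t: "0 < t" "t \<le> T N"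
        have "a.charw t = \<phi> N (t / sqrt (real N)) * cis (- (t * sqrt (real N) * A))"
          unfolding a.charw_def using char_\<mu>[OF N1(1)] by simp
        moreover have "b.charw t = exp (- of_real (\<sigma>2 * t\<^sup>2 / 2)) * (1 + \<i> * of_real ((\<mu>1 * t + \<kappa> * t ^ 3) / sqrt (real N)))"
          unfolding b.charw_def gp[symmetric] gfourier_def[OF sigma_pos] ..
        ultimately show "cmod (a.charw t - b.charw t) \<le> t * H N t" using main[OF N1(1,2) t] by simp
      qed
      also have "(\<integral>t. indicator {0..T N} t * H N t \<partial>lborel) \<le> C6 / real N * J + C6 / (real N)\<^sup>2 * T N"
        unfolding H_def J_def by (rule char_estimate_integral(2)[OF Tpos nonneg])
      also have "\<dots> \<le> C6 / real N * J + C6 / (real N)\<^sup>2 * (c * real N)"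
        unfolding T_def using NkN big(1) C6 by (intro add_left_mono mult_left_mono) auto
      also have "\<dots> = (C6 * J + C6 * c) / real N" using N1 by (simp add: field_simps power2_eq_square)
      also have "\<dots> \<le> (C6 * J + C6 * c) / real N powr k"
        using NkN Nkpos C6 J big(1) N1 by (intro divide_left_mono) auto
      finally show ?thesis by simp
    qed
    have "\<bar>a.cdfw z - b.cdfw z\<bar> \<le> C0 * (4 * ((C6 * J + C6 * c) / real N powr k) + m / T N)"
    proof (rule C0(2)[of "T N" m "\<lambda>z. a.cdfw z - b.cdfw z"
          "(\<integral>x. \<bar>1\<bar> \<partial>\<mu> N) + (\<integral>x. \<bar>gpoly \<sigma>2 (p N) x\<bar> \<partial>lborel)" _ z, OF Tpos m])
      show "(\<lambda>z. a.cdfw z - b.cdfw z) \<in> borel_measurable borel" by measurable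
      show "\<bar>a.cdfw x - b.cdfw x\<bar> \<le> (\<integral>x. \<bar>1\<bar> \<partial>\<mu> N) + (\<integral>x. \<bar>gpoly \<sigma>2 (p N) x\<bar> \<partial>lborel)" for x
        using a.abs_cdfw_le[of x] b.abs_cdfw_le[of x] by linarith
      \<comment> \<open>Only downward slopes need control: the distribution function of the sum is
        monotone, jumps included, and the comparison function rises with slope at most m.\<close>
      show "a.cdfw x - b.cdfw x - m * s \<le> a.cdfw (x + s) - b.cdfw (x + s)" if s: "0 \<le> s" for x s
      proof -
        have "a.cdfw x \<le> a.cdfw (x + s)"
          unfolding cdf1 using s by (intro finite_measure_mono) auto
        moreover have "b.cdfw (x + s) - b.cdfw x \<le> m * s"
          by (rule cdfw_lipschitz[OF W2 gp_le[OF N1(1)] s])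
        ultimately show ?thesis by linarith
      qed
    qed (rule bound)
    also have "\<dots> = C7 / real N powr k"
      using Nkpos big(1) by (simp add: C7_def T_def field_simps)
    finally show ?thesis unfolding cdf1 cdf2 .
  qed
  show ?thesis
  proof (intro exI allI impI)
    fix N z assume "max 1 N2 \<le> N"
    then show "\<bar>measure M {\<omega> \<in> space M. ((\<Sum>n=1..N. X n \<omega>) - real N * A) / sqrt (real N) \<le> z}
       - (Nfrak \<sigma>2 z + poly P z / sqrt (real N) * nfrak \<sigma>2 z)\<bar> \<le> C7 / real N powr (min 1 (1/2 + r1))"
      using final[of N z] by (simp add: Y_def S_def k_def)
  qed
qed

end
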